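(* Let $V$ be a real function with $V\in L^p(\mathbb R^3)+\big(L^r(\mathbb R^3)\cap\dot W^{1,q}(\mathbb R^3)\big)+L^\infty_\epsilon(\mathbb R^3)$ for some $6<p<\infty$, $3<r\le6$ and $2<q<\infty$. Then $\mathrm{Spu}(D^0+V,P^0_+)=\emptyset$.
   Context: Units $m=c=1$, $p=-i\nabla$. $D^0=\boldsymbol\alpha\cdot p+\beta$ on $L^2(\mathbb R^3,\mathbb C^4)$ with $\beta=\mathrm{diag}(I_2,-I_2)$, $\alpha_k=\begin{pmatrix}0&\sigma_k\\\sigma_k&0\end{pmatrix}$, $\sigma_k$ Pauli matrices; $\sigma(D^0)=(-\infty,-1]\cup[1,\infty)$. Under the assumptions $D^0+V$ is self-adjoint with domain $H^1(\mathbb R^3,\mathbb C^4)$. $P^0_+=\chi_{(0,\infty)}(D^0)$. $L^r\cap\dot W^{1,q}=\{V\in L^r:\nabla V\in L^q\}$. $X+L^\infty_\epsilon$ is the set of $f\in X+L^\infty$ such that for every $\epsilon>0$ there is $f_\epsilon\in X$ with $\|f-f_\epsilon\|_\infty\le\epsilon$. For a self-adjoint $T$ and finite-dimensional $V\subset D(T)$, $T_{|V}$ is the restriction of $P_VTP_V$ to $V$. Given an orthogonal projector $P$, $\lambda\in\mathrm{Spu}(T,P)$ if there are finite-dimensional $V_n^+\subset P\mathfrak H\cap D(T)$, $V_n^-\subset(1-P)\mathfrak H\cap D(T)$, $V_n^\pm\subset V_{n+1}^\pm$, with $\bigcup_n(V_n^+\oplus V_n^-)$ dense in $D(T)$ for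 the graph norm, $\mathrm{dist}(\lambda,\sigma(T_{|V_n^+\oplus V_n^-}))\to0$, and $\lambda\notin\sigma(T)$. *)

theory Defs
  imports "HOL-Analysis.Analysis"
begin

type_synonym spinor = "complex ^ 4"
type_synonym wavefn = "real ^ 3 \<Rightarrow> spinor"

text \<open>Indices of C^4: 0,1 form the upper block, 2,3 the lower block.\<close>
definition blk :: "4 \<Rightarrow> nat" where "blk i = (if i = 0 \<or> i = 1 then 0 else 1)"
definition sub :: "4 \<Rightarrow> nat" where "sub i = (if i = 0 \<or> i = 2 then 0 else 1)"

text \<open>Pauli matrices sigma_1, sigma_2, sigma_3 (spatial index k :: 3, with 3 = 0 in type 3).\<close>
definition pauli :: "3 \<Rightarrow> nat \<Rightarrow> nat \<Rightarrow> complex" where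
  "pauli k a b =
     (if k = 1 then (if a \<noteq> b then 1 else 0)
      else if k = 2 then (if a = 0 \<and> b = 1 then - \<i> else if a = 1 \<and> b = 0 then \<i> else 0)
      else (if a = b then (if a = 0 then 1 else -1) else 0))"

definition beta :: "complex ^ 4 ^ 4" where
  "beta = (\<chi> i j. if i = j then (if blk i = 0 then 1 else -1) else 0)"

definition alpha :: "3 \<Rightarrow> complex ^ 4 ^ 4" where
  "alpha k = (\<chi> i j. if blk i \<noteq> blk j then pauli k (sub i) (sub j) else 0)"

definition cinner :: "spinor \<Rightarrow> spinor \<Rightarrow> complex" where
  "cinner v w = (\<Sum>i\<in>UNIV. cnj (v $ i) * w $ i)"

definition L2 :: "('a::euclidean_space \<Rightarrow> spinor) \<Rightarrow> bool" where
  "L2 u \<longleftrightarrow> u \<in> borel_measurable lborel \<and> integrable lborel (\<lambda>x. (norm (u x))\<^sup>2)"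

definition L2norm :: "('a::euclidean_space \<Rightarrow> spinor) \<Rightarrow> real" where
  "L2norm u = sqrt (\<integral>x. (norm (u x))\<^sup>2 \<partial>lborel)"

definition L2inner :: "wavefn \<Rightarrow> wavefn \<Rightarrow> complex" where
  "L2inner u w = (\<integral>x. cinner (u x) (w x) \<partial>lborel)"

definition Lp_real :: "real \<Rightarrow> (real ^ 3 \<Rightarrow> real) \<Rightarrow> bool" where
  "Lp_real p f \<longleftrightarrow> f \<in> borel_measurable lborel \<and> integrable lborel (\<lambda>x. \<bar>f x\<bar> powr p)"

definition pd :: "3 \<Rightarrow> (real ^ 3 \<Rightarrow> real) \<Rightarrow> real ^ 3 \<Rightarrow> real" where
  "pd k f x = frechet_derivative f (at x) (axis k 1)"

fun dpart :: "3 list \<Rightarrow> (real ^ 3 \<Rightarrow> real) \<Rightarrow> real ^ 3 \<Rightarrow> real" where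
  "dpart [] f = f"
| "dpart (k # ks) f = pd k (dpart ks f)"

definition test_fn :: "(real ^ 3 \<Rightarrow> real) \<Rightarrow> bool" where
  "test_fn \<phi> \<longleftrightarrow> (\<forall>ks x. dpart ks \<phi> differentiable (at x)) \<and> compact (closure {x. \<phi> x \<noteq> 0})"

definition loc_integrable :: "(real ^ 3 \<Rightarrow> 'b::{banach, second_countable_topology}) \<Rightarrow> bool" where
  "loc_integrable f \<longleftrightarrow> f \<in> borel_measurable lborel \<and> (\<forall>R. set_integrable lborel (cball 0 R) f)"

definition weak_deriv :: "(real ^ 3 \<Rightarrow> 'b::{banach, second_countable_topology}) \<Rightarrow> 3 \<Rightarrow> (real ^ 3 \<Rightarrow> 'b) \<Rightarrow> bool" where
  "weak_deriv f k g \<longleftrightarrow> loc_integrable f \<and> loc_integrable g \<and>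
     (\<forall>\<phi>. test_fn \<phi> \<longrightarrow>
        (\<integral>x. pd k \<phi> x *\<^sub>R f x \<partial>lborel) = - (\<integral>x. \<phi> x *\<^sub>R g x \<partial>lborel))"

definition H1 :: "wavefn \<Rightarrow> bool" where
  "H1 u \<longleftrightarrow> L2 u \<and> (\<forall>k. \<exists>g. L2 g \<and> weak_deriv u k g)"

definition wd :: "wavefn \<Rightarrow> 3 \<Rightarrow> wavefn" where
  "wd u k = (SOME g. L2 g \<and> weak_deriv u k g)"

definition Dop :: "(real ^ 3 \<Rightarrow> real) \<Rightarrow> wavefn \<Rightarrow> wavefn" where
  "Dop V u x = (\<Sum>k\<in>UNIV. (- \<i>) *s (alpha k *v wd u k x)) + beta *v u x + complex_of_real (V x) *s u x"

text \<open>Real lambda is in the resolvent set: D^0+V-lambda : H^1 -> L^2 is bijective (up to a.e.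
  equality) with bounded inverse.\<close>
definition in_resolvent :: "(real ^ 3 \<Rightarrow> real) \<Rightarrow> real \<Rightarrow> bool" where
  "in_resolvent V lam \<longleftrightarrow> (\<exists>C. \<forall>f. L2 f \<longrightarrow>
      (\<exists>u. H1 u \<and> (AE x in lborel. Dop V u x - complex_of_real lam *s u x = f x)) \<and>
      (\<forall>u. H1 u \<and> (AE x in lborel. Dop V u x - complex_of_real lam *s u x = f x)
             \<longrightarrow> L2norm u \<le> C * L2norm f))"

definition spec :: "(real ^ 3 \<Rightarrow> real) \<Rightarrow> real set" where
  "spec V = {lam. \<not> in_resolvent V lam}"

definition FT2 :: "wavefn \<Rightarrow> wavefn \<Rightarrow> bool" where
  "FT2 u uh \<longleftrightarrow> L2 uh \<and>
     ((\<lambda>R::nat. L2norm (\<lambda>\<xi>. uh \<xi> -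
        complex_of_real ((2 * pi) powr (-3/2)) *s
          (LINT x:cball 0 (real R)|lborel. exp (- \<i> * complex_of_real (x \<bullet> \<xi>)) *s u x)))
      \<longlonglongrightarrow> 0)"

text \<open>Symbol of D^0: alpha.xi + beta, and its positive spectral projector
  Lambda_+(xi) = (1 + (alpha.xi + beta)/sqrt(1+|xi|^2))/2 = chi_(0,inf)(alpha.xi+beta).\<close>
definition D0symb :: "real ^ 3 \<Rightarrow> complex ^ 4 ^ 4" where
  "D0symb \<xi> = (\<chi> i j. (\<Sum>k\<in>UNIV. complex_of_real (\<xi> $ k) * alpha k $ i $ j) + beta $ i $ j)"

definition Lam_plus :: "real ^ 3 \<Rightarrow> complex ^ 4 ^ 4" where
  "Lam_plus \<xi> = (\<chi> i j. ((if i = j then 1 else 0)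
       + D0symb \<xi> $ i $ j / complex_of_real (sqrt (1 + (norm \<xi>)\<^sup>2))) / 2)"

text \<open>Range of P^0_+ and of 1 - P^0_+ (as sets of L^2 representatives).\<close>
definition Pplus_space :: "wavefn set" where
  "Pplus_space = {u. L2 u \<and> (\<exists>uh. FT2 u uh \<and> (AE \<xi> in lborel. Lam_plus \<xi> *v uh \<xi> = uh \<xi>))}"

definition Pminus_space :: "wavefn set" where
  "Pminus_space = {u. L2 u \<and> (\<exists>uh. FT2 u uh \<and> (AE \<xi> in lborel. Lam_plus \<xi> *v uh \<xi> = 0))}"

definition cspan :: "wavefn set \<Rightarrow> wavefn set" where
  "cspan B = {(\<lambda>x. \<Sum>b\<in>B. c b *s b x) | c. True}"

definition fin_subspace :: "wavefn set \<Rightarrow> bool" where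
  "fin_subspace W \<longleftrightarrow> (\<exists>B. finite B \<and> W = cspan B)"

definition dsum :: "wavefn set \<Rightarrow> wavefn set \<Rightarrow> wavefn set" where
  "dsum A B = {(\<lambda>x. a x + b x) | a b. a \<in> A \<and> b \<in> B}"

text \<open>Spectrum of the compression T_{|W}: eigenvalues of P_W T P_W on W.\<close>
definition compr_spec :: "(real ^ 3 \<Rightarrow> real) \<Rightarrow> wavefn set \<Rightarrow> complex set" where
  "compr_spec V W = {\<mu>. \<exists>v\<in>W. L2norm v \<noteq> 0 \<and>
       (\<forall>w\<in>W. L2inner w (\<lambda>x. Dop V v x - \<mu> *s v x) = 0)}"

definition Spu :: "(real ^ 3 \<Rightarrow> real) \<Rightarrow> real set" where
  "Spu V = {lam. lam \<notin> spec V \<and>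
     (\<exists>Vp Vm :: nat \<Rightarrow> wavefn set.
        (\<forall>n. fin_subspace (Vp n) \<and> Vp n \<subseteq> Pplus_space \<inter> Collect H1) \<and>
        (\<forall>n. fin_subspace (Vm n) \<and> Vm n \<subseteq> Pminus_space \<inter> Collect H1) \<and>
        (\<forall>n. Vp n \<subseteq> Vp (Suc n) \<and> Vm n \<subseteq> Vm (Suc n)) \<and>
        (\<forall>u. H1 u \<longrightarrow> (\<forall>\<epsilon>>0. \<exists>n. \<exists>w\<in>dsum (Vp n) (Vm n).
             L2norm (\<lambda>x. u x - w x) + L2norm (\<lambda>x. Dop V u x - Dop V w x) < \<epsilon>)) \<and>
        (\<exists>\<mu>. (\<forall>\<^sub>F n in sequentially. \<mu> n \<in> compr_spec V (dsum (Vp n) (Vm n))) \<and>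
             \<mu> \<longlonglongrightarrow> complex_of_real lam))}"

definition Linf_real :: "(real ^ 3 \<Rightarrow> real) \<Rightarrow> bool" where
  "Linf_real f \<longleftrightarrow> f \<in> borel_measurable lborel \<and> (\<exists>C. AE x in lborel. \<bar>f x\<bar> \<le> C)"

definition Xclass :: "real \<Rightarrow> real \<Rightarrow> real \<Rightarrow> (real ^ 3 \<Rightarrow> real) \<Rightarrow> bool" where
  "Xclass p r q W \<longleftrightarrow> (\<exists>V1 V2. Lp_real p V1 \<and> Lp_real r V2 \<and>
      (\<forall>k. \<exists>g. Lp_real q g \<and> weak_deriv V2 k g) \<and> (\<forall>x. W x = V1 x + V2 x))"

definition Xclass_eps :: "real \<Rightarrow> real \<Rightarrow> real \<Rightarrow> (real ^ 3 \<Rightarrow> real) \<Rightarrow> bool" where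
  "Xclass_eps p r q V \<longleftrightarrow>
     (\<exists>W U. Xclass p r q W \<and> Linf_real U \<and> (\<forall>x. V x = W x + U x)) \<and>
     (\<forall>\<epsilon>>0. \<exists>W. Xclass p r q W \<and> (AE x in lborel. \<bar>V x - W x\<bar> \<le> \<epsilon>))"

end

theory Submission
  imports Defs "HOL-Probability.Probability"
begin

text \<open>
  The Dirac operator with the potential still has every real number of modulus at least 1 in its
  spectrum (Weyl sequence of spreading wave packets), so a spurious value lam satisfies |lam| < 1.
  Let v = a + b be a normalised Galerkin eigenvector with eigenvalue mu close to lam, where a and b
  lie in the positive and negative Galerkin space. Testing the Galerkin equation with a - b
  instead of v makes the cross terms of the real potential V cancel and leaves

    <v, |D0| v> = Re mu (|a|^2 - |b|^2) - <a, V a> + <b, V b>.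

  By density of the Galerkin spaces and lam being in the resolvent set, v tends weakly to 0, and so do a and b.
  The measure of {|V| > t} is finite for all t > 0 and decays faster than t^(-3), so that the form of V
  is compact relative to that of |D0|: the V-terms vanish in the limit. As |D0| \<ge> 1, this gives
  1 \<le> |lam|, a contradiction. The form bounds come from splitting each field into low
  frequencies (bounded pointwise) and high frequencies (small in the mean), with the threshold
  adapted to the size of each dyadic level set of V.
\<close>

section \<open>Square-integrable spinor fields\<close>

text \<open>The free operator is unbounded in both directions, so testing with the eigenvector
  itself controls no energy; flipping the sign of \<open>b\<close> is admissible because the
  Galerkin spaces respect the splitting of the free operator. The power t^(-3) is critical: if
  frequencies are split at m^(-1/3), a set of measure m carries mass O(m^(\<theta>/3)) of a field
  with finite \<open>En \<theta>\<close>. A level set of height t then contributes t^\<theta>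
  t^(-s\<theta>/3), summable over dyadic t for s > 3. One estimate serves two exponents: \<theta> =
  1 bounds the form of V on Galerkin vectors, and \<theta> = 2 bounds V as an operator from H1 to
  L2, for domain questions and for the Weyl sequence. Compactness is obtained by hand: weak
  convergence makes every low-pass part vanish pointwise, and the energy bound makes the remainder
  uniformly small. Only real parts of the Galerkin equation are taken, so the real pairing
  \<open>ip\<close> suffices and compressed eigenvalues may be treated as complex numbers.\<close>

lemma norm_smult_spinor [simp]: "norm (c *s (v::spinor)) = cmod c * norm v"
  by (simp add: norm_vec_def L2_set_def norm_mult power_mult_distrib
      sum_distrib_left[symmetric] real_sqrt_mult)

lemma smult_of_real_spinor: "complex_of_real r *s (v::spinor) = r *\<^sub>R v"
  by (rule vec_eq_iff[THEN iffD2]) (simp add: complex_eq_iff)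

lemma bounded_linear_smult_spinor: "bounded_linear (\<lambda>v::spinor. c *s v)"
  by (rule bounded_linear_intro[where K="cmod c"])
     (auto simp: vec_eq_iff algebra_simps)

lemma measurable_smult_spinor [measurable]:
  assumes [measurable]: "f \<in> borel_measurable M" "g \<in> borel_measurable M"
  shows "(\<lambda>x. f x *s (g x::spinor)) \<in> borel_measurable M"
proof -
  have "(\<lambda>p. fst p *s (snd p::spinor)) \<in> borel_measurable (borel :: (complex \<times> spinor) measure)"
  proof (rule borel_measurable_continuous_onI)
    have "continuous_on UNIV (\<lambda>p::complex \<times> spinor. \<chi> i. fst p * snd p $ i)"
      by (intro continuous_intros)
    then show "continuous_on UNIV (\<lambda>p::complex \<times> spinor. fst p *s snd p)"
      by (simp add: vector_scalar_mult_def)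
  qed
  then have "(\<lambda>x. fst (f x, g x) *s snd (f x, g x)) \<in> borel_measurable M"
    by (rule measurable_compose_rev) (simp add: borel_prod[symmetric])
  then show ?thesis by simp
qed

lemma Re_cinner: "Re (cinner v w) = v \<bullet> w"
  by (simp add: cinner_def inner_vec_def inner_complex_def)

lemma cinner_smult_left: "cinner (c *s v) w = cnj c * cinner v w"
  by (simp add: cinner_def sum_distrib_left mult.assoc)

lemma cinner_smult_right: "cinner v (c *s w) = c * cinner v w"
  by (simp add: cinner_def sum_distrib_left mult.left_commute)

lemma inner_smult_spinor: "(a *s v) \<bullet> (b *s (w::spinor)) = Re (cnj a * b * cinner v w)"
  by (simp only: Re_cinner[symmetric] cinner_smult_left cinner_smult_right mult.assoc mult.left_commute)

text \<open>Each of the four summands is at most the product of the norms. The crude factor 4 is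
  harmless, as the bound serves only to establish integrability.\<close>

lemma norm_cinner_le: "cmod (cinner v w) \<le> 4 * (norm v * norm w)"
proof -
  have "cmod (cinner v w) \<le> (\<Sum>i\<in>(UNIV::4 set). norm v * norm w)"
    unfolding cinner_def
    by (rule sum_norm_le) (simp add: norm_mult mult_mono Finite_Cartesian_Product.norm_nth_le)
  then show ?thesis by simp
qed

text \<open>The real part of the complex pairing \<open>L2inner\<close>. Norms, polarisation,
  Cauchy-Schwarz and the energy identities can all be expressed by it.\<close>

definition ip :: "wavefn \<Rightarrow> wavefn \<Rightarrow> real" where
  "ip u w = (\<integral>x. u x \<bullet> w x \<partial>lborel)"

lemma L2_measurable [measurable_dest]: "L2 u \<Longrightarrow> u \<in> borel_measurable borel"
  by (simp add: L2_def)

lemma L2_integrable: "L2 u \<Longrightarrow> integrable lborel (\<lambda>x. (norm (u x))\<^sup>2)"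
  by (simp add: L2_def)

lemma L2norm_nonneg [simp]: "0 \<le> L2norm u"
  by (simp add: L2norm_def)

lemma L2norm_power2: "(L2norm u)\<^sup>2 = (\<integral>x. (norm (u x))\<^sup>2 \<partial>lborel)"
  by (simp add: L2norm_def)

lemma L2norm_power2_ip: "(L2norm u)\<^sup>2 = ip u u"
  by (simp add: L2norm_power2 ip_def power2_norm_eq_inner)

text \<open>The common route for multipliers, truncations and matrices: one pointwise estimate
  yields both square integrability and the norm bound.\<close>

lemma L2_dominated:
  fixes u F :: wavefn
  assumes u: "L2 u" and F [measurable]: "F \<in> borel_measurable borel"
    and le: "AE x in lborel. norm (F x) \<le> C * norm (u x)" and C: "0 \<le> C"
  shows "L2 F" "L2norm F \<le> C * L2norm u"
proof -
  have le2: "AE x in lborel. (norm (F x))\<^sup>2 \<le> C\<^sup>2 * (norm (u x))\<^sup>2"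
    using le
  proof eventually_elim
    case (elim x)
    then show ?case
      using power_mono[OF elim norm_ge_zero, of 2] by (simp add: power_mult_distrib)
  qed
  have I: "integrable lborel (\<lambda>x. C\<^sup>2 * (norm (u x))\<^sup>2)"
    using L2_integrable[OF u] by simp
  have "integrable lborel (\<lambda>x. (norm (F x))\<^sup>2)"
    by (rule Bochner_Integration.integrable_bound[OF I]) (use le2 in auto)
  then show 1: "L2 F" by (simp add: L2_def)
  have "(L2norm F)\<^sup>2 \<le> (\<integral>x. C\<^sup>2 * (norm (u x))\<^sup>2 \<partial>lborel)"
    unfolding L2norm_power2 by (rule integral_mono_AE[OF L2_integrable[OF 1] I le2])
  also have "\<dots> = (C * L2norm u)\<^sup>2"
    by (simp add: L2norm_power2 power_mult_distrib)
  finally show "L2norm F \<le> C * L2norm u"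
    by (rule power2_le_imp_le) (simp add: C)
qed

lemma L2_add:
  fixes u w :: wavefn
  assumes u: "L2 u" and w: "L2 w" shows "L2 (\<lambda>x. u x + w x)"
proof -
  note [measurable] = L2_measurable[OF u] L2_measurable[OF w]
  have I: "integrable lborel (\<lambda>x. 2 * (norm (u x))\<^sup>2 + 2 * (norm (w x))\<^sup>2)"
    using L2_integrable[OF u] L2_integrable[OF w] by simp
  have "(norm (u x + w x))\<^sup>2 \<le> 2 * (norm (u x))\<^sup>2 + 2 * (norm (w x))\<^sup>2" for x
  proof -
    have "(norm (u x + w x))\<^sup>2 \<le> (norm (u x) + norm (w x))\<^sup>2"
      by (simp add: norm_triangle_ineq power_mono)
    also have "\<dots> \<le> 2 * (norm (u x))\<^sup>2 + 2 * (norm (w x))\<^sup>2"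
      using sum_squares_bound[of "norm (u x)" "norm (w x)"] by (simp add: power2_sum)
    finally show ?thesis .
  qed
  then have "integrable lborel (\<lambda>x. (norm (u x + w x))\<^sup>2)"
    by (intro Bochner_Integration.integrable_bound[OF I]) auto
  then show ?thesis by (simp add: L2_def)
qed

lemma L2_smult: "L2 (u::wavefn) \<Longrightarrow> L2 (\<lambda>x. c *s u x)"
  by (rule L2_dominated(1)[where C="cmod c"]) auto

lemma L2_scaleR: "L2 (u::wavefn) \<Longrightarrow> L2 (\<lambda>x. c *\<^sub>R u x)"
  by (rule L2_dominated(1)[where C="\<bar>c\<bar>"]) auto

lemma L2_minus: "L2 (u::wavefn) \<Longrightarrow> L2 (\<lambda>x. - u x)"
  by (rule L2_dominated(1)[where C="1"]) auto

lemma L2_diff: "L2 (u::wavefn) \<Longrightarrow> L2 w \<Longrightarrow> L2 (\<lambda>x. u x - w x)"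
  using L2_add[OF _ L2_minus, of u w] by simp

lemma L2_zero [simp]: "L2 (\<lambda>x. 0)"
  by (simp add: L2_def)

lemma L2_sum: "(\<And>i. i \<in> I \<Longrightarrow> L2 (f i::wavefn)) \<Longrightarrow> L2 (\<lambda>x. \<Sum>i\<in>I. f i x)"
  by (induction I rule: infinite_finite_induct) (auto intro: L2_add)

lemma L2_indicator: "L2 (u::wavefn) \<Longrightarrow> A \<in> sets borel \<Longrightarrow> L2 (\<lambda>x. indicator A x *\<^sub>R u x)"
  by (rule L2_dominated(1)[where C="1"]) (auto simp: indicator_def)

section \<open>The real pairing and its norm\<close>

lemma L2_integrable_inner:
  fixes u w :: wavefn
  assumes u: "L2 u" and w: "L2 w" shows "integrable lborel (\<lambda>x. u x \<bullet> w x)"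
proof -
  note [measurable] = L2_measurable[OF u] L2_measurable[OF w]
  have I: "integrable lborel (\<lambda>x. (norm (u x))\<^sup>2 + (norm (w x))\<^sup>2)"
    using L2_integrable[OF u] L2_integrable[OF w] by simp
  have "\<bar>u x \<bullet> w x\<bar> \<le> (norm (u x))\<^sup>2 + (norm (w x))\<^sup>2" for x
  proof -
    have "0 \<le> norm (u x) * norm (w x)" by simp
    then show ?thesis
      using Cauchy_Schwarz_ineq2[of "u x" "w x"] sum_squares_bound[of "norm (u x)" "norm (w x)"]
      by linarith
  qed
  then show ?thesis
    by (intro Bochner_Integration.integrable_bound[OF I]) auto
qed

lemma ip_add_left: "L2 u \<Longrightarrow> L2 u' \<Longrightarrow> L2 w \<Longrightarrow> ip (\<lambda>x. u x + u' x) w = ip u w + ip u' w"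
  by (simp add: ip_def inner_add_left L2_integrable_inner)

lemma ip_commute: "ip u w = ip w u"
  by (simp add: ip_def inner_commute)

lemma ip_add_right: "L2 u \<Longrightarrow> L2 u' \<Longrightarrow> L2 w \<Longrightarrow> ip w (\<lambda>x. u x + u' x) = ip w u + ip w u'"
  by (simp add: ip_commute[of w] ip_add_left)

lemma ip_diff_left: "L2 u \<Longrightarrow> L2 u' \<Longrightarrow> L2 w \<Longrightarrow> ip (\<lambda>x. u x - u' x) w = ip u w - ip u' w"
  by (simp add: ip_def inner_diff_left L2_integrable_inner)

lemma ip_diff_right: "L2 u \<Longrightarrow> L2 u' \<Longrightarrow> L2 w \<Longrightarrow> ip w (\<lambda>x. u x - u' x) = ip w u - ip w u'"
  by (simp add: ip_commute[of w] ip_diff_left)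

lemma ip_scaleR_left: "ip (\<lambda>x. c *\<^sub>R u x) w = c * ip u w"
  by (simp add: ip_def)

lemma ip_scaleR_right: "ip w (\<lambda>x. c *\<^sub>R u x) = c * ip w u"
  by (simp add: ip_def)

lemma ip_Cauchy_Schwarz:
  assumes u: "L2 u" and w: "L2 w"
  shows "\<bar>ip u w\<bar> \<le> L2norm u * L2norm w"
proof -
  have q: "0 \<le> ip u u - 2 * t * ip u w + t\<^sup>2 * ip w w" for t
  proof -
    have "0 \<le> (L2norm (\<lambda>x. u x - t *\<^sub>R w x))\<^sup>2" by simp
    also have "\<dots> = ip u u - 2 * t * ip u w + t\<^sup>2 * ip w w"
      unfolding L2norm_power2_ip
      by (simp add: ip_diff_left ip_diff_right L2_diff L2_scaleR u w ip_scaleR_left ip_scaleR_right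
          ip_commute[of w u] power2_eq_square algebra_simps)
    finally show ?thesis .
  qed
  have "(ip u w)\<^sup>2 \<le> ip u u * ip w w"
  proof (cases "ip w w = 0")
    case True
    have "ip u w = 0"
    proof (rule ccontr)
      assume "ip u w \<noteq> 0"
      then show False
        \<comment> \<open>The quadratic has degenerated to an affine function of t; at this t it
          equals -1.\<close>
        using q[of "(ip u u + 1) / (2 * ip u w)"] True by simp
    qed
    then show ?thesis using True by simp
  next
    case False
    then have pos: "0 < ip w w"
      using zero_le_power2[of "L2norm w"] unfolding L2norm_power2_ip by linarith
    have "0 \<le> ip u u - (ip u w)\<^sup>2 / ip w w"
      \<comment> \<open>The minimiser of the quadratic in t.\<close>
      using q[of "ip u w / ip w w"] False by (simp add: power2_eq_square)
    then have "(ip u w)\<^sup>2 / ip w w \<le> ip u u" by linarith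
    then show ?thesis using pos by (simp add: pos_divide_le_eq)
  qed
  then have "\<bar>ip u w\<bar>\<^sup>2 \<le> (L2norm u * L2norm w)\<^sup>2"
    by (simp add: power_mult_distrib L2norm_power2_ip)
  then show ?thesis by (rule power2_le_imp_le) simp
qed

lemma L2norm_triangle:
  fixes u w :: wavefn
  assumes u: "L2 u" and w: "L2 w"
  shows "L2norm (\<lambda>x. u x + w x :: spinor) \<le> L2norm u + L2norm w"
proof (rule power2_le_imp_le)
  have "(L2norm (\<lambda>x. u x + w x))\<^sup>2 = (L2norm u)\<^sup>2 + 2 * ip u w + (L2norm w)\<^sup>2"
    unfolding L2norm_power2_ip by (simp add: ip_add_left ip_add_right L2_add u w ip_commute[of w u])
  also have "\<dots> \<le> (L2norm u + L2norm w)\<^sup>2"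
    using ip_Cauchy_Schwarz[OF u w] by (simp add: power2_sum)
  finally show "(L2norm (\<lambda>x. u x + w x))\<^sup>2 \<le> (L2norm u + L2norm w)\<^sup>2" .
qed simp

lemma L2norm_smult: "L2norm (\<lambda>x. c *s (u x::spinor)) = cmod c * L2norm (u::wavefn)"
  by (simp add: L2norm_def power_mult_distrib real_sqrt_mult)

lemma L2norm_scaleR: "L2norm (\<lambda>x. c *\<^sub>R (u x::spinor)) = \<bar>c\<bar> * L2norm (u::wavefn)"
  by (simp add: L2norm_def power_mult_distrib real_sqrt_mult)

lemma L2norm_minus_commute: "L2norm (\<lambda>x. w x - u x) = L2norm (\<lambda>x. u x - w x :: spinor)"
  by (simp add: L2norm_def norm_minus_commute)

lemma L2norm_zero [simp]: "L2norm (\<lambda>x. 0) = 0"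
  by (simp add: L2norm_def)

lemma L2norm_triangle_diff:
  fixes u w v :: wavefn
  assumes u: "L2 u" and w: "L2 w" and v: "L2 v"
  shows "L2norm (\<lambda>x. u x - w x :: spinor) \<le> L2norm (\<lambda>x. u x - v x) + L2norm (\<lambda>x. v x - w x)"
  using L2norm_triangle[OF L2_diff[OF u v] L2_diff[OF v w]] by simp

lemma L2norm_diff_abs:
  fixes u w :: wavefn
  assumes u: "L2 u" and w: "L2 w"
  shows "\<bar>L2norm u - L2norm (w::wavefn)\<bar> \<le> L2norm (\<lambda>x. u x - w x)"
  using L2norm_triangle[OF L2_diff[OF u w] w] L2norm_triangle[OF L2_diff[OF w u] u]
  by (simp add: L2norm_minus_commute[of w u])

lemma L2norm_cong_AE:
  assumes "u \<in> borel_measurable borel" "w \<in> borel_measurable borel"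
    and "AE x in lborel. u x = (w x::spinor)"
  shows "L2norm (u::wavefn) = L2norm w"
  unfolding L2norm_def using assms
  by (intro arg_cong[where f=sqrt] integral_cong_AE) auto

lemma L2norm_tendsto:
  fixes u :: "nat \<Rightarrow> wavefn"
  assumes u: "\<And>n. L2 (u n)" and w: "L2 w"
    and lim: "(\<lambda>n. L2norm (\<lambda>x. u n x - w x)) \<longlonglongrightarrow> 0"
  shows "(\<lambda>n. L2norm (u n)) \<longlonglongrightarrow> L2norm (w::wavefn)"
proof (rule LIM_zero_cancel, rule tendsto_rabs_zero_cancel)
  show "(\<lambda>n. \<bar>L2norm (u n) - L2norm w\<bar>) \<longlonglongrightarrow> 0"
    by (rule tendsto_sandwich[OF _ _ tendsto_const lim])
       (use L2norm_diff_abs[OF u w] in auto)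
qed

lemma L2norm_dominated_convergence:
  fixes u :: "nat \<Rightarrow> wavefn"
  assumes [measurable]: "\<And>n. u n \<in> borel_measurable borel" and w: "L2 w"
    and dom: "\<And>n x. norm (u n x) \<le> norm (w x)"
    and lim: "\<And>x. (\<lambda>n. u n x) \<longlonglongrightarrow> 0"
  shows "(\<lambda>n. L2norm (u n)) \<longlonglongrightarrow> 0"
proof -
  have 1: "AE x in lborel. (\<lambda>n. (norm (u n x))\<^sup>2) \<longlonglongrightarrow> 0"
  proof (rule AE_I2)
    show "(\<lambda>n. (norm (u n x))\<^sup>2) \<longlonglongrightarrow> 0" for x
      using tendsto_power[OF tendsto_norm_zero[OF lim[of x]], of 2] by simp
  qed
  have 2: "AE x in lborel. norm ((norm (u n x))\<^sup>2) \<le> (norm (w x))\<^sup>2" for n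
    using dom[of n] by (intro AE_I2) (simp add: power_mono)
  have "(\<lambda>n. \<integral>x. (norm (u n x))\<^sup>2 \<partial>lborel) \<longlonglongrightarrow> integral\<^sup>L (lborel :: (real^3) measure) (\<lambda>x. 0)"
    by (rule integral_dominated_convergence[where w="\<lambda>x. (norm (w x))\<^sup>2"]) (use 1 2 L2_integrable[OF w] in simp_all)
  then have "(\<lambda>n. sqrt (\<integral>x. (norm (u n x))\<^sup>2 \<partial>lborel)) \<longlonglongrightarrow> sqrt 0"
    by (intro tendsto_real_sqrt) simp
  then show ?thesis by (simp add: L2norm_def)
qed

section \<open>Continuity of translations in the mean\<close>

text \<open>The usual two-stage limit in one rule: an approximating object of error \<open>e\<close>
  is fixed before n tends to infinity, so the null sequence may depend on \<open>e\<close>.\<close>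

lemma tendsto_zero_approx:
  fixes a :: "nat \<Rightarrow> real"
  assumes nn: "\<And>n. 0 \<le> a n"
    and ap: "\<And>e. e > 0 \<Longrightarrow> \<exists>b. b \<longlonglongrightarrow> 0 \<and> (\<forall>n. a n \<le> e + b n)"
  shows "a \<longlonglongrightarrow> 0"
proof (rule LIMSEQ_I)
  fix r :: real assume r: "0 < r"
  then obtain b where b: "b \<longlonglongrightarrow> 0" "\<And>n. a n \<le> r/2 + b n"
    using ap[of "r/2"] by auto
  obtain N where N: "\<And>n. n \<ge> N \<Longrightarrow> \<bar>b n\<bar> < r/2"
    using LIMSEQ_D[OF b(1), of "r/2"] r by auto
  have "norm (a n - 0) < r" if "n \<ge> N" for n
    using N[OF that] b(2)[of n] nn[of n] by simp
  then show "\<exists>no. \<forall>n\<ge>no. norm (a n - 0) < r" by blast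
qed

lemma nn_integral_lborel_translate:
  fixes h :: "'a::euclidean_space"
  assumes [measurable]: "f \<in> borel_measurable borel"
  shows "(\<integral>\<^sup>+x. f (x + h) \<partial>lborel) = (\<integral>\<^sup>+x. f x \<partial>lborel)"
proof -
  have "(\<integral>\<^sup>+x. f x \<partial>lborel) = (\<integral>\<^sup>+x. f x \<partial>(distr lborel borel ((+) h)))"
    by (simp add: lborel_distr_plus)
  also have "\<dots> = (\<integral>\<^sup>+x. f (x + h) \<partial>lborel)"
    by (subst nn_integral_distr) (simp_all add: add.commute)
  finally show ?thesis by simp
qed

lemma lborel_integrable_translate:
  fixes h :: "'a::euclidean_space" and f :: "'a \<Rightarrow> 'b::{banach, second_countable_topology}"
  assumes "integrable lborel f"
  shows "integrable lborel (\<lambda>x. f (x + h))"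
proof -
  have [measurable]: "f \<in> borel_measurable borel" using assms by auto
  show ?thesis
    using assms nn_integral_lborel_translate[of "\<lambda>x. ennreal (norm (f x))" h]
    by (simp add: integrable_iff_bounded)
qed

lemma lborel_integral_translate:
  fixes h :: "'a::euclidean_space" and f :: "'a \<Rightarrow> 'b::{banach, second_countable_topology}"
  assumes [measurable]: "f \<in> borel_measurable borel"
  shows "(\<integral>x. f (x + h) \<partial>lborel) = (\<integral>x. f x \<partial>lborel)"
proof -
  have "(\<integral>x. f x \<partial>lborel) = (\<integral>x. f x \<partial>(distr lborel borel ((+) h)))"
    by (simp add: lborel_distr_plus)
  also have "\<dots> = (\<integral>x. f (x + h) \<partial>lborel)"
    by (subst integral_distr) (simp_all add: add.commute)
  finally show ?thesis by simp
qed

lemma lborel_integral_scale: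
  fixes f :: "'a::euclidean_space \<Rightarrow> real"
  assumes [measurable]: "f \<in> borel_measurable borel" and c: "c > 0"
  shows "(\<integral>x. f x \<partial>lborel) = c ^ DIM('a) * (\<integral>x. f (c *\<^sub>R x) \<partial>lborel)"
proof -
  have "(\<integral>x. f x \<partial>lborel) =
     (\<integral>x. f x \<partial>(density (distr lborel borel (\<lambda>x. 0 + c *\<^sub>R x)) (\<lambda>_. ennreal (\<bar>c\<bar> ^ DIM('a)))))"
    using c by (subst lborel_affine[of c 0]) (auto simp: ennreal_power)
  also have "\<dots> = c ^ DIM('a) * (\<integral>x. f (c *\<^sub>R x) \<partial>lborel)"
    using c by (subst integral_real_density) (auto simp: integral_distr)
  finally show ?thesis .
qed

text \<open>A point of an open set stays in it under small shifts, so the integrand is eventually 0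
  at every point. The integral is one-sided on purpose: openness says nothing about points outside
  \<open>U\<close>.\<close>

lemma translate_open_tendsto:
  fixes U :: "'a::euclidean_space set"
  assumes U: "open U" and fin: "emeasure lborel U < \<infinity>" and h: "h \<longlonglongrightarrow> 0"
  shows "(\<lambda>n. \<integral>x. indicator U x * (1 - indicator U (x + h n)) \<partial>lborel) \<longlonglongrightarrow> (0::real)"
proof -
  note [measurable] = borel_open[OF U]
  have "(\<lambda>n. \<integral>x. indicator U x * (1 - indicator U (x + h n)) \<partial>lborel) \<longlonglongrightarrow>
      integral\<^sup>L (lborel :: 'a measure) (\<lambda>x. 0::real)"
  proof (rule integral_dominated_convergence[where w="indicator U"])
    show "integrable lborel (indicator U :: 'a \<Rightarrow> real)"
      using fin by (simp add: integrable_indicator_iff)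
    show "AE x in lborel. (\<lambda>n. indicator U x * (1 - indicator U (x + h n))) \<longlonglongrightarrow> (0::real)"
    proof (rule AE_I2, cases)
      fix x assume x: "x \<in> U"
      have "(\<lambda>n. x + h n) \<longlonglongrightarrow> x + 0" by (intro tendsto_intros h)
      then have "\<forall>\<^sub>F n in sequentially. x + h n \<in> U"
        using topological_tendstoD[OF _ U] x by fastforce
      then show "(\<lambda>n. indicator U x * (1 - indicator U (x + h n))) \<longlonglongrightarrow> (0::real)"
        by (intro tendsto_eventually) (erule eventually_mono, simp)
    qed simp
  qed (auto simp: indicator_def)
  then show ?thesis by simp
qed

text \<open>Outer regularity replaces \<open>A\<close> by an open superset \<open>U\<close>. The
  shifted and unshifted copies of \<open>U - A\<close> cost \<open>e / 2\<close> each, and the rest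
  is the one-sided defect of \<open>U\<close> for the shift \<open>k\<close> and, after translating
  back, for \<open>- k\<close>.\<close>

lemma translate_indicator_tendsto:
  fixes A :: "'a::euclidean_space set"
  assumes A [measurable]: "A \<in> sets borel" and fin: "emeasure lborel A < \<infinity>" and h: "h \<longlonglongrightarrow> 0"
  shows "(\<lambda>n. \<integral>x. \<bar>indicator A (x + h n) - indicator A x\<bar> \<partial>lborel) \<longlonglongrightarrow> (0::real)"
proof (rule tendsto_zero_approx)
  fix e :: real assume e: "e > 0"
  obtain U where U: "open U" "A \<subseteq> U" and e2: "emeasure lborel (U - A) < e/2"
    using outer_regular_lborel[OF A, of "e/2"] e by auto
  have [measurable]: "U \<in> sets borel" using U by simp
  let ?I = "\<lambda>S x. indicator S x :: real"
  have finD: "emeasure lborel (U - A) < \<infinity>" using e2 by (simp add: order_less_trans)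
  have "emeasure lborel U \<le> emeasure lborel A + emeasure lborel (U - A)"
    using U(2) by (intro order_trans[OF _ emeasure_subadditive]) (auto intro!: emeasure_mono)
  also have "\<dots> < \<infinity>" using fin finD by simp
  finally have finU: "emeasure lborel U < \<infinity>" .
  have iU: "integrable lborel (?I U)" "integrable lborel (?I (U - A))" "integrable lborel (?I A)"
    using finU finD fin by (simp_all add: integrable_indicator_iff)
  note iUt = iU[THEN lborel_integrable_translate]
  define D where "D k = (\<integral>x. ?I U x * (1 - ?I U (x + k)) \<partial>lborel)" for k
  have iD: "integrable lborel (\<lambda>x. ?I U x * (1 - ?I U (x + k)))" for k
    by (rule Bochner_Integration.integrable_bound[OF iU(1)]) (auto simp: indicator_def)
  have iD': "integrable lborel (\<lambda>x. ?I U (x + k) * (1 - ?I U x))" for k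
    by (rule Bochner_Integration.integrable_bound[OF iUt(1)[of k]]) (auto simp: indicator_def)
  have D': "(\<integral>x. ?I U (x + k) * (1 - ?I U x) \<partial>lborel) = D (- k)" for k
    using lborel_integral_translate[of "\<lambda>x. ?I U x * (1 - ?I U (x - k))" k] by (simp add: D_def)
  have mU: "(\<integral>x. ?I (U - A) x \<partial>lborel) \<le> e / 2"
    using e2 e finD by (simp add: emeasure_eq_ennreal_measure less_top ennreal_less_iff less_imp_le)
  have main: "(\<integral>x. \<bar>?I A (x + k) - ?I A x\<bar> \<partial>lborel) \<le> e + (D k + D (- k))" for k
  proof -
    have "(\<integral>x. \<bar>?I A (x + k) - ?I A x\<bar> \<partial>lborel) \<le>
      (\<integral>x. (?I (U - A) (x + k) + ?I (U - A) x) +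
            (?I U x * (1 - ?I U (x + k)) + ?I U (x + k) * (1 - ?I U x)) \<partial>lborel)"
    proof (rule integral_mono)
      show "integrable lborel (\<lambda>x. \<bar>?I A (x + k) - ?I A x\<bar>)"
        using iU iUt by (intro integrable_abs Bochner_Integration.integrable_diff)
      show "integrable lborel (\<lambda>x. (?I (U - A) (x + k) + ?I (U - A) x) +
            (?I U x * (1 - ?I U (x + k)) + ?I U (x + k) * (1 - ?I U x)))"
        by (intro Bochner_Integration.integrable_add iU iUt iD iD')
      show "\<bar>?I A (x + k) - ?I A x\<bar> \<le> (?I (U - A) (x + k) + ?I (U - A) x) +
            (?I U x * (1 - ?I U (x + k)) + ?I U (x + k) * (1 - ?I U x))" for x
        using U(2) by (auto simp: indicator_def split: if_splits)
    qed
    also have "\<dots> = (\<integral>x. ?I (U - A) (x + k) \<partial>lborel) + (\<integral>x. ?I (U - A) x \<partial>lborel) + (D k + D (-k))"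
      using iU iUt iD iD' by (simp add: D_def[of k] D' del: integral_indicator)
    also have "\<dots> \<le> e + (D k + D (-k))"
      using mU lborel_integral_translate[of "?I (U - A)" k] by simp
    finally show ?thesis .
  qed
  have "(\<lambda>n. D (h n) + D (- h n)) \<longlonglongrightarrow> 0 + 0"
    unfolding D_def using h tendsto_minus[OF h]
    by (intro tendsto_add translate_open_tendsto U finU) auto
  then show "\<exists>b. b \<longlonglongrightarrow> 0 \<and> (\<forall>n. (\<integral>x. \<bar>?I A (x + h n) - ?I A x\<bar> \<partial>lborel) \<le> e + b n)"
    using main by (intro exI[of _ "\<lambda>n. D (h n) + D (- h n)"]) auto
qed simp

lemma translate_L1_tendsto:
  fixes f :: "'a::euclidean_space \<Rightarrow> 'b::{banach, second_countable_topology}"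
  assumes f: "integrable lborel f" and h: "h \<longlonglongrightarrow> 0"
  shows "(\<lambda>n. \<integral>x. norm (f (x + h n) - f x) \<partial>lborel) \<longlonglongrightarrow> 0"
  using f
proof (induction rule: integrable_induct)
  case (base A c)
  have "norm (indicator A (x + k) *\<^sub>R c - indicator A x *\<^sub>R c) =
      norm c * \<bar>indicator A (x + k) - indicator A x\<bar>" for x k
    by (simp add: scaleR_diff_left[symmetric])
  moreover have "(\<lambda>n. norm c * (\<integral>x. \<bar>indicator A (x + h n) - indicator A x\<bar> \<partial>lborel)) \<longlonglongrightarrow> norm c * 0"
    using base by (intro tendsto_intros translate_indicator_tendsto h) auto
  ultimately show ?case by simp
next
  case (add f g)
  note ft = add.hyps(1)[THEN lborel_integrable_translate]
    and gt = add.hyps(2)[THEN lborel_integrable_translate]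
  note d = ft[THEN Bochner_Integration.integrable_diff, OF add.hyps(1)]
    gt[THEN Bochner_Integration.integrable_diff, OF add.hyps(2)]
  show ?case
  proof (rule tendsto_sandwich[OF _ _ tendsto_const])
    show "(\<lambda>n. (\<integral>x. norm (f (x + h n) - f x) \<partial>lborel) + (\<integral>x. norm (g (x + h n) - g x) \<partial>lborel)) \<longlonglongrightarrow> 0"
      using tendsto_add[OF add.IH] by simp
    have "(\<integral>x. norm (f (x + k) + g (x + k) - (f x + g x)) \<partial>lborel) \<le>
        (\<integral>x. norm (f (x + k) - f x) \<partial>lborel) + (\<integral>x. norm (g (x + k) - g x) \<partial>lborel)" for k
      unfolding Bochner_Integration.integral_add[OF integrable_norm integrable_norm, OF d, symmetric]
      using d ft gt add.hyps
      by (intro integral_mono integrable_norm Bochner_Integration.integrable_add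
          Bochner_Integration.integrable_diff) (auto simp: add_diff_add norm_triangle_ineq)
    then show "\<forall>\<^sub>F n in sequentially. (\<integral>x. norm (f (x + h n) + g (x + h n) - (f x + g x)) \<partial>lborel) \<le>
        (\<integral>x. norm (f (x + h n) - f x) \<partial>lborel) + (\<integral>x. norm (g (x + h n) - g x) \<partial>lborel)"
      by simp
  qed simp
next
  case (lim f s)
  have [measurable]: "f \<in> borel_measurable borel" "\<And>i. s i \<in> borel_measurable borel"
    using lim by auto
  have ints: "integrable lborel (s i)" for i using lim by simp
  have if': "integrable lborel f" using lim by simp
  have L: "(\<lambda>i. \<integral>x. norm (s i x - f x) \<partial>lborel) \<longlonglongrightarrow> integral\<^sup>L (lborel :: 'a measure) (\<lambda>x. 0::real)"
  \<comment> \<open>The induction rule provides \<open>norm (s i x) \<le> 2 * norm (f x)\<close>,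
    hence the factor 3 for the difference.\<close>
  proof (rule integral_dominated_convergence[where w="\<lambda>x. 3 * norm (f x)"])
    show "AE x in lborel. (\<lambda>i. norm (s i x - f x)) \<longlonglongrightarrow> 0"
      using lim(2) by (auto simp: LIM_zero_iff tendsto_norm_zero_iff)
    have "norm (s i x - f x) \<le> 3 * norm (f x)" for i x
      using norm_triangle_ineq4[of "s i x" "f x"] lim(3)[of x i] by simp
    then show "AE x in lborel. norm (norm (s i x - f x)) \<le> 3 * norm (f x)" for i by simp
  qed (use if' in auto)
  show ?case
  proof (rule tendsto_zero_approx)
    fix e :: real assume "e > 0"
    then obtain i where i: "(\<integral>x. norm (s i x - f x) \<partial>lborel) < e / 2"
      using LIMSEQ_D[OF L, of "e/2"] by fastforce
    have d: "integrable lborel (\<lambda>x. s i x - f x)" using ints if' by simp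
    note dt = lborel_integrable_translate[OF d]
    note st = lborel_integrable_translate[OF ints[of i]] and ft = lborel_integrable_translate[OF if']
    have tr: "(\<integral>x. norm (s i (x + k) - f (x + k)) \<partial>lborel) = (\<integral>x. norm (s i x - f x) \<partial>lborel)" for k
      by (rule lborel_integral_translate) measurable
    have main: "(\<integral>x. norm (f (x + k) - f x) \<partial>lborel) \<le> e + (\<integral>x. norm (s i (x + k) - s i x) \<partial>lborel)" for k
    proof -
    have "(\<integral>x. norm (f (x + k) - f x) \<partial>lborel) \<le> (\<integral>x. norm (s i (x + k) - f (x + k)) +
       norm (s i x - f x) + norm (s i (x + k) - s i x) \<partial>lborel)"
    proof (rule integral_mono)
      show "integrable lborel (\<lambda>x. norm (f (x + k) - f x))"
        using ft if' by simp
      show "integrable lborel (\<lambda>x. norm (s i (x + k) - f (x + k)) +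
       norm (s i x - f x) + norm (s i (x + k) - s i x))"
        using d dt st ints ft by simp
      show "norm (f (x + k) - f x) \<le> norm (s i (x + k) - f (x + k)) +
       norm (s i x - f x) + norm (s i (x + k) - s i x)" for x
      proof -
        have "f (x + k) - f x = (s i (x + k) - s i x) + (s i x - f x) - (s i (x + k) - f (x + k))" by simp
        then show ?thesis
          using norm_triangle_ineq4[of "(s i (x + k) - s i x) + (s i x - f x)" "s i (x + k) - f (x + k)"]
            norm_triangle_ineq[of "s i (x + k) - s i x" "s i x - f x"] by simp
      qed
    qed
    also have "\<dots> = (\<integral>x. norm (s i x - f x) \<partial>lborel) + (\<integral>x. norm (s i x - f x) \<partial>lborel) +
        (\<integral>x. norm (s i (x + k) - s i x) \<partial>lborel)"
      using d dt st ints ft tr by simp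
    finally show ?thesis using i by linarith
    qed
    with main show "\<exists>b. b \<longlonglongrightarrow> 0 \<and> (\<forall>n. (\<integral>x. norm (f (x + h n) - f x) \<partial>lborel) \<le> e + b n)"
      using lim.IH[of i] by (intro exI[of _ "\<lambda>n. \<integral>x. norm (s i (x + h n) - s i x) \<partial>lborel"]) auto
  qed simp
qed

section \<open>Gaussians\<close>

text \<open>Lebesgue measure is the image of the product measure on coordinates, so functions that
  factor over coordinates integrate factor by factor. This reduces Gaussian integrals to dimension
  one.\<close>

lemma lborel_integral_prod:
  fixes f :: "'a::euclidean_space \<Rightarrow> real \<Rightarrow> complex"
  assumes f: "\<And>b. b \<in> Basis \<Longrightarrow> integrable lborel (f b)"
  shows "integrable lborel (\<lambda>x::'a. \<Prod>b\<in>Basis. f b (x \<bullet> b))" (is ?A)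
    and "(\<integral>x. (\<Prod>b\<in>Basis. f b (x \<bullet> b)) \<partial>lborel) = (\<Prod>b\<in>Basis. \<integral>t. f b t \<partial>lborel)" (is ?B)
proof -
  interpret product_sigma_finite "\<lambda>_::'a. lborel :: real measure" ..
  have [measurable]: "\<And>b. b \<in> Basis \<Longrightarrow> f b \<in> borel_measurable borel"
    using f by auto
  have [simp]: "b \<in> Basis \<Longrightarrow> (\<Sum>c\<in>Basis. g c *\<^sub>R c) \<bullet> b = g b" for g and b :: 'a
    by (simp add: inner_sum_left inner_Basis if_distrib cong: if_cong)
  have eq: "(\<Prod>b\<in>Basis. f b ((\<Sum>c\<in>Basis. g c *\<^sub>R c) \<bullet> b)) = (\<Prod>b\<in>Basis. f b (g b))" for g
    by (intro prod.cong) auto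
  show ?A
    by (subst lborel_eq, subst integrable_distr_eq) (simp_all add: eq f product_integrable_prod)
  show ?B
    by (subst lborel_eq, subst integral_distr) (simp_all add: eq f product_integral_prod)
qed

text \<open>The characteristic function of the standard normal law, rescaled by
  \<open>\<sigma>\<close>.\<close>

lemma normal_density_fourier:
  assumes s: "\<sigma> > 0"
  shows "integrable lborel (\<lambda>x. complex_of_real (normal_density 0 \<sigma> x) * iexp (x * t))" (is ?A)
    and "(\<integral>x. complex_of_real (normal_density 0 \<sigma> x) * iexp (x * t) \<partial>lborel)
      = of_real (exp (- (\<sigma>\<^sup>2 * t\<^sup>2 / 2)))" (is ?B)
proof -
  have n: "normal_density 0 \<sigma> (0 + \<sigma> * x) = std_normal_density x / \<sigma>" for x
    using s by (simp add: normal_density_def power_mult_distrib real_sqrt_mult field_simps)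
  have I: "integrable lborel (\<lambda>x. complex_of_real (normal_density 0 \<sigma> x))"
    using s by simp
  show ?A
    by (rule Bochner_Integration.integrable_bound[OF I]) (auto simp: norm_mult)
  have "(\<integral>x. complex_of_real (normal_density 0 \<sigma> x) * iexp (x * t) \<partial>lborel)
     = \<bar>\<sigma>\<bar> *\<^sub>R (\<integral>x. complex_of_real (normal_density 0 \<sigma> (0 + \<sigma> * x)) * iexp ((0 + \<sigma> * x) * t) \<partial>lborel)"
    using s by (intro lborel_integral_real_affine) auto
  also have "\<dots> = (\<integral>x. std_normal_density x *\<^sub>R iexp (\<sigma> * t * x) \<partial>lborel)"
    unfolding n Bochner_Integration.integral_scaleR_right[symmetric]
    using s by (intro Bochner_Integration.integral_cong) (auto simp: scaleR_conv_of_real mult_ac)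
  also have "\<dots> = char std_normal_distribution (\<sigma> * t)"
    by (simp add: char_def integral_density)
  also have "\<dots> = of_real (exp (- (\<sigma>\<^sup>2 * t\<^sup>2 / 2)))"
    by (simp add: char_std_normal_distribution power_mult_distrib exp_of_real[symmetric])
  finally show ?B .
qed

text \<open>The isotropic Gaussian probability density of width \<open>\<sigma>\<close>. The product
  form makes its Fourier integral factor; the radial form is recovered in
  \<open>gauss_eq\<close>.\<close>

definition gauss :: "real \<Rightarrow> real^3 \<Rightarrow> real" where
  "gauss \<sigma> z = (\<Prod>b\<in>Basis. normal_density 0 \<sigma> (z \<bullet> b))"

lemma gauss_nonneg [simp]: "0 \<le> gauss \<sigma> z"
  by (simp add: gauss_def prod_nonneg)

lemma gauss_measurable [measurable]: "gauss \<sigma> \<in> borel_measurable borel"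
  unfolding gauss_def by measurable

lemma gauss_eq:
  assumes "\<sigma> > 0"
  shows "gauss \<sigma> z = (1 / (sqrt (2 * pi) * \<sigma>)) ^ 3 * exp (- ((norm z)\<^sup>2 / (2 * \<sigma>\<^sup>2)))"
proof -
  have "(norm z)\<^sup>2 = (\<Sum>b\<in>Basis. (z \<bullet> b)\<^sup>2)"
    by (simp add: euclidean_inner[of z z] power2_norm_eq_inner power2_eq_square[symmetric])
  then have "exp (- ((norm z)\<^sup>2 / (2 * \<sigma>\<^sup>2))) = (\<Prod>b\<in>Basis. exp (- (z \<bullet> b)\<^sup>2 / (2 * \<sigma>\<^sup>2)))"
    by (simp add: exp_sum[symmetric] sum_negf sum_divide_distrib)
  then show ?thesis
    using assms by (simp add: gauss_def normal_density_def prod.distrib real_sqrt_mult power_divide prod_dividef)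
qed

lemma gauss_fourier:
  assumes s: "\<sigma> > 0"
  shows "integrable lborel (\<lambda>z. complex_of_real (gauss \<sigma> z) * iexp (z \<bullet> w))" (is ?A)
    and "(\<integral>z. complex_of_real (gauss \<sigma> z) * iexp (z \<bullet> w) \<partial>lborel)
      = of_real (exp (- (\<sigma>\<^sup>2 * (norm w)\<^sup>2 / 2)))" (is ?B)
proof -
  have eq: "complex_of_real (gauss \<sigma> z) * iexp (z \<bullet> w) =
    (\<Prod>b\<in>Basis. complex_of_real (normal_density 0 \<sigma> (z \<bullet> b)) * iexp ((z \<bullet> b) * (w \<bullet> b)))" for z
    by (simp add: gauss_def prod.distrib exp_sum[symmetric] euclidean_inner[of z w] sum_distrib_left)
  have nw: "(norm w)\<^sup>2 = (\<Sum>b\<in>Basis. (w \<bullet> b)\<^sup>2)"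
    by (simp add: euclidean_inner[of w w] power2_norm_eq_inner power2_eq_square[symmetric])
  show ?A
    unfolding eq using s
    by (intro lborel_integral_prod(1)[of "\<lambda>b t. complex_of_real (normal_density 0 \<sigma> t) * iexp (t * (w \<bullet> b))"]
        normal_density_fourier)
  show ?B
    unfolding eq using s
    by (subst lborel_integral_prod(2)[of "\<lambda>b t. complex_of_real (normal_density 0 \<sigma> t) * iexp (t * (w \<bullet> b))"])
       (simp_all only: normal_density_fourier nw exp_sum[OF finite_Basis] sum_negf[symmetric] sum_divide_distrib sum_distrib_left
         of_real_prod)
qed

lemma gauss_integrable:
  assumes "\<sigma> > 0" shows "integrable lborel (gauss \<sigma>)" "(\<integral>z. gauss \<sigma> z \<partial>lborel) = 1"
  using gauss_fourier[OF assms, of 0] by (simp_all add: complex_of_real_integrable_eq)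

text \<open>A convergence factor for frequency integrals. It increases to 1 as
  \<open>\<epsilon>\<close> decreases to 0, and it is a multiple of the Gaussian of width
  \<open>1 / \<epsilon>\<close>, so its Fourier integral is a Gaussian of width
  \<open>\<epsilon>\<close> in position space.\<close>

definition damp :: "real \<Rightarrow> real^3 \<Rightarrow> real" where
  "damp \<epsilon> \<xi> = exp (- (\<epsilon>\<^sup>2 * (norm \<xi>)\<^sup>2 / 2))"

lemma damp_bounds: "0 \<le> damp \<epsilon> \<xi>" "damp \<epsilon> \<xi> \<le> 1"
  by (simp_all add: damp_def)

lemma damp_measurable [measurable]: "damp \<epsilon> \<in> borel_measurable borel"
  unfolding damp_def by measurable

lemma damp_eq_gauss:
  assumes e: "\<epsilon> > 0"
  shows "damp \<epsilon> \<xi> = (sqrt (2 * pi) / \<epsilon>) ^ 3 * gauss (1 / \<epsilon>) \<xi>"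
  using e by (simp add: gauss_eq damp_def power_divide power_mult_distrib field_simps)

lemma damp_fourier:
  assumes e: "\<epsilon> > 0"
  shows "integrable lborel (\<lambda>\<xi>. complex_of_real (damp \<epsilon> \<xi>) * iexp (\<xi> \<bullet> w))" (is ?A)
    and "(\<integral>\<xi>. complex_of_real (damp \<epsilon> \<xi>) * iexp (\<xi> \<bullet> w) \<partial>lborel)
      = of_real ((2 * pi) ^ 3 * gauss \<epsilon> w)" (is ?B)
proof -
  have eq: "complex_of_real (damp \<epsilon> \<xi>) * iexp (\<xi> \<bullet> w) =
    of_real ((sqrt (2 * pi) / \<epsilon>) ^ 3) * (complex_of_real (gauss (1/\<epsilon>) \<xi>) * iexp (\<xi> \<bullet> w))" for \<xi>
    by (simp add: damp_eq_gauss[OF e])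
  show ?A unfolding eq using e by (intro integrable_mult_right gauss_fourier) auto
  have g: "gauss \<epsilon> w = (1 / (sqrt (2 * pi) * \<epsilon>)) ^ 3 * exp (- ((1 / \<epsilon>)\<^sup>2 * (norm w)\<^sup>2 / 2))"
    using e by (simp add: gauss_eq power_divide)
  have c: "(2 * pi) ^ 3 * (1 / (sqrt (2 * pi) * \<epsilon>)) ^ 3 = (sqrt (2 * pi) / \<epsilon>) ^ 3"
  proof -
    have "2 * pi * (1 / (sqrt (2 * pi) * \<epsilon>)) = sqrt (2 * pi) / \<epsilon>"
      using e by (simp add: field_simps)
    then show ?thesis unfolding power_mult_distrib[symmetric] by simp
  qed
  have "(\<integral>\<xi>. complex_of_real (damp \<epsilon> \<xi>) * iexp (\<xi> \<bullet> w) \<partial>lborel) =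
      of_real ((sqrt (2 * pi) / \<epsilon>) ^ 3 * exp (- ((1 / \<epsilon>)\<^sup>2 * (norm w)\<^sup>2 / 2)))"
    unfolding eq integral_mult_right_zero using e by (subst gauss_fourier) simp_all
  also have "\<dots> = of_real ((2 * pi) ^ 3 * gauss \<epsilon> w)"
    unfolding g c[symmetric] mult.assoc ..
  finally show ?B .
qed

lemma damp_integrable: "\<epsilon> > 0 \<Longrightarrow> integrable lborel (damp \<epsilon>)"
  using damp_fourier(1)[of \<epsilon> 0] by (simp add: complex_of_real_integrable_eq)

section \<open>Plancherel's identity\<close>

lemmas emeasure_cball_less_top = emeasure_lborel_cball_finite[unfolded infinity_ennreal_def]

lemma lborel_pair_integrable_mult:
  fixes f :: "'a::euclidean_space \<Rightarrow> real" and g :: "'b::euclidean_space \<Rightarrow> real"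
  assumes f: "integrable lborel f" and g: "integrable lborel g"
  shows "integrable (lborel \<Otimes>\<^sub>M lborel) (\<lambda>p. f (fst p) * g (snd p))"
proof (rule lborel_pair.Fubini_integrable)
  have [measurable]: "f \<in> borel_measurable borel" "g \<in> borel_measurable borel"
    using f g by auto
  show "(\<lambda>p. f (fst p) * g (snd p)) \<in> borel_measurable (lborel \<Otimes>\<^sub>M lborel)"
    by measurable
  show "integrable lborel (\<lambda>x. \<integral>y. norm (f (fst (x, y)) * g (snd (x, y))) \<partial>lborel)"
    using f g by (simp add: abs_mult)
  show "AE x in lborel. integrable lborel (\<lambda>y. f (fst (x, y)) * g (snd (x, y)))"
    using g by simp
qed

lemma measurable_cinner [measurable]:
  assumes [measurable]: "f \<in> borel_measurable M" "g \<in> borel_measurable M"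
  shows "(\<lambda>x. cinner (f x) (g x)) \<in> borel_measurable M"
proof -
  have "(\<lambda>p. cinner (fst p) (snd p)) \<in> borel_measurable (borel :: (spinor \<times> spinor) measure)"
    unfolding cinner_def by (intro borel_measurable_continuous_onI continuous_intros)
  then have "(\<lambda>x. cinner (fst (f x, g x)) (snd (f x, g x))) \<in> borel_measurable M"
    by (rule measurable_compose_rev) (simp add: borel_prod[symmetric])
  then show ?thesis by simp
qed

lemma L2_translate:
  assumes u: "L2 (u::wavefn)"
  shows "L2 (\<lambda>x. u (x + h))" and "L2norm (\<lambda>x. u (x + h)) = L2norm u"
proof -
  note [measurable] = L2_measurable[OF u]
  show "L2 (\<lambda>x. u (x + h))"
    using lborel_integrable_translate[OF L2_integrable[OF u], of h] by (simp add: L2_def)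
  show "L2norm (\<lambda>x. u (x + h)) = L2norm u"
    using lborel_integral_translate[of "\<lambda>x. (norm (u x))\<^sup>2" h] by (simp add: L2norm_def)
qed

lemma L2_bounded_integrable:
  assumes w: "integrable lborel (w::wavefn)" and M: "\<And>x. norm (w x) \<le> M"
  shows "L2 w"
proof -
  have [measurable]: "w \<in> borel_measurable borel" using w by auto
  have le: "norm ((norm (w x))\<^sup>2) \<le> norm (M * norm (w x))" for x
  proof -
    have "norm (w x) * norm (w x) \<le> \<bar>M\<bar> * norm (w x)"
      by (rule mult_right_mono[OF order_trans[OF M abs_ge_self] norm_ge_zero])
    then show ?thesis unfolding power2_eq_square real_norm_def abs_mult abs_norm_cancel .
  qed
  have "integrable lborel (\<lambda>x. M * norm (w x))" using w by simp
  then have "integrable lborel (\<lambda>x. (norm (w x))\<^sup>2)"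
    by (rule Bochner_Integration.integrable_bound) (measurable, rule AE_I2, rule le)
  then show ?thesis by (simp add: L2_def)
qed

text \<open>Discarding the points where the field or the position is large leaves a bounded
  integrable field. On such fields continuity of translations can be transferred from the L1 to the
  L2 norm.\<close>

lemma L2_truncate:
  assumes u: "L2 (u::wavefn)" and e: "e > 0"
  obtains w :: wavefn and M where "L2 w" "integrable lborel w" "\<And>x. norm (w x) \<le> M"
    "L2norm (\<lambda>x. u x - w x) < e"
proof -
  note [measurable] = L2_measurable[OF u]
  define S where "S k = {x::real^3. norm (u x) \<le> real k \<and> norm x \<le> real k}" for k :: nat
  have [measurable]: "S k \<in> sets borel" for k unfolding S_def by measurable
  define w where "w k x = indicator (S k) x *\<^sub>R u x" for k x
  have [measurable]: "w k \<in> borel_measurable borel" for k unfolding w_def by measurable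
  have L: "L2 (w k)" for k unfolding w_def using u by (intro L2_indicator) auto
  have b: "norm (w k x) \<le> real k * indicator (cball 0 (real k)) x" for k x
    by (auto simp: w_def S_def indicator_def)
  have bi: "integrable lborel (\<lambda>x. real k * indicator (cball 0 (real k)) x :: real)" for k
    by (intro integrable_mult_right) (simp add: integrable_indicator_iff emeasure_cball_less_top)
  have I: "integrable lborel (w k)" for k
    using b[of k] by (intro Bochner_Integration.integrable_bound[OF bi[of k]]) (auto simp: abs_mult)
  have b': "norm (w k x) \<le> real k" for k x
    using b[of k x] by (cases "norm x \<le> real k") auto
  have "(\<lambda>k. L2norm (\<lambda>x. u x - w k x)) \<longlonglongrightarrow> 0"
  proof (rule L2norm_dominated_convergence[OF _ u])
    show "norm (u x - w k x) \<le> norm (u x)" for k x by (auto simp: w_def indicator_def)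
    show "(\<lambda>k. u x - w k x) \<longlonglongrightarrow> 0" for x
    proof (rule tendsto_eventually)
      obtain N :: nat where N: "norm (u x) + norm x \<le> real N" using real_arch_simple by blast
      have "x \<in> S k" if "k \<ge> N" for k
        using N of_nat_mono[OF that, where 'a=real] norm_ge_zero[of x] norm_ge_zero[of "u x"]
        unfolding S_def mem_Collect_eq by linarith
      then show "\<forall>\<^sub>F k in sequentially. u x - w k x = 0"
        by (auto simp: eventually_sequentially w_def intro!: exI[of _ N])
    qed
  qed measurable
  then obtain k where "L2norm (\<lambda>x. u x - w k x) < e"
    using LIMSEQ_D[OF _ e] by fastforce
  with that L I b' show thesis by blast
qed

text \<open>For a field bounded by \<open>M\<close> the squared difference is at most
  \<open>2 * M\<close> times the difference, which reduces the claim to the L1 case.\<close>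

lemma translate_L2_bounded_tendsto:
  assumes w: "integrable lborel (w::wavefn)" and M: "\<And>x. norm (w x) \<le> M" and h: "h \<longlonglongrightarrow> 0"
  shows "(\<lambda>n. L2norm (\<lambda>x. w (x + h n) - w x)) \<longlonglongrightarrow> 0"
proof -
  have [measurable]: "w \<in> borel_measurable borel" using w by auto
  note wt = lborel_integrable_translate[OF w]
  have L: "L2 w" by (rule L2_bounded_integrable[OF w M])
  have M0: "0 \<le> M" using M[of 0] norm_ge_zero order_trans by blast
  have "(\<integral>x. (norm (w (x + k) - w x))\<^sup>2 \<partial>lborel) \<le> (\<integral>x. 2 * M * norm (w (x + k) - w x) \<partial>lborel)" for k
  proof (rule integral_mono)
    show "integrable lborel (\<lambda>x. (norm (w (x + k) - w x))\<^sup>2)"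
      using L2_diff[OF L2_translate(1)[OF L] L] by (simp add: L2_def)
    show "integrable lborel (\<lambda>x. 2 * M * norm (w (x + k) - w x))" using wt w by simp
    show "(norm (w (x + k) - w x))\<^sup>2 \<le> 2 * M * norm (w (x + k) - w x)" for x
      unfolding power2_eq_square
      using norm_triangle_ineq4[of "w (x + k)" "w x"] M[of "x + k"] M[of x]
      by (intro mult_right_mono) auto
  qed
  then have le: "(L2norm (\<lambda>x. w (x + k) - w x))\<^sup>2 \<le> 2 * M * (\<integral>x. norm (w (x + k) - w x) \<partial>lborel)" for k
    by (simp add: L2norm_power2)
  have lim: "(\<lambda>n. 2 * M * (\<integral>x. norm (w (x + h n) - w x) \<partial>lborel)) \<longlonglongrightarrow> 0"
    using tendsto_mult_right_zero[OF translate_L1_tendsto[OF w h]] by simp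
  have "(\<lambda>n. (L2norm (\<lambda>x. w (x + h n) - w x))\<^sup>2) \<longlonglongrightarrow> 0"
    by (rule tendsto_sandwich[OF _ _ tendsto_const lim]) (use le in auto)
  from tendsto_real_sqrt[OF this] show ?thesis by simp
qed

lemma translate_ip_tendsto:
  assumes u: "L2 u" and h: "h \<longlonglongrightarrow> 0"
  shows "(\<lambda>n. ip u (\<lambda>x. u (x + h n))) \<longlonglongrightarrow> ip u u"
proof (rule LIM_zero_cancel, rule tendsto_rabs_zero_cancel, rule tendsto_zero_approx)
  fix e :: real assume e: "e > 0"
  \<comment> \<open>The two approximation errors cost at most \<open>2 * L2norm u * d\<close>; the
    summand 1 covers the case \<open>L2norm u = 0\<close>.\<close>
  define d where "d = e / (2 * L2norm u + 1)"
  have d: "d > 0" using e by (simp add: d_def add_nonneg_pos)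
  obtain w M where w: "L2 w" "integrable lborel w" "\<And>x. norm (w x) \<le> M"
    and uw: "L2norm (\<lambda>x. u x - w x) < d"
    using L2_truncate[OF u d] by blast
  note ut = L2_translate(1)[OF u] and wt = L2_translate(1)[OF w(1)]
  have "\<bar>ip u (\<lambda>x. u (x + k)) - ip u u\<bar> \<le> e + L2norm u * L2norm (\<lambda>x. w (x + k) - w x)" for k
  proof -
    have "ip u (\<lambda>x. u (x + k)) - ip u u =
      ip u (\<lambda>x. u (x + k) - w (x + k)) + ip u (\<lambda>x. w (x + k) - w x) - ip u (\<lambda>x. u x - w x)"
      using u ut w wt by (simp add: ip_diff_right)
    moreover have "\<bar>ip u (\<lambda>x. u (x + k) - w (x + k))\<bar> \<le> L2norm u * d"
      using ip_Cauchy_Schwarz[OF u L2_diff[OF ut wt, of k k]]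
      unfolding L2_translate(2)[OF L2_diff[OF u w(1)], of k]
      using mult_left_mono[OF less_imp_le[OF uw] L2norm_nonneg[of u]] by linarith
    moreover have "\<bar>ip u (\<lambda>x. u x - w x)\<bar> \<le> L2norm u * d"
      using ip_Cauchy_Schwarz[OF u L2_diff[OF u w(1)]]
        mult_left_mono[OF less_imp_le[OF uw] L2norm_nonneg[of u]] by linarith
    moreover have "\<bar>ip u (\<lambda>x. w (x + k) - w x)\<bar> \<le> L2norm u * L2norm (\<lambda>x. w (x + k) - w x)"
      by (rule ip_Cauchy_Schwarz[OF u L2_diff[OF wt w(1)]])
    moreover have "2 * L2norm u * d \<le> e"
    proof -
      have "2 * L2norm u * d \<le> (2 * L2norm u + 1) * d" using d by (simp add: algebra_simps)
      also have "\<dots> = e" using L2norm_nonneg[of u] unfolding d_def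
        by (subst nonzero_mult_div_cancel_left times_divide_eq_right; linarith?)+
      finally show ?thesis .
    qed
    ultimately show ?thesis by linarith
  qed
  moreover have "(\<lambda>n. L2norm u * L2norm (\<lambda>x. w (x + h n) - w x)) \<longlonglongrightarrow> 0"
    using tendsto_mult_right_zero[OF translate_L2_bounded_tendsto[OF w(2,3) h]] by simp
  ultimately show "\<exists>b. b \<longlonglongrightarrow> 0 \<and> (\<forall>n. \<bar>ip u (\<lambda>x. u (x + h n)) - ip u u\<bar> \<le> e + b n)"
    by blast
qed simp

text \<open>The unitary Fourier integral with the sign as a parameter: \<open>s = -1\<close> is the
  forward transform and \<open>s = 1\<close> the inverse one. Plancherel's identity is proved for
  both at once from \<open>s\<^sup>2 = 1\<close>.\<close>

definition fo :: "real \<Rightarrow> wavefn \<Rightarrow> wavefn" where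
  "fo s u \<xi> = complex_of_real ((2 * pi) powr (-3/2)) *s
     (\<integral>x. iexp (s * (x \<bullet> \<xi>)) *s u x \<partial>lborel)"

lemma fo_measurable [measurable (raw)]:
  assumes [measurable]: "u \<in> borel_measurable borel"
  shows "fo s u \<in> borel_measurable borel"
  unfolding fo_def by measurable

lemma norm_phase [simp]: "cmod (iexp t) = 1"
  by simp

lemma integrable_phase:
  assumes u: "integrable lborel (u :: 'a::euclidean_space \<Rightarrow> spinor)" and [measurable]: "g \<in> borel_measurable borel"
  shows "integrable lborel (\<lambda>x. iexp (g x) *s u x)"
proof -
  have [measurable]: "u \<in> borel_measurable borel" using u by auto
  show ?thesis by (rule Bochner_Integration.integrable_bound[OF u]) (auto simp del: norm_exp_i_times)
qed

text \<open>The square of the normalising constant of \<open>fo\<close> cancels the factor produced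
  by \<open>damp_fourier\<close>.\<close>

lemma two_pi_powr: "((2 * pi) powr (-3/2))\<^sup>2 * (2 * pi) ^ 3 = 1"
proof -
  have "((2 * pi) powr (-3/2))\<^sup>2 = (2 * pi) powr (-3)"
    by (simp add: powr_power)
  moreover have "(2 * pi) ^ 3 = (2 * pi) powr 3" by (simp add: powr_numeral)
  ultimately show ?thesis by (simp add: powr_add[symmetric] del: powr_numeral)
qed

lemma gauss_even: "s\<^sup>2 = 1 \<Longrightarrow> \<epsilon> > 0 \<Longrightarrow> gauss \<epsilon> (s *\<^sub>R z) = gauss \<epsilon> z"
  by (simp add: gauss_eq power_mult_distrib)

lemma gauss_bounded: "\<epsilon> > 0 \<Longrightarrow> gauss \<epsilon> z \<le> (1 / (sqrt (2 * pi) * \<epsilon>)) ^ 3"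
  by (simp add: gauss_eq mult_left_le)

text \<open>The square is written as a double integral over two positions, in which the frequency
  occurs only in a phase; the frequency integral can then be carried out first.\<close>

lemma norm_fo_power2:
  assumes u: "integrable lborel u"
  shows "(norm (fo s u \<xi>))\<^sup>2 = ((2 * pi) powr (-3/2))\<^sup>2 *
    (\<integral>p. Re (iexp (s * ((snd p - fst p) \<bullet> \<xi>)) * cinner (u (fst p)) (u (snd p))) \<partial>(lborel \<Otimes>\<^sub>M lborel))"
proof -
  have [measurable]: "u \<in> borel_measurable borel" using u by auto
  let ?e = "\<lambda>x. iexp (s * (x \<bullet> \<xi>)) *s u x"
  define I where "I = (\<integral>x. ?e x \<partial>lborel)"
  have ie: "integrable lborel ?e" by (intro integrable_phase u) measurable
  have eq: "Re (iexp (s * ((y - x) \<bullet> \<xi>)) * cinner (u x) (u y)) = ?e x \<bullet> ?e y" for x y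
  proof -
    have "iexp (s * ((y - x) \<bullet> \<xi>)) =
      cnj (iexp (s * (x \<bullet> \<xi>))) * iexp (s * (y \<bullet> \<xi>))"
      by (simp add: exp_cnj exp_add[symmetric] inner_diff_left algebra_simps)
    then show ?thesis by (simp only: inner_smult_spinor)
  qed
  have int: "integrable (lborel \<Otimes>\<^sub>M lborel) (\<lambda>p. ?e (fst p) \<bullet> ?e (snd p))"
  proof (rule Bochner_Integration.integrable_bound)
    show "integrable (lborel \<Otimes>\<^sub>M lborel) (\<lambda>p. norm (u (fst p)) * norm (u (snd p)))"
      using u by (intro lborel_pair_integrable_mult) auto
    have "\<bar>?e x \<bullet> ?e y\<bar> \<le> norm (u x) * norm (u y)" for x y
      using Cauchy_Schwarz_ineq2[of "?e x" "?e y"] by (simp only: norm_smult_spinor norm_phase mult_1)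
    then show "AE p in lborel \<Otimes>\<^sub>M lborel. norm (?e (fst p) \<bullet> ?e (snd p)) \<le> norm (norm (u (fst p)) * norm (u (snd p)))"
      by simp
  qed measurable
  have "I \<bullet> I = (\<integral>x. ?e x \<bullet> I \<partial>lborel)"
    unfolding I_def using ie by (subst integral_inner_left) auto
  also have "\<dots> = (\<integral>x. (\<integral>y. ?e x \<bullet> ?e y \<partial>lborel) \<partial>lborel)"
    unfolding I_def using ie by (subst integral_inner_right[symmetric]) auto
  also have "\<dots> = (\<integral>p. ?e (fst p) \<bullet> ?e (snd p) \<partial>(lborel \<Otimes>\<^sub>M lborel))"
    using lborel_pair.integral_fst'[OF int] by simp
  finally have "(norm I)\<^sup>2 = \<dots>" by (simp add: power2_norm_eq_inner)
  then show ?thesis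
    unfolding fo_def eq norm_smult_spinor power_mult_distrib I_def by simp
qed

text \<open>Fubini's criterion is checked with the shift as outer variable: for each shift the inner
  integral of the absolute value is at most \<open>(L2norm u)\<^sup>2\<close>, and the Gaussian
  makes this integrable. The order of the variables is swapped afterwards.\<close>

lemma lborel_integrable_translate_inner:
  assumes u: "L2 u" "integrable lborel u"
  shows "integrable (lborel \<Otimes>\<^sub>M lborel) (\<lambda>(x, z). gauss 1 z * (u x \<bullet> u (x + \<epsilon> *\<^sub>R z)))"
proof -
  note [measurable] = L2_measurable[OF u(1)]
  have "integrable (lborel \<Otimes>\<^sub>M lborel) (\<lambda>(z, x). gauss 1 z * (u x \<bullet> u (x + \<epsilon> *\<^sub>R z)))"
  proof (rule lborel_pair.Fubini_integrable)
    have A: "integrable lborel (\<lambda>x. u x \<bullet> u (x + h))" for h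
      by (intro L2_integrable_inner u L2_translate)
    have B: "(\<integral>x. \<bar>u x \<bullet> u (x + h)\<bar> \<partial>lborel) \<le> (L2norm u)\<^sup>2" for h
    proof -
      have "(\<integral>x. \<bar>u x \<bullet> u (x + h)\<bar> \<partial>lborel) \<le> (\<integral>x. ((norm (u x))\<^sup>2 + (norm (u (x + h)))\<^sup>2) / 2 \<partial>lborel)"
      proof (rule integral_mono)
        show "\<bar>u x \<bullet> u (x + h)\<bar> \<le> ((norm (u x))\<^sup>2 + (norm (u (x + h)))\<^sup>2) / 2" for x
          using Cauchy_Schwarz_ineq2[of "u x" "u (x + h)"] sum_squares_bound[of "norm (u x)" "norm (u (x + h))"]
          by (simp add: mult.assoc)
      qed (use A L2_integrable[OF u(1)] L2_integrable[OF L2_translate(1)[OF u(1)]] in auto)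
      also have "\<dots> = (L2norm u)\<^sup>2"
        using L2_integrable[OF u(1)] L2_integrable[OF L2_translate(1)[OF u(1), of h]] L2_translate(2)[OF u(1), of h]
        by (simp add: L2norm_power2[symmetric])
      finally show ?thesis .
    qed
    show "integrable lborel (\<lambda>z. \<integral>x. norm (case (z, x) of (z, x) \<Rightarrow> gauss 1 z * (u x \<bullet> u (x + \<epsilon> *\<^sub>R z))) \<partial>lborel)"
    proof (rule Bochner_Integration.integrable_bound)
      show "integrable lborel (\<lambda>z. (L2norm u)\<^sup>2 * gauss 1 z)" by (simp add: gauss_integrable)
      show "AE z in lborel. norm (\<integral>x. norm (case (z, x) of (z, x) \<Rightarrow> gauss 1 z * (u x \<bullet> u (x + \<epsilon> *\<^sub>R z))) \<partial>lborel)
          \<le> norm ((L2norm u)\<^sup>2 * gauss 1 z)"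
        using B mult_right_mono[OF B gauss_nonneg[of 1]] by (simp add: abs_mult mult.commute)
    qed measurable
    show "AE z in lborel. integrable lborel (\<lambda>x. case (z, x) of (z, x) \<Rightarrow> gauss 1 z * (u x \<bullet> u (x + \<epsilon> *\<^sub>R z)))"
      using A by simp
  qed measurable
  then show ?thesis
    by (subst lborel_pair.integrable_product_swap_iff[symmetric]) simp
qed

text \<open>Plancherel's identity with a convergence factor. Integrating out the frequency leaves a
  Gaussian in the difference of the two positions, that is, a Gaussian average of the
  autocorrelation of \<open>u\<close>. The sign \<open>s\<close> disappears because the Gaussian is
  even.\<close>

lemma fo_damped:
  assumes u: "L2 u" "integrable lborel u" and s: "s\<^sup>2 = 1" and e: "\<epsilon> > 0"
  shows "integrable lborel (\<lambda>\<xi>. damp \<epsilon> \<xi> * (norm (fo s u \<xi>))\<^sup>2)"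
    and "(\<integral>\<xi>. damp \<epsilon> \<xi> * (norm (fo s u \<xi>))\<^sup>2 \<partial>lborel) =
      (\<integral>z. gauss 1 z * ip u (\<lambda>x. u (x + \<epsilon> *\<^sub>R z)) \<partial>lborel)"
proof -
  note [measurable] = L2_measurable[OF u(1)]
  define c where "c = ((2 * pi) powr (-3/2))\<^sup>2"
  define G where "G \<xi> p = damp \<epsilon> \<xi> * Re (iexp (s * ((snd p - fst p) \<bullet> \<xi>)) * cinner (u (fst p)) (u (snd p)))"
    for \<xi> :: "real^3" and p :: "(real^3) \<times> (real^3)"
  have cin' [measurable]: "(\<lambda>p::(real^3)\<times>(real^3). cinner (u (fst p)) (u (snd p))) \<in> borel_measurable borel"
    unfolding borel_prod[symmetric] by measurable
  have uu: "integrable (lborel \<Otimes>\<^sub>M lborel) (\<lambda>p. norm (u (fst p)) * norm (u (snd p)))"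
    using u by (intro lborel_pair_integrable_mult) auto
  \<comment> \<open>Joint integrability in the frequency and both positions. In the frequency
    variable it comes from the damping factor alone.\<close>
  have GI: "integrable (lborel \<Otimes>\<^sub>M lborel) (\<lambda>q. G (fst q) (snd q))"
  proof (rule Bochner_Integration.integrable_bound)
    show "integrable (lborel \<Otimes>\<^sub>M (lborel :: ((real^3) \<times> (real^3)) measure))
       (\<lambda>q. damp \<epsilon> (fst q) * (4 * (norm (u (fst (snd q))) * norm (u (snd (snd q))))))"
      using uu[unfolded lborel_prod] e
      by (intro lborel_pair_integrable_mult[of _ "\<lambda>p. 4 * (norm (u (fst p)) * norm (u (snd p)))"] damp_integrable) auto
    have "(\<lambda>q. G (fst q) (snd q)) \<in> borel_measurable (borel \<Otimes>\<^sub>M (borel \<Otimes>\<^sub>M borel))"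
      unfolding G_def by measurable
    then show "(\<lambda>q. G (fst q) (snd q)) \<in> borel_measurable (lborel \<Otimes>\<^sub>M lborel)"
      unfolding borel_prod lborel_prod by simp
    have "\<bar>G \<xi> p\<bar> \<le> damp \<epsilon> \<xi> * (4 * (norm (u (fst p)) * norm (u (snd p))))" for \<xi> p
    proof -
      have "\<bar>Re (iexp (s * ((snd p - fst p) \<bullet> \<xi>)) * cinner (u (fst p)) (u (snd p)))\<bar> \<le>
         cmod (iexp (s * ((snd p - fst p) \<bullet> \<xi>)) * cinner (u (fst p)) (u (snd p)))"
        by (rule abs_Re_le_cmod)
      also have "\<dots> = cmod (cinner (u (fst p)) (u (snd p)))"
        by (simp only: norm_mult norm_phase mult_1)
      also note norm_cinner_le
      finally show ?thesis unfolding G_def abs_mult using damp_bounds(1)[of \<epsilon> \<xi>]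
        by (simp add: mult_left_mono)
    qed
    then show "AE q in lborel \<Otimes>\<^sub>M lborel. norm (G (fst q) (snd q)) \<le>
      norm (damp \<epsilon> (fst q) * (4 * (norm (u (fst (snd q))) * norm (u (snd (snd q))))))"
      using damp_bounds(1) by (simp add: abs_mult)
  qed
  have eqG: "damp \<epsilon> \<xi> * (norm (fo s u \<xi>))\<^sup>2 = c * (\<integral>p. G \<xi> p \<partial>lborel)" for \<xi>
    unfolding norm_fo_power2[OF u(2)] G_def c_def lborel_prod by simp
  show "integrable lborel (\<lambda>\<xi>. damp \<epsilon> \<xi> * (norm (fo s u \<xi>))\<^sup>2)"
    unfolding eqG using lborel_pair.integrable_fst'[OF GI] by simp
  have inner: "(\<integral>\<xi>. G \<xi> p \<partial>lborel) = (2 * pi) ^ 3 * (gauss \<epsilon> (snd p - fst p) * (u (fst p) \<bullet> u (snd p)))" for p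
  proof -
    let ?w = "s *\<^sub>R (snd p - fst p)"
    have "(\<integral>\<xi>. G \<xi> p \<partial>lborel) = (\<integral>\<xi>. Re (complex_of_real (damp \<epsilon> \<xi>) * iexp (\<xi> \<bullet> ?w) * cinner (u (fst p)) (u (snd p))) \<partial>lborel)"
      unfolding G_def by (intro Bochner_Integration.integral_cong) (simp_all add: mult.assoc inner_commute)
    also have "\<dots> = Re (\<integral>\<xi>. (complex_of_real (damp \<epsilon> \<xi>) * iexp (\<xi> \<bullet> ?w)) * cinner (u (fst p)) (u (snd p)) \<partial>lborel)"
      by (intro integral_Re integrable_mult_left damp_fourier e)
    also have "\<dots> = Re (of_real ((2 * pi) ^ 3 * gauss \<epsilon> ?w) * cinner (u (fst p)) (u (snd p)))"
      using damp_fourier[OF e, of ?w] by simp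
    also have "\<dots> = (2 * pi) ^ 3 * gauss \<epsilon> ?w * (u (fst p) \<bullet> u (snd p))"
      by (simp only: Re_complex_of_real Im_complex_of_real times_complex.sel Re_cinner mult_zero_left diff_0_right)
    finally show ?thesis using gauss_even[OF s e] by simp
  qed
  have GI': "integrable (lborel \<Otimes>\<^sub>M lborel) (case_prod G)"
    using GI by (simp add: case_prod_beta')
  have gi: "integrable (lborel \<Otimes>\<^sub>M lborel) (\<lambda>p. gauss \<epsilon> (snd p - fst p) * (u (fst p) \<bullet> u (snd p)))"
  proof (rule Bochner_Integration.integrable_bound)
    let ?C = "(1 / (sqrt (2 * pi) * \<epsilon>)) ^ 3"
    show "integrable (lborel \<Otimes>\<^sub>M lborel) (\<lambda>p. ?C * (norm (u (fst p)) * norm (u (snd p))))"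
      using uu by simp
    show "AE p in lborel \<Otimes>\<^sub>M lborel. norm (gauss \<epsilon> (snd p - fst p) * (u (fst p) \<bullet> u (snd p))) \<le>
      norm (?C * (norm (u (fst p)) * norm (u (snd p))))"
      using gauss_bounded[OF e] e
      by (intro AE_I2) (simp add: abs_mult mult_mono Cauchy_Schwarz_ineq2 del: power_one_over)
  qed measurable
  have "(\<integral>\<xi>. damp \<epsilon> \<xi> * (norm (fo s u \<xi>))\<^sup>2 \<partial>lborel) = c * (\<integral>\<xi>. (\<integral>p. G \<xi> p \<partial>lborel) \<partial>lborel)"
    by (simp add: eqG)
  also have "\<dots> = c * (\<integral>p. (\<integral>\<xi>. G \<xi> p \<partial>lborel) \<partial>lborel)"
    using lborel_pair.Fubini_integral[OF GI'] by simp
  also have "\<dots> = (\<integral>p. gauss \<epsilon> (snd p - fst p) * (u (fst p) \<bullet> u (snd p)) \<partial>lborel)"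
    unfolding inner integral_mult_right_zero using two_pi_powr by (simp only: c_def mult_1 mult.assoc[symmetric])
  also have "\<dots> = (\<integral>x. (\<integral>y. gauss \<epsilon> (y - x) * (u x \<bullet> u y) \<partial>lborel) \<partial>lborel)"
    using lborel_pair.integral_fst'[OF gi] by (simp add: lborel_prod)
  \<comment> \<open>The substitution y = x + \<epsilon> z: its Jacobian turns the Gaussian of width
    \<open>\<epsilon>\<close> into the one of width 1, so the parameter survives only in the
    shift.\<close>
  also have "\<dots> = (\<integral>x. (\<integral>z. gauss 1 z * (u x \<bullet> u (x + \<epsilon> *\<^sub>R z)) \<partial>lborel) \<partial>lborel)"
  proof (rule Bochner_Integration.integral_cong[OF refl])
    fix x
    have "(\<integral>y. gauss \<epsilon> (y - x) * (u x \<bullet> u y) \<partial>lborel) = (\<integral>z. gauss \<epsilon> z * (u x \<bullet> u (x + z)) \<partial>lborel)"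
      using lborel_integral_translate[of "\<lambda>y. gauss \<epsilon> (y - x) * (u x \<bullet> u y)" x] by (simp add: add.commute)
    also have "\<dots> = \<epsilon> ^ 3 * (\<integral>z. gauss \<epsilon> (\<epsilon> *\<^sub>R z) * (u x \<bullet> u (x + \<epsilon> *\<^sub>R z)) \<partial>lborel)"
      using e by (subst lborel_integral_scale[of _ \<epsilon>]) auto
    also have "\<dots> = (\<integral>z. gauss 1 z * (u x \<bullet> u (x + \<epsilon> *\<^sub>R z)) \<partial>lborel)"
      unfolding integral_mult_right_zero[symmetric]
      using e by (intro Bochner_Integration.integral_cong) (auto simp: gauss_eq power_mult_distrib power_divide)
    finally show "(\<integral>y. gauss \<epsilon> (y - x) * (u x \<bullet> u y) \<partial>lborel) = \<dots>" .
  qed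
  also have "\<dots> = (\<integral>z. (\<integral>x. gauss 1 z * (u x \<bullet> u (x + \<epsilon> *\<^sub>R z)) \<partial>lborel) \<partial>lborel)"
    using lborel_pair.Fubini_integral[OF lborel_integrable_translate_inner[OF u, of \<epsilon>]] by simp
  also have "\<dots> = (\<integral>z. gauss 1 z * ip u (\<lambda>x. u (x + \<epsilon> *\<^sub>R z)) \<partial>lborel)"
    by (simp add: ip_def)
  finally show "(\<integral>\<xi>. damp \<epsilon> \<xi> * (norm (fo s u \<xi>))\<^sup>2 \<partial>lborel) = \<dots>" .
qed

text \<open>The damping is removed along 1/(n+1). The position side converges by dominated
  convergence and continuity of the autocorrelation at shift 0; the frequency side by monotone
  convergence, which at the same time proves that the transform is square integrable.\<close>

theorem plancherel:
  assumes u: "L2 u" "integrable lborel u" and s: "s\<^sup>2 = 1"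
  shows "L2 (fo s u)" and "L2norm (fo s u) = L2norm u"
proof -
  note [measurable] = L2_measurable[OF u(1)]
  define \<epsilon> where "\<epsilon> n = 1 / real (Suc n)" for n
  have e: "\<epsilon> n > 0" for n by (simp add: \<epsilon>_def)
  have e0: "\<epsilon> \<longlonglongrightarrow> 0" unfolding \<epsilon>_def using LIMSEQ_inverse_real_of_nat by (simp add: inverse_eq_divide)
  have lim: "(\<lambda>n. \<integral>z. gauss 1 z * ip u (\<lambda>x. u (x + \<epsilon> n *\<^sub>R z)) \<partial>lborel) \<longlonglongrightarrow> (\<integral>z. gauss 1 z * ip u u \<partial>lborel)"
  proof (rule integral_dominated_convergence[where w="\<lambda>z. (L2norm u)\<^sup>2 * gauss 1 z"])
    show "integrable lborel (\<lambda>z. (L2norm u)\<^sup>2 * gauss 1 z)" by (simp add: gauss_integrable)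
    show "(\<lambda>z. gauss 1 z * ip u (\<lambda>x. u (x + \<epsilon> n *\<^sub>R z))) \<in> borel_measurable lborel" for n
      unfolding ip_def by measurable
    have "(\<lambda>n. \<epsilon> n *\<^sub>R z) \<longlonglongrightarrow> 0" for z :: "real^3"
      using tendsto_scaleR[OF e0 tendsto_const[of z]] by simp
    then show "AE z in lborel. (\<lambda>n. gauss 1 z * ip u (\<lambda>x. u (x + \<epsilon> n *\<^sub>R z))) \<longlonglongrightarrow> gauss 1 z * ip u u"
      by (intro AE_I2 tendsto_intros translate_ip_tendsto u)
    have "\<bar>ip u (\<lambda>x. u (x + h))\<bar> \<le> (L2norm u)\<^sup>2" for h
      using ip_Cauchy_Schwarz[OF u(1) L2_translate(1)[OF u(1), of h]]
      by (simp add: L2_translate u power2_eq_square)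
    then show "AE z in lborel. norm (gauss 1 z * ip u (\<lambda>x. u (x + \<epsilon> n *\<^sub>R z))) \<le> (L2norm u)\<^sup>2 * gauss 1 z" for n
      by (intro AE_I2) (simp add: abs_mult mult.commute[of _ "gauss 1 _"] mult_left_mono)
  qed measurable
  have L: "(\<lambda>n. \<integral>\<xi>. damp (\<epsilon> n) \<xi> * (norm (fo s u \<xi>))\<^sup>2 \<partial>lborel) \<longlonglongrightarrow> (L2norm u)\<^sup>2"
    using lim unfolding fo_damped(2)[OF u s e] by (simp add: gauss_integrable L2norm_power2_ip)
  have mono: "AE \<xi> in lborel. mono (\<lambda>n. damp (\<epsilon> n) \<xi> * (norm (fo s u \<xi>))\<^sup>2)"
  proof (rule AE_I2, rule monoI)
    fix \<xi> and m n :: nat assume "m \<le> n"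
    then have "\<epsilon> n \<le> \<epsilon> m" by (simp add: \<epsilon>_def frac_le)
    then have "(\<epsilon> n)\<^sup>2 \<le> (\<epsilon> m)\<^sup>2" using e[of n] by (intro power_mono) auto
    then have "damp (\<epsilon> m) \<xi> \<le> damp (\<epsilon> n) \<xi>"
      by (simp add: damp_def mult_right_mono)
    then show "damp (\<epsilon> m) \<xi> * (norm (fo s u \<xi>))\<^sup>2 \<le> damp (\<epsilon> n) \<xi> * (norm (fo s u \<xi>))\<^sup>2"
      by (rule mult_right_mono) simp
  qed
  have pw: "AE \<xi> in lborel. (\<lambda>n. damp (\<epsilon> n) \<xi> * (norm (fo s u \<xi>))\<^sup>2) \<longlonglongrightarrow> (norm (fo s u \<xi>))\<^sup>2"
  proof (rule AE_I2)
    fix \<xi>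
    have "(\<lambda>n. exp (- ((\<epsilon> n)\<^sup>2 * (norm \<xi>)\<^sup>2 / 2)) * (norm (fo s u \<xi>))\<^sup>2) \<longlonglongrightarrow> exp (- (0\<^sup>2 * (norm \<xi>)\<^sup>2 / 2)) * (norm (fo s u \<xi>))\<^sup>2"
      by (intro tendsto_intros e0) auto
    then show "(\<lambda>n. damp (\<epsilon> n) \<xi> * (norm (fo s u \<xi>))\<^sup>2) \<longlonglongrightarrow> (norm (fo s u \<xi>))\<^sup>2"
      by (simp add: damp_def)
  qed
  have pos: "AE \<xi> in lborel. 0 \<le> damp (\<epsilon> n) \<xi> * (norm (fo s u \<xi>))\<^sup>2" for n
    by (simp add: damp_bounds)
  have meas: "(\<lambda>\<xi>. (norm (fo s u \<xi>))\<^sup>2) \<in> borel_measurable lborel" by measurable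
  note * = integral_monotone_convergence_nonneg[OF fo_damped(1)[OF u s e] mono pos pw L meas]
  show "L2 (fo s u)" using *(1) by (simp add: L2_def)
  show "L2norm (fo s u) = L2norm u"
    using *(2) unfolding L2norm_power2[symmetric] by simp
qed

section \<open>The Fourier transform on square-integrable fields\<close>

lemma tendsto_zero_sandwich:
  fixes a b :: "nat \<Rightarrow> real"
  assumes "\<And>n. 0 \<le> a n" "\<And>n. a n \<le> b n" "b \<longlonglongrightarrow> 0"
  shows "a \<longlonglongrightarrow> 0"
  by (rule tendsto_sandwich[OF _ _ tendsto_const assms(3)]) (use assms in auto)

lemma L2norm_diff_power2:
  assumes "L2 u" "L2 w"
  shows "(L2norm (\<lambda>x. u x - w x))\<^sup>2 = (L2norm u)\<^sup>2 - 2 * ip u w + (L2norm w)\<^sup>2"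
  unfolding L2norm_power2_ip using assms
  by (simp add: ip_diff_left ip_diff_right L2_diff ip_commute[of w u])

text \<open>Used on both sides of the Fourier transform: balls in position space occur in the
  definition of \<open>FT2\<close>, balls in frequency space define low-pass parts.\<close>

definition restr :: "(real^3) set \<Rightarrow> wavefn \<Rightarrow> wavefn" where
  "restr S u x = indicator S x *\<^sub>R u x"

lemma restr_measurable [measurable (raw)]:
  assumes [measurable]: "S \<in> sets borel" "u \<in> borel_measurable borel"
  shows "restr S u \<in> borel_measurable borel"
  unfolding restr_def by measurable

lemma L2_restr: "L2 u \<Longrightarrow> S \<in> sets borel \<Longrightarrow> L2 (restr S u)"
  unfolding restr_def[abs_def] by (rule L2_indicator)

lemma norm_restr_le: "norm (restr S u x) \<le> norm (u x)"
  by (simp add: restr_def indicator_def)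

lemma restr_diff: "restr S (\<lambda>x. u x - w x) x = restr S u x - restr S w x"
  by (simp add: restr_def scaleR_diff_right)

lemma L2norm_restr_le: "L2 u \<Longrightarrow> S \<in> sets borel \<Longrightarrow> L2norm (restr S u) \<le> L2norm u"
  using L2_dominated(2)[of u "restr S u" 1] by (simp add: norm_restr_le)

lemma integrable_restr:
  assumes u: "L2 u" and S: "S \<in> sets borel" "emeasure lborel S < \<infinity>"
  shows "integrable lborel (restr S u)"
proof (rule Bochner_Integration.integrable_bound)
  note [measurable] = L2_measurable[OF u] S(1)
  show "integrable lborel (\<lambda>x. indicator S x + (norm (u x))\<^sup>2 :: real)"
    using S L2_integrable[OF u] by (intro Bochner_Integration.integrable_add) (simp_all add: integrable_indicator_iff)
  have "norm (u x) \<le> 1 + (norm (u x))\<^sup>2" for x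
    using sum_squares_bound[of "norm (u x)" 1] norm_ge_zero[of "u x"] by (simp only: power2_eq_square)
  then show "AE x in lborel. norm (restr S u x) \<le> norm (indicator S x + (norm (u x))\<^sup>2 :: real)"
    by (intro AE_I2) (simp add: restr_def indicator_def)
  show "restr S u \<in> borel_measurable lborel" by simp
qed

lemma L2norm_restr_tendsto:
  assumes u: "L2 u" and S: "\<And>n. S n \<in> sets borel" and ev: "\<And>x. \<forall>\<^sub>F n in sequentially. x \<in> S n"
  shows "(\<lambda>n. L2norm (\<lambda>x. restr (S n) u x - u x)) \<longlonglongrightarrow> 0"
proof (rule L2norm_dominated_convergence[OF _ u])
  note [measurable] = L2_measurable[OF u] S
  show "(\<lambda>x. restr (S n) u x - u x) \<in> borel_measurable borel" for n by measurable
  show "norm (restr (S n) u x - u x) \<le> norm (u x)" for n x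
    by (simp add: restr_def indicator_def)
  show "(\<lambda>n. restr (S n) u x - u x) \<longlonglongrightarrow> 0" for x
    using ev[of x] by (intro tendsto_eventually) (erule eventually_mono, simp add: restr_def)
qed

abbreviation "cb n \<equiv> cball (0::real^3) (real n)"

lemma eventually_cb: "\<forall>\<^sub>F n in sequentially. x \<in> cb n"
proof -
  obtain N :: nat where "norm x \<le> real N" using real_arch_simple by blast
  then have "x \<in> cb n" if "n \<ge> N" for n
    using of_nat_mono[OF that, where 'a=real] by simp
  then show ?thesis by (auto simp: eventually_sequentially)
qed

lemma integrable_restr_cb: "L2 u \<Longrightarrow> integrable lborel (restr (cb n) u)"
  by (rule integrable_restr) (simp_all add: emeasure_cball_less_top)

lemma fo_diff:
  assumes u: "integrable lborel u" and w: "integrable lborel w"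
  shows "fo s (\<lambda>x. u x - w x) \<xi> = fo s u \<xi> - fo s w \<xi>"
proof -
  have "(\<integral>x. iexp (s * (x \<bullet> \<xi>)) *s (u x - w x) \<partial>lborel) =
    (\<integral>x. iexp (s * (x \<bullet> \<xi>)) *s u x \<partial>lborel) - (\<integral>x. iexp (s * (x \<bullet> \<xi>)) *s w x \<partial>lborel)"
    unfolding vector_ssub_ldistrib
    by (intro Bochner_Integration.integral_diff integrable_phase u w) measurable
  then show ?thesis by (simp add: fo_def vector_ssub_ldistrib)
qed

lemma fo_add:
  assumes u: "integrable lborel u" and w: "integrable lborel w"
  shows "fo s (\<lambda>x. u x + w x) \<xi> = fo s u \<xi> + fo s w \<xi>"
proof -
  have "(\<integral>x. iexp (s * (x \<bullet> \<xi>)) *s (u x + w x) \<partial>lborel) =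
    (\<integral>x. iexp (s * (x \<bullet> \<xi>)) *s u x \<partial>lborel) + (\<integral>x. iexp (s * (x \<bullet> \<xi>)) *s w x \<partial>lborel)"
    unfolding vector_add_ldistrib
    by (intro Bochner_Integration.integral_add integrable_phase u w) measurable
  then show ?thesis by (simp add: fo_def vector_add_ldistrib)
qed

lemma fo_smult:
  assumes u: "integrable lborel u"
  shows "fo s (\<lambda>x. c *s u x) \<xi> = c *s fo s u \<xi>"
proof -
  have "(\<integral>x. iexp (s * (x \<bullet> \<xi>)) *s (c *s u x) \<partial>lborel) =
    (\<integral>x. c *s (iexp (s * (x \<bullet> \<xi>)) *s u x) \<partial>lborel)"
    by (simp add: vector_smult_assoc mult.commute)
  also have "\<dots> = c *s (\<integral>x. iexp (s * (x \<bullet> \<xi>)) *s u x \<partial>lborel)"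
    by (intro integral_bounded_linear[OF bounded_linear_smult_spinor] integrable_phase u) measurable
  finally show ?thesis by (simp add: fo_def vector_smult_assoc mult.commute)
qed

text \<open>The set integral in \<open>FT2\<close> is \<open>fo (-1)\<close> applied to a truncated
  field, so \<open>FT2\<close> becomes a statement about L2 limits of transforms to which
  \<open>plancherel\<close> applies.\<close>

lemma FT2_iff:
  "FT2 u uh \<longleftrightarrow> L2 uh \<and> (\<lambda>n. L2norm (\<lambda>\<xi>. fo (-1) (restr (cb n) u) \<xi> - uh \<xi>)) \<longlonglongrightarrow> 0"
proof -
  have "(LINT x:cb n|lborel. exp (- \<i> * complex_of_real (x \<bullet> \<xi>)) *s u x) =
    (\<integral>x. iexp ((-1) * (x \<bullet> \<xi>)) *s restr (cb n) u x \<partial>lborel)" for n \<xi>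
    unfolding set_lebesgue_integral_def restr_def
    by (intro Bochner_Integration.integral_cong) (auto simp: indicator_def)
  then show ?thesis
    unfolding FT2_def fo_def L2norm_minus_commute[of "\<lambda>\<xi>. uh \<xi>" for uh] by simp
qed

lemma FT2_L2: "FT2 u uh \<Longrightarrow> L2 uh"
  by (simp add: FT2_def)

lemma L2_fo: "L2 u \<Longrightarrow> integrable lborel u \<Longrightarrow> L2 (fo (-1) u)" "L2 u \<Longrightarrow> integrable lborel u \<Longrightarrow> L2 (fo 1 u)"
  by (simp_all add: plancherel)

lemma FT2_L2_restr: "L2 u \<Longrightarrow> L2 (fo (-1) (restr (cb n) u))"
  by (intro L2_fo L2_restr integrable_restr_cb) auto

text \<open>\<open>FT2\<close> is a relation whose second argument is fixed only up to null sets.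
  Transforms are never chosen by an existence theorem: they come from the definitions of the two
  spectral spaces, from \<open>FT2_fo\<close>, or from the closure rules for
  \<open>FT2\<close>.\<close>

lemma FT2_isometry:
  assumes u: "L2 u" and f: "FT2 u uh"
  shows "L2norm u = L2norm uh"
proof (rule LIMSEQ_unique)
  show "(\<lambda>n. L2norm (fo (-1) (restr (cb n) u))) \<longlonglongrightarrow> L2norm uh"
    using f by (intro L2norm_tendsto FT2_L2_restr u FT2_L2[OF f]) (simp add: FT2_iff)
  have "L2norm (fo (-1) (restr (cb n) u)) = L2norm (restr (cb n) u)" for n
    using u by (intro plancherel L2_restr integrable_restr_cb) auto
  then show "(\<lambda>n. L2norm (fo (-1) (restr (cb n) u))) \<longlonglongrightarrow> L2norm u"
    using L2norm_tendsto[OF L2_restr[OF u] u L2norm_restr_tendsto[OF u]] eventually_cb by simp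
qed

lemma FT2_add:
  assumes u: "L2 u" "FT2 u uh" and w: "L2 w" "FT2 w wh"
  shows "FT2 (\<lambda>x. u x + w x) (\<lambda>\<xi>. uh \<xi> + wh \<xi>)"
  unfolding FT2_iff
proof
  note L = FT2_L2[OF u(2)] FT2_L2[OF w(2)]
  show "L2 (\<lambda>\<xi>. uh \<xi> + wh \<xi>)" using L by (rule L2_add)
  have eq: "restr (cb n) (\<lambda>x. u x + w x) = (\<lambda>x. restr (cb n) u x + restr (cb n) w x)" for n
    by (auto simp: restr_def scaleR_add_right)
  have b: "(\<lambda>n. L2norm (\<lambda>\<xi>. fo (-1) (restr (cb n) u) \<xi> - uh \<xi>) + L2norm (\<lambda>\<xi>. fo (-1) (restr (cb n) w) \<xi> - wh \<xi>)) \<longlonglongrightarrow> 0"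
    using u w unfolding FT2_iff by (auto intro!: tendsto_add_zero)
  have a: "L2norm (\<lambda>\<xi>. fo (-1) (restr (cb n) (\<lambda>x. u x + w x)) \<xi> - (uh \<xi> + wh \<xi>)) \<le>
     L2norm (\<lambda>\<xi>. fo (-1) (restr (cb n) u) \<xi> - uh \<xi>) + L2norm (\<lambda>\<xi>. fo (-1) (restr (cb n) w) \<xi> - wh \<xi>)" for n
    using L2norm_triangle[OF L2_diff[OF FT2_L2_restr[OF u(1), of n] L(1)] L2_diff[OF FT2_L2_restr[OF w(1), of n] L(2)]]
    by (simp add: eq fo_add[OF integrable_restr_cb[OF u(1)] integrable_restr_cb[OF w(1)]] algebra_simps)
  show "(\<lambda>n. L2norm (\<lambda>\<xi>. fo (-1) (restr (cb n) (\<lambda>x. u x + w x)) \<xi> - (uh \<xi> + wh \<xi>))) \<longlonglongrightarrow> 0"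
    by (rule tendsto_zero_sandwich[OF _ a b]) simp
qed

lemma FT2_smult:
  assumes u: "L2 u" "FT2 u uh"
  shows "FT2 (\<lambda>x. c *s u x) (\<lambda>\<xi>. c *s uh \<xi>)"
  unfolding FT2_iff
proof
  show "L2 (\<lambda>\<xi>. c *s uh \<xi>)" using FT2_L2[OF u(2)] by (rule L2_smult)
  have eq: "restr (cb n) (\<lambda>x. c *s u x) = (\<lambda>x. c *s restr (cb n) u x)" for n
    by (auto simp: restr_def indicator_def)
  have "(\<lambda>n. cmod c * L2norm (\<lambda>\<xi>. fo (-1) (restr (cb n) u) \<xi> - uh \<xi>)) \<longlonglongrightarrow> 0"
    using u(2) unfolding FT2_iff by (intro tendsto_mult_right_zero) simp
  then show "(\<lambda>n. L2norm (\<lambda>\<xi>. fo (-1) (restr (cb n) (\<lambda>x. c *s u x)) \<xi> - c *s uh \<xi>)) \<longlonglongrightarrow> 0"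
    unfolding eq fo_smult[OF integrable_restr_cb[OF u(1)]] vector_ssub_ldistrib[symmetric] L2norm_smult .
qed

lemma FT2_diff:
  assumes u: "L2 u" "FT2 u uh" and w: "L2 w" "FT2 w wh"
  shows "FT2 (\<lambda>x. u x - w x) (\<lambda>\<xi>. uh \<xi> - wh \<xi>)"
  using FT2_add[OF u L2_smult[OF w(1)] FT2_smult[OF w], of "-1"] by simp

text \<open>Polarisation of \<open>FT2_isometry\<close>; real polarisation is the right one for the
  real pairing \<open>ip\<close>.\<close>

theorem parseval:
  assumes u: "L2 u" "FT2 u uh" and w: "L2 w" "FT2 w wh"
  shows "ip u w = ip uh wh"
proof -
  have pol: "4 * ip f g = (L2norm (\<lambda>x. f x + g x))\<^sup>2 - (L2norm (\<lambda>x. f x - g x))\<^sup>2"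
    if "L2 f" "L2 g" for f g
    using that unfolding L2norm_power2_ip
    by (simp add: ip_add_left ip_add_right ip_diff_left ip_diff_right L2_add L2_diff ip_commute[of g f])
  have "L2norm (\<lambda>x. u x + w x) = L2norm (\<lambda>x. uh x + wh x)"
    by (intro FT2_isometry L2_add FT2_add u w)
  moreover have "L2norm (\<lambda>x. u x - w x) = L2norm (\<lambda>x. uh x - wh x)"
    by (intro FT2_isometry L2_diff FT2_diff u w)
  ultimately show ?thesis
    using pol[OF u(1) w(1)] pol[OF FT2_L2[OF u(2)] FT2_L2[OF w(2)]] by simp
qed

text \<open>Fubini, with the phase moved to the other factor of the pairing. Conjugation reverses
  the sign of the phase.\<close>

lemma fo_adjoint:
  assumes h: "integrable lborel h" and u: "integrable lborel u"
  shows "ip (fo s h) u = ip h (fo (-s) u)"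
proof -
  have [measurable]: "h \<in> borel_measurable borel" "u \<in> borel_measurable borel" using h u by auto
  let ?c = "(2 * pi) powr (-3/2)"
  let ?e = "\<lambda>s x \<xi>. iexp (s * (x \<bullet> \<xi>))"
  have ih: "integrable lborel (\<lambda>\<xi>. ?e s \<xi> x *s h \<xi>)" for x s
    by (intro integrable_phase h) measurable
  have iu: "integrable lborel (\<lambda>x. ?e s x \<xi> *s u x)" for \<xi> s
    by (intro integrable_phase u) measurable
  have eq: "(?e s \<xi> x *s h \<xi>) \<bullet> u x = h \<xi> \<bullet> (?e (-s) x \<xi> *s u x)" for x \<xi>
    using inner_smult_spinor[of "?e s \<xi> x" "h \<xi>" 1 "u x"] inner_smult_spinor[of 1 "h \<xi>" "?e (-s) x \<xi>" "u x"]
    by (simp add: exp_cnj inner_commute)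
  have int: "integrable (lborel \<Otimes>\<^sub>M lborel) (\<lambda>(x, \<xi>). (?e s \<xi> x *s h \<xi>) \<bullet> u x)"
  proof (rule Bochner_Integration.integrable_bound)
    show "integrable (lborel \<Otimes>\<^sub>M lborel) (\<lambda>p. norm (u (fst p)) * norm (h (snd p)))"
      using h u by (intro lborel_pair_integrable_mult) auto
    have "\<bar>(?e s \<xi> x *s h \<xi>) \<bullet> u x\<bar> \<le> norm (u x) * norm (h \<xi>)" for x \<xi>
      using Cauchy_Schwarz_ineq2[of "?e s \<xi> x *s h \<xi>" "u x"]
      by (simp only: norm_smult_spinor norm_phase mult_1 mult.commute[of "norm (u x)"])
    then show "AE p in lborel \<Otimes>\<^sub>M lborel. norm (case p of (x, \<xi>) \<Rightarrow> (?e s \<xi> x *s h \<xi>) \<bullet> u x) \<le>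
        norm (norm (u (fst p)) * norm (h (snd p)))"
      by (intro AE_I2) (simp add: case_prod_beta)
  qed measurable
  have "ip (fo s h) u = ?c * (\<integral>x. (\<integral>\<xi>. ?e s \<xi> x *s h \<xi> \<partial>lborel) \<bullet> u x \<partial>lborel)"
    by (simp add: ip_def fo_def smult_of_real_spinor)
  also have "\<dots> = ?c * (\<integral>x. (\<integral>\<xi>. (?e s \<xi> x *s h \<xi>) \<bullet> u x \<partial>lborel) \<partial>lborel)"
    using ih by (subst integral_inner_left) auto
  also have "\<dots> = ?c * (\<integral>\<xi>. (\<integral>x. (?e s \<xi> x *s h \<xi>) \<bullet> u x \<partial>lborel) \<partial>lborel)"
    using lborel_pair.Fubini_integral[OF int] by simp
  also have "\<dots> = ?c * (\<integral>\<xi>. h \<xi> \<bullet> (\<integral>x. ?e (-s) x \<xi> *s u x \<partial>lborel) \<partial>lborel)"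
    unfolding eq by (subst integral_inner_right) (use iu[of "-s"] in simp_all)
  also have "\<dots> = ip h (fo (-s) u)"
    by (simp add: ip_def fo_def smult_of_real_spinor)
  finally show ?thesis .
qed

text \<open>Fourier inversion from adjointness. With r the truncation of \<open>fo 1 h\<close>, the
  pairing of its transform with \<open>h\<close> is the squared norm of r, so the squared distance
  of the transform from \<open>h\<close> expands to the squared norm of \<open>fo 1 h\<close> minus
  that of r, which tends to 0.\<close>

theorem FT2_fo:
  assumes h: "L2 h" "integrable lborel h"
  shows "FT2 (fo 1 h) h"
  unfolding FT2_iff
proof
  let ?u = "fo 1 h" let ?r = "\<lambda>n. restr (cb n) ?u"
  have u: "L2 ?u" and nu: "L2norm ?u = L2norm h" using plancherel[OF h, of 1] by simp_all
  have r: "L2 (?r n)" "integrable lborel (?r n)" for n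
    using u by (auto intro: L2_restr integrable_restr_cb)
  have L: "L2 (fo (-1) (?r n))" for n using r by (rule L2_fo)
  have "ip (fo (-1) (?r n)) h = (L2norm (?r n))\<^sup>2" for n
  proof -
    have "ip (fo (-1) (?r n)) h = ip (?r n) ?u" using fo_adjoint[OF r(2) h(2), of "-1"] by simp
    also have "\<dots> = ip (?r n) (?r n)"
      unfolding ip_def by (intro Bochner_Integration.integral_cong) (auto simp: restr_def indicator_def)
    finally show ?thesis by (simp add: L2norm_power2_ip)
  qed
  moreover have "L2norm (fo (-1) (?r n)) = L2norm (?r n)" for n using r by (simp add: plancherel)
  ultimately have sq: "(L2norm (\<lambda>\<xi>. fo (-1) (?r n) \<xi> - h \<xi>))\<^sup>2 = (L2norm ?u)\<^sup>2 - (L2norm (?r n))\<^sup>2" for n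
    using L2norm_diff_power2[OF L h(1), of n] by (simp add: nu)
  have eq: "L2norm (\<lambda>\<xi>. fo (-1) (?r n) \<xi> - h \<xi>) = sqrt ((L2norm ?u)\<^sup>2 - (L2norm (?r n))\<^sup>2)" for n
    by (rule real_sqrt_unique[OF sq L2norm_nonneg, symmetric])
  have "(\<lambda>n. sqrt ((L2norm ?u)\<^sup>2 - (L2norm (?r n))\<^sup>2)) \<longlonglongrightarrow> sqrt ((L2norm ?u)\<^sup>2 - (L2norm ?u)\<^sup>2)"
    by (intro tendsto_real_sqrt tendsto_diff tendsto_power tendsto_const L2norm_tendsto[OF r(1) u]
        L2norm_restr_tendsto[OF u] eventually_cb) simp
  then show "(\<lambda>n. L2norm (\<lambda>\<xi>. fo (-1) (?r n) \<xi> - h \<xi>)) \<longlonglongrightarrow> 0"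
    by (simp add: eq)
qed (rule h)

section \<open>Smooth cutoffs\<close>

lemma pd_eqI:
  assumes "\<And>x. (f has_derivative f' x) (at x)"
  shows "pd k f = (\<lambda>x. f' x (axis k 1))"
  using frechet_derivative_at[OF assms] by (auto simp: pd_def)

lemma has_derivative_pd:
  assumes "f differentiable (at x)"
  shows "(f has_derivative frechet_derivative f (at x)) (at x)"
  using assms by (simp add: frechet_derivative_works)

text \<open>\<open>test_fn\<close> asks for differentiability of all iterated partial derivatives;
  it suffices to exhibit a set of differentiable functions closed under \<open>pd\<close>.\<close>

lemma smooth_closed:
  assumes S: "\<And>f x. f \<in> S \<Longrightarrow> f differentiable (at x)" "\<And>f k. f \<in> S \<Longrightarrow> pd k f \<in> S"
    and f: "f \<in> S"
  shows "dpart ks f differentiable (at x)"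
proof -
  have "dpart ks f \<in> S" by (induction ks) (simp_all add: f S)
  then show ?thesis by (rule S)
qed

text \<open>The powers of \<open>1/t\<close> make the family closed under differentiation.\<close>
definition bump :: "nat \<Rightarrow> real \<Rightarrow> real" where
  "bump m t = (if t > 0 then exp (- (1 / t)) / t ^ m else 0)"

lemma bump_tendsto: "(bump m \<longlongrightarrow> 0) (at 0)"
proof -
  have "((\<lambda>t::real. inverse t ^ m / exp (inverse t)) \<longlongrightarrow> 0) (at_right 0)"
    by (rule filterlim_compose[OF tendsto_power_div_exp_0 filterlim_inverse_at_top_right])
  then have r: "(bump m \<longlongrightarrow> 0) (at_right 0)"
    by (rule Lim_transform_eventually)
       (auto simp: eventually_at_filter bump_def exp_minus field_simps)
  have "(bump m \<longlongrightarrow> 0) (at_left 0)"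
    by (rule tendsto_eventually) (auto simp: eventually_at_filter bump_def)
  with r show ?thesis by (simp add: filterlim_split_at)
qed

lemma bump_has_derivative:
  "(bump m has_real_derivative (bump (m + 2) t - real m * bump (m + 1) t)) (at t)"
proof -
  consider "t > 0" | "t < 0" | "t = 0" by linarith
  then show ?thesis
  proof cases
    case 1
    have "((\<lambda>t. exp (- (1 / t)) / t ^ m) has_real_derivative
        (exp (- (1/t)) * (1 / t\<^sup>2) * t ^ m - exp (- (1/t)) * (real m * t ^ (m - 1))) / (t ^ m * t ^ m)) (at t)"
      using 1 by (auto intro!: derivative_eq_intros simp: power2_eq_square)
    also have "(exp (- (1/t)) * (1 / t\<^sup>2) * t ^ m - exp (- (1/t)) * (real m * t ^ (m - 1))) / (t ^ m * t ^ m) =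
        bump (m + 2) t - real m * bump (m + 1) t"
      using 1 by (cases m) (simp_all add: bump_def field_simps power2_eq_square)
    finally show ?thesis
      by (rule has_field_derivative_transform_within_open[where S="{0<..}"]) (use 1 in \<open>auto simp: bump_def\<close>)
  next
    case 2
    have "((\<lambda>t. 0) has_real_derivative 0) (at t)" by simp
    then have "(bump m has_real_derivative 0) (at t)"
      by (rule has_field_derivative_transform_within_open[where S="{..<0}"]) (use 2 in \<open>auto simp: bump_def\<close>)
    then show ?thesis using 2 by (simp add: bump_def)
  next
    case 3
    \<comment> \<open>At the origin the difference quotient of \<open>bump m\<close> is exactly
      \<open>bump (Suc m)\<close>, whose limit is known.\<close>
    have "((\<lambda>h. (bump m (0 + h) - bump m 0) / h) \<longlongrightarrow> 0) (at 0)"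
      by (rule Lim_transform_eventually[OF bump_tendsto[of "Suc m"]])
         (auto simp: eventually_at_filter bump_def)
    then have "(bump m has_real_derivative 0) (at 0)" by (simp add: DERIV_def)
    then show ?thesis using 3 by (simp add: bump_def)
  qed
qed

lemma bump_nonneg: "0 \<le> bump m t" by (simp add: bump_def)

lemma bump_0_le: "bump 0 t \<le> exp (-1) \<or> t > 1" 
  by (auto simp: bump_def field_simps)

text \<open>With s = 1/t this is the boundedness of exp(-s) s^2, read off from exp s \<ge> s^2/2. It
  is needed because \<open>bump 2\<close> is the bump factor in the gradient of the cutoff.\<close>

lemma bump_2_le: "bump 2 t \<le> 2"
proof (cases "t > 0")
  case True
  define s where "s = 1 / t"
  have s: "s > 0" using True by (simp add: s_def)
  have "s\<^sup>2 / 2 \<le> exp s"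
    using exp_lower_Taylor_quadratic[of s] s by linarith
  then have "exp (- s) * (s\<^sup>2 / 2) \<le> exp (- s) * exp s"
    by (intro mult_left_mono) auto
  also have "\<dots> = 1" by (simp add: exp_minus)
  finally have "exp (- s) * s\<^sup>2 \<le> 2" by simp
  moreover have "bump 2 t = exp (- s) * s\<^sup>2"
    using True by (simp add: bump_def s_def power_divide)
  ultimately show ?thesis by simp
qed (simp add: bump_def)

text \<open>A concrete algebra of smooth functions, closed under \<open>pd\<close> and just rich
  enough to contain a compactly supported cutoff times the real and imaginary parts of plane
  waves.\<close>

inductive_set sm :: "(real^3 \<Rightarrow> real) set" where
  const: "(\<lambda>x. c) \<in> sm"
| coord: "(\<lambda>x. x $ k) \<in> sm"
| cos: "(\<lambda>x. cos (x \<bullet> \<xi>)) \<in> sm"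
| sin: "(\<lambda>x. sin (x \<bullet> \<xi>)) \<in> sm"
| bump: "(\<lambda>x. bump m (1 - a * (x \<bullet> x))) \<in> sm"
| add: "f \<in> sm \<Longrightarrow> g \<in> sm \<Longrightarrow> (\<lambda>x. f x + g x) \<in> sm"
| mult: "f \<in> sm \<Longrightarrow> g \<in> sm \<Longrightarrow> (\<lambda>x. f x * g x) \<in> sm"

lemma bump_radial_has_derivative:
  "((\<lambda>x::real^3. bump m (1 - a * (x \<bullet> x))) has_derivative
    (\<lambda>h. (bump (m + 2) (1 - a * (x \<bullet> x)) - real m * bump (m + 1) (1 - a * (x \<bullet> x))) * (- 2 * a * (x \<bullet> h)))) (at x)"
proof -
  have "((\<lambda>x::real^3. 1 - a * (x \<bullet> x)) has_derivative (\<lambda>h. - 2 * a * (x \<bullet> h))) (at x)"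
    by (auto intro!: derivative_eq_intros simp: inner_commute algebra_simps)
  from has_derivative_compose[OF this has_field_derivative_imp_has_derivative[OF bump_has_derivative]]
  show ?thesis .
qed

lemma sm_diff_pd: "f \<in> sm \<Longrightarrow> (\<forall>x. f differentiable (at x)) \<and> (\<forall>k. pd k f \<in> sm)"
proof (induction rule: sm.induct)
  case (const c)
  have "pd k (\<lambda>x. c) = (\<lambda>x. 0)" for k by (rule pd_eqI) simp
  then show ?case by (auto intro: sm.intros)
next
  case (coord j)
  have d: "((\<lambda>x::real^3. x $ j) has_derivative (\<lambda>h. h $ j)) (at x)" for x
    by (rule bounded_linear_imp_has_derivative[OF bounded_linear_vec_nth])
  have "pd k (\<lambda>x. x $ j) = (\<lambda>x. axis k 1 $ j)" for k by (rule pd_eqI) (rule d)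
  then show ?case using d by (auto intro: sm.intros simp: differentiable_def)
next
  case (cos \<xi>)
  have d: "((\<lambda>x::real^3. cos (x \<bullet> \<xi>)) has_derivative (\<lambda>h. - (h \<bullet> \<xi>) * sin (x \<bullet> \<xi>))) (at x)" for x
    by (auto intro!: derivative_eq_intros)
  have "pd k (\<lambda>x. cos (x \<bullet> \<xi>)) = (\<lambda>x. - (axis k 1 \<bullet> \<xi>) * sin (x \<bullet> \<xi>))" for k by (rule pd_eqI) (rule d)
  moreover have "(\<lambda>x. - (axis k 1 \<bullet> \<xi>) * sin (x \<bullet> \<xi>)) \<in> sm" for k by (intro sm.intros)
  ultimately show ?case using d by (simp add: differentiable_def) blast
next
  case (sin \<xi>)
  have d: "((\<lambda>x::real^3. sin (x \<bullet> \<xi>)) has_derivative (\<lambda>h. (h \<bullet> \<xi>) * cos (x \<bullet> \<xi>))) (at x)" for x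
    by (auto intro!: derivative_eq_intros)
  have "pd k (\<lambda>x. sin (x \<bullet> \<xi>)) = (\<lambda>x. (axis k 1 \<bullet> \<xi>) * cos (x \<bullet> \<xi>))" for k by (rule pd_eqI) (rule d)
  then show ?case using d by (auto intro!: sm.intros(1,3,7) simp: differentiable_def)
next
  case (bump m a)
  note d = bump_radial_has_derivative[of m a]
  have "pd k (\<lambda>x. bump m (1 - a * (x \<bullet> x))) =
    (\<lambda>x. (bump (m + 2) (1 - a * (x \<bullet> x)) + (- real m) * bump (m + 1) (1 - a * (x \<bullet> x))) * ((- 2 * a) * x $ k))" for k
    by (subst pd_eqI[OF d]) (simp add: inner_axis)
  moreover have "(\<lambda>x. (bump (m + 2) (1 - a * (x \<bullet> x)) + (- real m) * bump (m + 1) (1 - a * (x \<bullet> x))) * ((- 2 * a) * x $ k)) \<in> sm" for k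
    by (intro sm.intros)
  ultimately have "pd k (\<lambda>x. bump m (1 - a * (x \<bullet> x))) \<in> sm" for k by (simp only:)
  then show ?case using d by (auto simp only: differentiable_def)
next
  case (add f g)
  have "pd k (\<lambda>x. f x + g x) = (\<lambda>x. pd k f x + pd k g x)" for k
    unfolding pd_def[of k f] pd_def[of k g]
    by (rule pd_eqI) (use add.IH in \<open>auto intro!: has_derivative_add has_derivative_pd\<close>)
  then show ?case using add.IH by (auto intro: sm.intros(6))
next
  case (mult f g)
  have "pd k (\<lambda>x. f x * g x) = (\<lambda>x. f x * pd k g x + pd k f x * g x)" for k
    unfolding pd_def[of k f] pd_def[of k g]
    by (rule pd_eqI) (use mult.IH in \<open>auto intro!: has_derivative_mult has_derivative_pd\<close>)
  then show ?case using mult by (auto intro!: sm.intros(6,7))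
qed

lemma sm_test_fn:
  assumes "f \<in> sm" and "compact (closure {x. f x \<noteq> 0})"
  shows "test_fn f"
  unfolding test_fn_def using smooth_closed[OF _ _ assms(1)] sm_diff_pd assms(2) by blast

lemma sm_continuous: "f \<in> sm \<Longrightarrow> continuous_on UNIV f"
  using sm_diff_pd by (intro continuous_at_imp_continuous_on) (auto intro: differentiable_imp_continuous_within)

lemma sm_measurable [measurable_dest]: "f \<in> sm \<Longrightarrow> f \<in> borel_measurable borel"
  by (intro borel_measurable_continuous_onI sm_continuous)

text \<open>The factor \<open>exp 1\<close> normalises the value at the origin to 1; the support
  lies in the ball of radius \<open>Suc n\<close>.\<close>

definition cutoff :: "nat \<Rightarrow> real^3 \<Rightarrow> real" where
  "cutoff n x = exp 1 * bump 0 (1 - (1 / real (Suc n))\<^sup>2 * (x \<bullet> x))"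

lemma cutoff_sm: "cutoff n \<in> sm"
  unfolding cutoff_def[abs_def] by (intro sm.intros)

lemma cutoff_bounds: "0 \<le> cutoff n x" "cutoff n x \<le> 1"
proof -
  show "0 \<le> cutoff n x" by (simp add: cutoff_def bump_nonneg)
  have "bump 0 (1 - (1 / real (Suc n))\<^sup>2 * (x \<bullet> x)) \<le> exp (-1)"
  proof -
    have "1 - (1 / real (Suc n))\<^sup>2 * (x \<bullet> x) \<le> 1"
      using mult_nonneg_nonneg[of "(1 / real (Suc n))\<^sup>2" "x \<bullet> x"] by simp
    then show ?thesis using bump_0_le by (meson not_le)
  qed
  then have "cutoff n x \<le> exp 1 * exp (-1)" unfolding cutoff_def by (intro mult_left_mono) auto
  then show "cutoff n x \<le> 1" by (simp add: exp_minus)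
qed

lemma cutoff_tendsto: "(\<lambda>n. cutoff n x) \<longlonglongrightarrow> 1"
proof -
  have c: "isCont (bump 0) 1" using DERIV_isCont[OF bump_has_derivative] .
  have "(\<lambda>n. 1 - (1 / real (Suc n))\<^sup>2 * (x \<bullet> x)) \<longlonglongrightarrow> 1 - 0\<^sup>2 * (x \<bullet> x)"
    using LIMSEQ_inverse_real_of_nat by (intro tendsto_intros) (simp add: inverse_eq_divide)
  then have "(\<lambda>n. bump 0 (1 - (1 / real (Suc n))\<^sup>2 * (x \<bullet> x))) \<longlonglongrightarrow> bump 0 1"
    by (intro isCont_tendsto_compose[OF c]) simp
  then have "(\<lambda>n. cutoff n x) \<longlonglongrightarrow> exp 1 * bump 0 1"
    unfolding cutoff_def by (intro tendsto_intros)
  then show ?thesis by (simp add: bump_def exp_minus)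
qed

lemma bump_radial_eq_0: "norm x > real (Suc n) \<Longrightarrow> bump m (1 - (1 / real (Suc n))\<^sup>2 * (x \<bullet> x)) = 0"
proof -
  assume a: "norm x > real (Suc n)"
  have "(1 / real (Suc n) * norm x)\<^sup>2 \<ge> 1"
    using a by (intro one_le_power) (simp add: field_simps)
  then have "(1 / real (Suc n))\<^sup>2 * (x \<bullet> x) \<ge> 1"
    by (simp only: power_mult_distrib power2_norm_eq_inner)
  then show ?thesis by (simp add: bump_def del: of_nat_Suc)
qed

lemma cutoff_eq_0: "norm x > real (Suc n) \<Longrightarrow> cutoff n x = 0"
  using bump_radial_eq_0[of n x 0] by (simp add: cutoff_def)

lemma compact_support_cb:
  assumes "\<And>x. norm (x::real^3) > r \<Longrightarrow> f x = (0::real)"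
  shows "compact (closure {x. f x \<noteq> 0})"
proof -
  have "{x. f x \<noteq> 0} \<subseteq> cball 0 r" using assms by (auto simp: not_less[symmetric])
  then show ?thesis using bounded_cball bounded_subset compact_closure by blast
qed

lemma pd_cutoff:
  "pd k (cutoff n) x = exp 1 * (bump 2 (1 - (1 / real (Suc n))\<^sup>2 * (x \<bullet> x)) * (- 2 * (1 / real (Suc n))\<^sup>2 * x $ k))"
proof -
  have "pd k (cutoff n) = (\<lambda>x. exp 1 * (bump 2 (1 - (1 / real (Suc n))\<^sup>2 * (x \<bullet> x)) * (- 2 * (1 / real (Suc n))\<^sup>2 * (x \<bullet> axis k 1))))"
    unfolding cutoff_def[abs_def]
    by (rule pd_eqI, rule has_derivative_mult_right)
       (use bump_radial_has_derivative[of 0 "(1 / real (Suc n))\<^sup>2"] in \<open>simp add: numeral_2_eq_2\<close>)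
  then show ?thesis by (simp add: inner_axis)
qed

text \<open>On the support the inner derivative is at most 2/(n+1), the bump factor is at most 2 and
  the normalisation contributes \<open>exp 1\<close>. The decay in n makes the commutator with the
  cutoff vanish in the limit.\<close>

lemma pd_cutoff_bound: "\<bar>pd k (cutoff n) x\<bar> \<le> 4 * exp 1 / real (Suc n)"
proof (cases "norm x > real (Suc n)")
  case True
  then show ?thesis unfolding pd_cutoff bump_radial_eq_0[OF True] by simp
next
  case False
  let ?r = "1 / real (Suc n)"
  have "\<bar>x $ k\<bar> \<le> real (Suc n)" using component_le_norm_cart[of x k] False by simp
  then have 1: "2 * ?r\<^sup>2 * \<bar>x $ k\<bar> \<le> 2 * ?r\<^sup>2 * real (Suc n)" by (intro mult_left_mono) auto
  have "\<bar>pd k (cutoff n) x\<bar> = exp 1 * (bump 2 (1 - ?r\<^sup>2 * (x \<bullet> x)) * (2 * ?r\<^sup>2 * \<bar>x $ k\<bar>))"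
    unfolding pd_cutoff by (simp add: abs_mult bump_nonneg)
  also have "\<dots> \<le> exp 1 * (2 * (2 * ?r\<^sup>2 * real (Suc n)))"
    by (intro mult_left_mono mult_mono bump_2_le 1 bump_nonneg) auto
  also have "\<dots> = 4 * exp 1 / real (Suc n)" by (simp add: power2_eq_square del: of_nat_Suc)
  finally show ?thesis .
qed

section \<open>Fourier transform of weak derivatives\<close>

text \<open>Fatou's lemma along growing balls. It serves for a field that is not yet known to be
  square integrable, but whose truncations have norms bounded independently of the radius.\<close>

lemma L2_local_bound:
  fixes F :: wavefn
  assumes [measurable]: "F \<in> borel_measurable borel"
    and L: "\<And>n. L2 (restr (cb n) F)" and c: "\<And>n. L2norm (restr (cb n) F) \<le> c"
  shows "L2 F" "L2norm F \<le> c"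
proof -
  have c0: "0 \<le> c" using c[of 0] L2norm_nonneg order_trans by blast
  have "(\<integral>\<^sup>+x. ennreal ((norm (F x))\<^sup>2) \<partial>lborel) = (\<integral>\<^sup>+x. liminf (\<lambda>n. ennreal ((norm (restr (cb n) F x))\<^sup>2)) \<partial>lborel)"
  proof (rule nn_integral_cong)
    fix x
    have "(\<lambda>n. ennreal ((norm (restr (cb n) F x))\<^sup>2)) \<longlonglongrightarrow> ennreal ((norm (F x))\<^sup>2)"
      by (rule tendsto_eventually, rule eventually_mono[OF eventually_cb[of x]]) (simp add: restr_def)
    then show "ennreal ((norm (F x))\<^sup>2) = liminf (\<lambda>n. ennreal ((norm (restr (cb n) F x))\<^sup>2))"
      by (rule lim_imp_Liminf[OF trivial_limit_sequentially, symmetric])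
  qed
  also have "\<dots> \<le> liminf (\<lambda>n. \<integral>\<^sup>+x. ennreal ((norm (restr (cb n) F x))\<^sup>2) \<partial>lborel)"
    by (rule nn_integral_liminf) measurable
  also have "\<dots> \<le> liminf (\<lambda>n::nat. ennreal (c\<^sup>2))"
  proof (rule Liminf_mono, rule always_eventually, rule allI)
    fix n
    have "(\<integral>\<^sup>+x. ennreal ((norm (restr (cb n) F x))\<^sup>2) \<partial>lborel) = ennreal ((L2norm (restr (cb n) F))\<^sup>2)"
      unfolding L2norm_power2 by (rule nn_integral_eq_integral[OF L2_integrable[OF L]]) simp
    also have "\<dots> \<le> ennreal (c\<^sup>2)" by (intro ennreal_leI power_mono c) simp
    finally show "(\<integral>\<^sup>+x. ennreal ((norm (restr (cb n) F x))\<^sup>2) \<partial>lborel) \<le> ennreal (c\<^sup>2)" .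
  qed
  also have "\<dots> = ennreal (c\<^sup>2)" by (rule lim_imp_Liminf[OF trivial_limit_sequentially tendsto_const])
  finally have le: "(\<integral>\<^sup>+x. ennreal ((norm (F x))\<^sup>2) \<partial>lborel) \<le> ennreal (c\<^sup>2)" .
  then have "integrable lborel (\<lambda>x. (norm (F x))\<^sup>2)"
    by (intro integrableI_bounded) (auto intro: le_less_trans)
  then show L2: "L2 F" by (simp add: L2_def)
  have "ennreal ((L2norm F)\<^sup>2) \<le> ennreal (c\<^sup>2)"
    using le nn_integral_eq_integral[OF L2_integrable[OF L2]] by (simp add: L2norm_power2)
  then have "(L2norm F)\<^sup>2 \<le> c\<^sup>2" by (simp add: ennreal_le_iff)
  then show "L2norm F \<le> c" using c0 by (rule power2_le_imp_le)
qed

lemma L2norm_fo_diff: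
  assumes a: "L2 a" "integrable lborel a" and b: "L2 b" "integrable lborel b"
  shows "L2norm (\<lambda>\<xi>. fo (-1) a \<xi> - fo (-1) b \<xi>) = L2norm (\<lambda>x. a x - b x)"
proof -
  have "(\<lambda>\<xi>. fo (-1) a \<xi> - fo (-1) b \<xi>) = fo (-1) (\<lambda>x. a x - b x)"
    using fo_diff[OF a(2) b(2)] by auto
  then show ?thesis using plancherel(2)[OF L2_diff[OF a(1) b(1)], of "-1"] a b by simp
qed

section \<open>Cutoff fields and their commutator terms\<close>

definition cut :: "nat \<Rightarrow> wavefn \<Rightarrow> wavefn" where
  "cut n u x = cutoff n x *\<^sub>R u x"

definition dcut :: "3 \<Rightarrow> nat \<Rightarrow> wavefn \<Rightarrow> wavefn" where
  "dcut k n u x = pd k (cutoff n) x *\<^sub>R u x"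

lemma pd_sm: "f \<in> sm \<Longrightarrow> pd k f \<in> sm"
  using sm_diff_pd by blast

lemma pd_cutoff_eq_0: "norm x > real (Suc n) \<Longrightarrow> pd k (cutoff n) x = 0"
  unfolding pd_cutoff by (simp only: bump_radial_eq_0 mult_zero_left mult_zero_right)

lemma integrable_mult_compact:
  fixes m :: "real^3 \<Rightarrow> real" and u :: wavefn
  assumes u: "L2 u" and [measurable]: "m \<in> borel_measurable borel"
    and b: "\<And>x. \<bar>m x\<bar> \<le> C" and z: "\<And>x. norm x > real N \<Longrightarrow> m x = 0"
  shows "integrable lborel (\<lambda>x. m x *\<^sub>R u x)"
proof (rule Bochner_Integration.integrable_bound)
  note [measurable] = L2_measurable[OF u]
  show "integrable lborel (\<lambda>x. C *\<^sub>R restr (cb N) u x)"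
    using integrable_restr_cb[OF u] by simp
  have "\<bar>m x\<bar> * norm (u x) \<le> \<bar>C\<bar> * norm (restr (cb N) u x)" for x
  proof (cases "norm x > real N")
    case False
    then show ?thesis using order_trans[OF b[of x] abs_ge_self] by (simp add: restr_def mult_right_mono)
  qed (simp add: z)
  then show "AE x in lborel. norm (m x *\<^sub>R u x) \<le> norm (C *\<^sub>R restr (cb N) u x)" by simp
  show "(\<lambda>x. m x *\<^sub>R u x) \<in> borel_measurable lborel" by measurable
qed

lemma cutoff_abs: "\<bar>cutoff n x\<bar> \<le> 1" using cutoff_bounds[of n x] by simp

lemma cut_measurable [measurable (raw)]:
  assumes [measurable]: "u \<in> borel_measurable borel"
  shows "cut n u \<in> borel_measurable borel" "dcut k n u \<in> borel_measurable borel"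
proof -
  note [measurable] = sm_measurable[OF cutoff_sm] sm_measurable[OF pd_sm[OF cutoff_sm]]
  show "cut n u \<in> borel_measurable borel" "dcut k n u \<in> borel_measurable borel"
    unfolding cut_def dcut_def by measurable
qed

lemma integrable_cut: "L2 u \<Longrightarrow> integrable lborel (cut n u)"
  unfolding cut_def[abs_def]
  by (rule integrable_mult_compact[where C=1 and N="Suc n"])
     (auto simp: cutoff_abs cutoff_eq_0 sm_measurable[OF cutoff_sm] simp del: of_nat_Suc)

lemma integrable_dcut: "L2 u \<Longrightarrow> integrable lborel (dcut k n u)"
  unfolding dcut_def[abs_def]
  by (rule integrable_mult_compact[where C="4 * exp 1 / real (Suc n)" and N="Suc n"])
     (auto simp: pd_cutoff_bound pd_cutoff_eq_0 sm_measurable[OF pd_sm[OF cutoff_sm]] simp del: of_nat_Suc)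

lemma L2_cut: "L2 u \<Longrightarrow> L2 (cut n u)"
  by (rule L2_dominated(1)[where u=u and C=1]) (auto simp: cut_def cutoff_bounds mult_left_le_one_le)

lemma L2_dcut: 
  assumes u: "L2 u" 
  shows "L2 (dcut k n u)" "L2norm (dcut k n u) \<le> (4 * exp 1 / real (Suc n)) * L2norm u"
proof -
  have b: "AE x in lborel. norm (dcut k n u x) \<le> (4 * exp 1 / real (Suc n)) * norm (u x)"
    unfolding dcut_def norm_scaleR by (intro AE_I2 mult_right_mono pd_cutoff_bound norm_ge_zero)
  have m: "dcut k n u \<in> borel_measurable borel" using L2_measurable[OF u] by measurable
  show "L2 (dcut k n u)" "L2norm (dcut k n u) \<le> (4 * exp 1 / real (Suc n)) * L2norm u"
    by (rule L2_dominated[OF u m b]; simp)+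
qed

lemma cut_tendsto:
  assumes u: "L2 u" shows "(\<lambda>n. L2norm (\<lambda>x. cut n u x - u x)) \<longlonglongrightarrow> 0"
proof (rule L2norm_dominated_convergence[OF _ u])
  note [measurable] = L2_measurable[OF u]
  show "(\<lambda>x. cut n u x - u x) \<in> borel_measurable borel" for n by measurable
  have eq: "cut n u x - u x = (cutoff n x - 1) *\<^sub>R u x" for n x
    by (simp add: cut_def algebra_simps)
  show "norm (cut n u x - u x) \<le> norm (u x)" for n x
    unfolding eq using cutoff_bounds[of n x] by (simp add: mult_left_le_one_le)
  have "(\<lambda>n. (cutoff n x - 1) *\<^sub>R u x) \<longlonglongrightarrow> (1 - 1) *\<^sub>R u x" for x
    by (intro tendsto_intros cutoff_tendsto)
  then show "(\<lambda>n. cut n u x - u x) \<longlonglongrightarrow> 0" for x unfolding eq by simp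
qed

lemma exp_minus_phase: "iexp (- t) = complex_of_real (cos t) - \<i> * complex_of_real (sin t)"
  by (simp only: cis_conv_exp[symmetric]) (simp add: complex_eq_iff)

text \<open>Testing the weak derivative against \<open>cutoff n\<close> times a plane wave.\<close>
lemma fo_cut_weak_deriv:
  assumes u: "L2 u" and g: "L2 g" and wd: "weak_deriv u k g"
  shows "fo (-1) (cut n g) \<xi> = (\<i> * complex_of_real (\<xi> $ k)) *s fo (-1) (cut n u) \<xi> - fo (-1) (dcut k n u) \<xi>"
proof -
  \<comment> \<open>Test functions are real valued, so the plane wave has to be entered through its
    cosine and sine separately.\<close>
  define pc where "pc = (\<lambda>x. cutoff n x * cos (x \<bullet> \<xi>))"
  define ps where "ps = (\<lambda>x. cutoff n x * sin (x \<bullet> \<xi>))"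
  have sm: "pc \<in> sm" "ps \<in> sm" unfolding pc_def ps_def by (intro sm.intros cutoff_sm)+
  note [measurable] = sm_measurable[OF sm(1)] sm_measurable[OF sm(2)]
    sm_measurable[OF pd_sm[OF sm(1)]] sm_measurable[OF pd_sm[OF sm(2)]]
  have z: "pc x = 0" "ps x = 0" if "norm x > real (Suc n)" for x
    using cutoff_eq_0[OF that] by (simp_all add: pc_def ps_def)
  have t: "test_fn pc" "test_fn ps"
    by (intro sm_test_fn sm compact_support_cb[of "real (Suc n)"] z; assumption)+
  let ?e = "\<lambda>x. iexp ((-1) * (x \<bullet> \<xi>))"
  have dc: "((\<lambda>x. cutoff n x) has_derivative frechet_derivative (cutoff n) (at x)) (at x)" for x
    using sm_diff_pd[OF cutoff_sm] by (intro has_derivative_pd) auto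
  have pdc: "pd k pc x = pd k (cutoff n) x * cos (x \<bullet> \<xi>) - cutoff n x * (\<xi> $ k) * sin (x \<bullet> \<xi>)" for x
  proof -
    have "pd k pc = (\<lambda>x. cutoff n x * (- (axis k 1 \<bullet> \<xi>) * sin (x \<bullet> \<xi>)) + pd k (cutoff n) x * cos (x \<bullet> \<xi>))"
      unfolding pc_def pd_def[of k "cutoff n"]
      by (rule pd_eqI) (auto intro!: derivative_eq_intros dc)
    then show ?thesis by (simp add: inner_axis' algebra_simps)
  qed
  have pds: "pd k ps x = pd k (cutoff n) x * sin (x \<bullet> \<xi>) + cutoff n x * (\<xi> $ k) * cos (x \<bullet> \<xi>)" for x
  proof -
    have "pd k ps = (\<lambda>x. cutoff n x * ((axis k 1 \<bullet> \<xi>) * cos (x \<bullet> \<xi>)) + pd k (cutoff n) x * sin (x \<bullet> \<xi>))"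
      unfolding ps_def pd_def[of k "cutoff n"]
      by (rule pd_eqI) (auto intro!: derivative_eq_intros dc)
    then show ?thesis by (simp add: inner_axis' algebra_simps)
  qed
  have bnd: "\<bar>pc x\<bar> \<le> 1" "\<bar>ps x\<bar> \<le> 1" for x
    unfolding pc_def ps_def abs_mult by (intro mult_le_one cutoff_abs; simp)+
  have ig: "integrable lborel (\<lambda>x. pc x *\<^sub>R g x)" "integrable lborel (\<lambda>x. ps x *\<^sub>R g x)"
    by (rule integrable_mult_compact[where C=1 and N="Suc n", OF g]; simp add: bnd z del: of_nat_Suc)+
  have iu: "integrable lborel (\<lambda>x. pd k pc x *\<^sub>R u x)" "integrable lborel (\<lambda>x. pd k ps x *\<^sub>R u x)"
  proof -
    have A: "integrable lborel (\<lambda>x. f x *\<^sub>R dcut k n u x)" "integrable lborel (\<lambda>x. f x *\<^sub>R cut n u x)"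
      if [measurable]: "f \<in> borel_measurable borel" and "\<And>x. \<bar>f x\<bar> \<le> 1" for f :: "real^3 \<Rightarrow> real"
    proof -
      note [measurable] = L2_measurable[OF u]
      have le: "norm (f x *\<^sub>R v) \<le> norm v" for x and v :: spinor
        using that(2)[of x] by (simp add: mult_left_le_one_le)
      show "integrable lborel (\<lambda>x. f x *\<^sub>R dcut k n u x)"
        by (rule Bochner_Integration.integrable_bound[OF integrable_dcut[OF u, of k n]]) (measurable, intro AE_I2 le)
      show "integrable lborel (\<lambda>x. f x *\<^sub>R cut n u x)"
        by (rule Bochner_Integration.integrable_bound[OF integrable_cut[OF u, of n]]) (measurable, intro AE_I2 le)
    qed
    have "integrable lborel (\<lambda>x. cos (x \<bullet> \<xi>) *\<^sub>R dcut k n u x - (\<xi> $ k) *\<^sub>R (sin (x \<bullet> \<xi>) *\<^sub>R cut n u x))"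
      "integrable lborel (\<lambda>x. sin (x \<bullet> \<xi>) *\<^sub>R dcut k n u x + (\<xi> $ k) *\<^sub>R (cos (x \<bullet> \<xi>) *\<^sub>R cut n u x))"
      by (intro Bochner_Integration.integrable_diff Bochner_Integration.integrable_add integrable_scaleR_right A; simp)+
    then show "integrable lborel (\<lambda>x. pd k pc x *\<^sub>R u x)" "integrable lborel (\<lambda>x. pd k ps x *\<^sub>R u x)"
      by (simp_all add: pdc pds dcut_def cut_def algebra_simps)
  qed
  have W: "(\<integral>x. pd k pc x *\<^sub>R u x \<partial>lborel) = - (\<integral>x. pc x *\<^sub>R g x \<partial>lborel)"
    "(\<integral>x. pd k ps x *\<^sub>R u x \<partial>lborel) = - (\<integral>x. ps x *\<^sub>R g x \<partial>lborel)"
    using wd t by (simp_all add: weak_deriv_def)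
  have comb: "(\<integral>x. a x - c *s b x \<partial>lborel) = (\<integral>x. a x \<partial>lborel) - c *s (\<integral>x. b x \<partial>lborel)"
    if "integrable lborel a" "integrable lborel b" for a b :: wavefn and c
    using that by (simp add: integrable_bounded_linear[OF bounded_linear_smult_spinor]
        integral_bounded_linear[OF bounded_linear_smult_spinor])
  have e1: "?e x *s cut n g x = pc x *\<^sub>R g x - \<i> *s (ps x *\<^sub>R g x)" for x
    unfolding mult_minus1 exp_minus_phase
    unfolding cut_def pc_def ps_def smult_of_real_spinor[symmetric] by (simp add: vec_eq_iff algebra_simps)
  have e2: "pd k pc x *\<^sub>R u x - \<i> *s (pd k ps x *\<^sub>R u x) =
     ?e x *s dcut k n u x - (\<i> * complex_of_real (\<xi> $ k)) *s (?e x *s cut n u x)" for x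
    unfolding mult_minus1 exp_minus_phase pdc pds
    unfolding cut_def dcut_def smult_of_real_spinor[symmetric] by (simp add: vec_eq_iff algebra_simps)
  have ie: "integrable lborel (\<lambda>x. ?e x *s dcut k n u x)" "integrable lborel (\<lambda>x. ?e x *s cut n u x)"
    by (intro integrable_phase integrable_cut integrable_dcut u; measurable)+
  have "(\<integral>x. ?e x *s cut n g x \<partial>lborel) = - ((\<integral>x. pd k pc x *\<^sub>R u x \<partial>lborel) - \<i> *s (\<integral>x. pd k ps x *\<^sub>R u x \<partial>lborel))"
    unfolding e1 comb[OF ig] W by (simp add: vec_eq_iff)
  also have "\<dots> = - (\<integral>x. ?e x *s dcut k n u x - (\<i> * complex_of_real (\<xi> $ k)) *s (?e x *s cut n u x) \<partial>lborel)"
    unfolding comb[OF iu, symmetric] e2 ..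
  also have "\<dots> = (\<i> * complex_of_real (\<xi> $ k)) *s (\<integral>x. ?e x *s cut n u x \<partial>lborel) - (\<integral>x. ?e x *s dcut k n u x \<partial>lborel)"
    unfolding comb[OF ie] by simp
  finally have fin: "(\<integral>x. ?e x *s cut n g x \<partial>lborel) = \<dots>" .
  show ?thesis
    unfolding fo_def fin vector_ssub_ldistrib vector_smult_assoc by (simp add: mult_ac)
qed

lemma norm_restr_coord:
  "norm (restr (cb N) (\<lambda>\<xi>. (\<i> * complex_of_real (\<xi> $ k)) *s w \<xi>) \<xi>) \<le> real N * norm (w \<xi>)"
proof (cases "norm \<xi> \<le> real N")
  case True
  then have "\<bar>\<xi> $ k\<bar> \<le> real N" using component_le_norm_cart[of \<xi> k] by simp
  then show ?thesis using True by (simp add: restr_def norm_mult mult_right_mono)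
qed (simp add: restr_def)

text \<open>The difficulty is that the multiplied transform is not known to be square integrable. On
  a ball of radius N multiplication by a coordinate is bounded by N, so the identity for smooth
  cutoffs can be passed to the limit there; the resulting bound is independent of N, and
  \<open>L2_local_bound\<close> removes the ball.\<close>

theorem FT2_weak_deriv:
  assumes u: "L2 u" "FT2 u uh" and g: "L2 g" and wd: "weak_deriv u k g"
  shows "FT2 g (\<lambda>\<xi>. (\<i> * complex_of_real (\<xi> $ k)) *s uh \<xi>)"
proof -
  define G where "G = (\<lambda>\<xi>. (\<i> * complex_of_real (\<xi> $ k)) *s uh \<xi>)"
  note uh = FT2_L2[OF u(2)]
  note [measurable] = L2_measurable[OF u(1)] L2_measurable[OF g] L2_measurable[OF uh]
  let ?fg = "\<lambda>n. fo (-1) (cut n g)" and ?fu = "\<lambda>n. fo (-1) (cut n u)"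
  have fg: "L2 (?fg n)" and fu: "L2 (?fu n)" and fd: "L2 (fo (-1) (dcut k n u))" for n
    by (intro L2_fo L2_cut integrable_cut L2_dcut integrable_dcut u g)+
  have gm [measurable]: "G \<in> borel_measurable borel" unfolding G_def by measurable
  \<comment> \<open>Sharp truncations and smooth cutoffs both approach \<open>u\<close> in the mean,
    and the transform is isometric on their difference; hence the transforms of the cutoffs also
    converge to \<open>uh\<close>.\<close>
  have fu_lim: "(\<lambda>m. L2norm (\<lambda>\<xi>. uh \<xi> - ?fu m \<xi>)) \<longlonglongrightarrow> 0"
  proof (rule tendsto_zero_sandwich)
    let ?r = "\<lambda>m. restr (cb m) u"
    have r: "L2 (?r m)" "integrable lborel (?r m)" for m
      using u by (auto intro: L2_restr integrable_restr_cb)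
    show "L2norm (\<lambda>\<xi>. uh \<xi> - ?fu m \<xi>) \<le> L2norm (\<lambda>\<xi>. fo (-1) (?r m) \<xi> - uh \<xi>) +
        (L2norm (\<lambda>x. ?r m x - u x) + L2norm (\<lambda>x. cut m u x - u x))" for m
    proof -
      have "L2norm (\<lambda>\<xi>. fo (-1) (?r m) \<xi> - ?fu m \<xi>) = L2norm (\<lambda>x. ?r m x - cut m u x)"
        by (intro L2norm_fo_diff r L2_cut integrable_cut u g)
      also have "\<dots> \<le> L2norm (\<lambda>x. ?r m x - u x) + L2norm (\<lambda>x. u x - cut m u x)"
        by (rule L2norm_triangle_diff[OF r(1) L2_cut[OF u(1)] u(1)])
      finally show ?thesis
        using L2norm_triangle_diff[OF uh fu[of m] L2_fo(1)[OF r[of m]]]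
        by (simp only: L2norm_minus_commute[of uh] L2norm_minus_commute[of u])
    qed
    have "(\<lambda>m. L2norm (\<lambda>\<xi>. fo (-1) (?r m) \<xi> - uh \<xi>)) \<longlonglongrightarrow> 0"
      using u(2) unfolding FT2_iff by simp
    moreover have "(\<lambda>m. L2norm (\<lambda>x. ?r m x - u x)) \<longlonglongrightarrow> 0"
      by (intro L2norm_restr_tendsto u eventually_cb) simp
    ultimately show "(\<lambda>m. L2norm (\<lambda>\<xi>. fo (-1) (?r m) \<xi> - uh \<xi>) +
        (L2norm (\<lambda>x. ?r m x - u x) + L2norm (\<lambda>x. cut m u x - u x))) \<longlonglongrightarrow> 0"
      using cut_tendsto[OF u(1)] by (intro tendsto_add_zero)
  qed simp
  have key: "L2 (\<lambda>\<xi>. G \<xi> - ?fg n \<xi>)" "L2norm (\<lambda>\<xi>. G \<xi> - ?fg n \<xi>) \<le> L2norm (\<lambda>x. cut n g x - g x)" for n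
  proof -
    have A: "L2 (restr (cb N) G)" for N
    proof (rule L2_dominated(1)[OF uh, where C="real N"])
      have "norm (restr (cb N) G \<xi>) \<le> real N * norm (uh \<xi>)" for \<xi>
        using component_le_norm_cart[of \<xi> k]
        by (auto simp: restr_def G_def norm_mult indicator_def intro!: mult_right_mono)
      then show "AE x in lborel. norm (restr (cb N) G x) \<le> real N * norm (uh x)" by simp
    qed auto
    have L: "L2 (restr (cb N) (\<lambda>\<xi>. G \<xi> - ?fg n \<xi>))" for N
    proof -
      have "restr (cb N) (\<lambda>\<xi>. G \<xi> - ?fg n \<xi>) = (\<lambda>\<xi>. restr (cb N) G \<xi> - restr (cb N) (?fg n) \<xi>)"
        by (auto simp: restr_diff)
      then show ?thesis using L2_diff[OF A L2_restr[OF fg]] by simp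
    qed
    have C: "L2norm (restr (cb N) (\<lambda>\<xi>. G \<xi> - ?fg n \<xi>)) \<le> L2norm (\<lambda>x. cut n g x - g x)" for N
    proof (rule LIMSEQ_le_const)
      let ?b = "\<lambda>m. real N * L2norm (\<lambda>\<xi>. uh \<xi> - ?fu m \<xi>) + ((4 * exp 1 / real (Suc m)) * L2norm u +
         (L2norm (\<lambda>x. cut m g x - g x) + L2norm (\<lambda>x. cut n g x - g x)))"
      have "(\<lambda>m. 4 * exp 1 * inverse (real (Suc m)) * L2norm u) \<longlonglongrightarrow> 4 * exp 1 * 0 * L2norm u"
        by (intro tendsto_mult tendsto_const LIMSEQ_inverse_real_of_nat)
      then have t: "(\<lambda>m. (4 * exp 1 / real (Suc m)) * L2norm u) \<longlonglongrightarrow> 0"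
        by (simp add: divide_inverse del: of_nat_Suc)
      have "?b \<longlonglongrightarrow> real N * 0 + (0 + (0 + L2norm (\<lambda>x. cut n g x - g x)))"
        by (rule tendsto_add[OF tendsto_mult[OF tendsto_const fu_lim]
            tendsto_add[OF t tendsto_add[OF cut_tendsto[OF g] tendsto_const]]])
      then show "?b \<longlonglongrightarrow> L2norm (\<lambda>x. cut n g x - g x)" by simp
      have "L2norm (restr (cb N) (\<lambda>\<xi>. G \<xi> - ?fg n \<xi>)) \<le> ?b m" for m
      proof -
        \<comment> \<open>An auxiliary index m splits the error: \<open>P\<close> is the multiplier
          applied to the transform error of \<open>u\<close>, \<open>Q\<close> comes from the
          gradient of the cutoff, \<open>R\<close> compares two cutoffs of \<open>g\<close>. As m
          grows the bounds for \<open>P\<close> and \<open>Q\<close> tend to 0, and only the error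
          of \<open>cut n g\<close> remains.\<close>
        define P where "P = (\<lambda>\<xi>. restr (cb N) (\<lambda>\<xi>. (\<i> * complex_of_real (\<xi> $ k)) *s (uh \<xi> - ?fu m \<xi>)) \<xi>)"
        define Q where "Q = restr (cb N) (fo (-1) (dcut k m u))"
        define R where "R = restr (cb N) (\<lambda>\<xi>. ?fg m \<xi> - ?fg n \<xi>)"
        have Pb: "norm (P \<xi>) \<le> real N * norm (uh \<xi> - ?fu m \<xi>)" for \<xi>
          unfolding P_def by (rule norm_restr_coord)
        have Pm: "P \<in> borel_measurable borel" unfolding P_def by measurable
        have P: "L2 P" "L2norm P \<le> real N * L2norm (\<lambda>\<xi>. uh \<xi> - ?fu m \<xi>)"
          by (rule L2_dominated[OF L2_diff[OF uh fu[of m]] Pm AE_I2[OF Pb]], simp)+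
        have Q: "L2 Q" "L2norm Q \<le> (4 * exp 1 / real (Suc m)) * L2norm u"
        proof -
          show "L2 Q" unfolding Q_def by (intro L2_restr fd) simp
          have "L2norm Q \<le> L2norm (fo (-1) (dcut k m u))" unfolding Q_def by (intro L2norm_restr_le fd) simp
          also have "\<dots> = L2norm (dcut k m u)" by (intro plancherel L2_dcut integrable_dcut u) simp
          also note L2_dcut(2)[OF u(1)]
          finally show "L2norm Q \<le> (4 * exp 1 / real (Suc m)) * L2norm u" .
        qed
        have R: "L2 R" "L2norm R \<le> L2norm (\<lambda>x. cut m g x - g x) + L2norm (\<lambda>x. cut n g x - g x)"
        proof -
          show "L2 R" unfolding R_def by (intro L2_restr L2_diff fg) simp
          have "L2norm R \<le> L2norm (\<lambda>\<xi>. ?fg m \<xi> - ?fg n \<xi>)" unfolding R_def by (intro L2norm_restr_le L2_diff fg) simp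
          also have "\<dots> = L2norm (\<lambda>x. cut m g x - cut n g x)"
        by (intro L2norm_fo_diff L2_cut integrable_cut u g)
          also have "\<dots> \<le> L2norm (\<lambda>x. cut m g x - g x) + L2norm (\<lambda>x. g x - cut n g x)"
            by (rule L2norm_triangle_diff[OF L2_cut[OF g] L2_cut[OF g] g])
          finally show "L2norm R \<le> L2norm (\<lambda>x. cut m g x - g x) + L2norm (\<lambda>x. cut n g x - g x)"
            by (simp only: L2norm_minus_commute[of g])
        qed
        have "restr (cb N) (\<lambda>\<xi>. G \<xi> - ?fg n \<xi>) = (\<lambda>\<xi>. P \<xi> + (Q \<xi> + R \<xi>))"
        proof
          fix \<xi>
          have "G \<xi> - ?fg n \<xi> = (\<i> * complex_of_real (\<xi> $ k)) *s (uh \<xi> - ?fu m \<xi>) + (fo (-1) (dcut k m u) \<xi> + (?fg m \<xi> - ?fg n \<xi>))"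
            unfolding fo_cut_weak_deriv[OF u(1) g wd, of m] G_def by (simp add: vec_eq_iff algebra_simps)
          then show "restr (cb N) (\<lambda>\<xi>. G \<xi> - ?fg n \<xi>) \<xi> = P \<xi> + (Q \<xi> + R \<xi>)"
            unfolding P_def Q_def R_def restr_def scaleR_add_right[symmetric] by simp
        qed
        then have "L2norm (restr (cb N) (\<lambda>\<xi>. G \<xi> - ?fg n \<xi>)) \<le> L2norm P + (L2norm Q + L2norm R)"
          using L2norm_triangle[OF P(1) L2_add[OF Q(1) R(1)]] L2norm_triangle[OF Q(1) R(1)] by simp
        then show ?thesis using P Q R by linarith
      qed
      then show "\<exists>M. \<forall>m\<ge>M. L2norm (restr (cb N) (\<lambda>\<xi>. G \<xi> - ?fg n \<xi>)) \<le> ?b m" by blast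
    qed
    show "L2 (\<lambda>\<xi>. G \<xi> - ?fg n \<xi>)" "L2norm (\<lambda>\<xi>. G \<xi> - ?fg n \<xi>) \<le> L2norm (\<lambda>x. cut n g x - g x)"
      by (rule L2_local_bound[OF _ L C]; measurable)+
  qed
  have G: "L2 G" using L2_add[OF key(1)[of 0] fg[of 0]] by simp
  have "(\<lambda>n. L2norm (\<lambda>\<xi>. fo (-1) (restr (cb n) g) \<xi> - G \<xi>)) \<longlonglongrightarrow> 0"
  proof (rule tendsto_zero_sandwich)
    let ?r = "\<lambda>m. restr (cb m) g"
    have r: "L2 (?r m)" "integrable lborel (?r m)" for m
      using g by (auto intro: L2_restr integrable_restr_cb)
    show "L2norm (\<lambda>\<xi>. fo (-1) (?r n) \<xi> - G \<xi>) \<le>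
        (L2norm (\<lambda>x. ?r n x - g x) + L2norm (\<lambda>x. cut n g x - g x)) + L2norm (\<lambda>x. cut n g x - g x)" for n
    proof -
      have "L2norm (\<lambda>\<xi>. fo (-1) (?r n) \<xi> - ?fg n \<xi>) = L2norm (\<lambda>x. ?r n x - cut n g x)"
        by (intro L2norm_fo_diff r L2_cut integrable_cut u g)
      also have "\<dots> \<le> L2norm (\<lambda>x. ?r n x - g x) + L2norm (\<lambda>x. g x - cut n g x)"
        by (rule L2norm_triangle_diff[OF r(1) L2_cut[OF g] g])
      finally show ?thesis
        using L2norm_triangle_diff[OF L2_fo(1)[OF r[of n]] G fg[of n]] key(2)[of n]
        by (simp only: L2norm_minus_commute[of g] L2norm_minus_commute[of G])
    qed
    have "(\<lambda>m. L2norm (\<lambda>x. ?r m x - g x)) \<longlonglongrightarrow> 0"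
      by (intro L2norm_restr_tendsto g eventually_cb) simp
    then show "(\<lambda>n. (L2norm (\<lambda>x. ?r n x - g x) + L2norm (\<lambda>x. cut n g x - g x)) + L2norm (\<lambda>x. cut n g x - g x)) \<longlonglongrightarrow> 0"
      by (intro tendsto_add_zero cut_tendsto g)
  qed simp
  with G show ?thesis unfolding FT2_iff G_def by simp
qed

section \<open>Weak derivatives of Fourier integrals\<close>

lemma test_fn_measurable:
  assumes "test_fn \<phi>"
  shows "\<phi> \<in> borel_measurable borel" "pd k \<phi> \<in> borel_measurable borel"
    "\<phi> differentiable (at x)" "continuous_on UNIV \<phi>" "continuous_on UNIV (pd k \<phi>)"
proof -
  have d: "dpart [] \<phi> differentiable (at x)" "dpart [k] \<phi> differentiable (at x)" for x
    using assms unfolding test_fn_def by blast+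
  then show "\<phi> differentiable (at x)" by simp
  show "continuous_on UNIV \<phi>" "continuous_on UNIV (pd k \<phi>)"
    using d by (auto intro!: continuous_at_imp_continuous_on differentiable_imp_continuous_within)
  then show "\<phi> \<in> borel_measurable borel" "pd k \<phi> \<in> borel_measurable borel"
    by (auto intro: borel_measurable_continuous_onI)
qed

lemma test_fn_bounds:
  assumes t: "test_fn \<phi>"
  obtains N :: nat and M where "\<And>x. norm x > real N \<Longrightarrow> \<phi> x = 0"
    "\<And>x. norm x > real N \<Longrightarrow> pd k \<phi> x = 0" "\<And>x. \<bar>\<phi> x\<bar> \<le> M" "\<And>x. \<bar>pd k \<phi> x\<bar> \<le> M" "0 \<le> M"
proof -
  have c: "compact (closure {x. \<phi> x \<noteq> 0})" using t by (simp add: test_fn_def)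
  then obtain r where r: "\<And>x. x \<in> closure {x. \<phi> x \<noteq> 0} \<Longrightarrow> norm x \<le> r"
    using compact_imp_bounded[OF c] unfolding bounded_iff by blast
  obtain N :: nat where N: "r \<le> real N" using real_arch_simple by blast
  have z: "\<phi> x = 0" if "norm x > real N" for x
    using that N r[of x] closure_subset[of "{x. \<phi> x \<noteq> 0}"] by force
  have zd: "pd k \<phi> x = 0" if "norm x > real N" for x
  proof -
    have "(\<phi> has_derivative (\<lambda>h. 0)) (at x)"
      by (rule has_derivative_transform_within_open[of "\<lambda>x. 0" _ _ UNIV "{x. norm x > real N}"])
         (use that z in \<open>auto intro!: open_Collect_less continuous_intros\<close>)
    from frechet_derivative_at[OF this] show ?thesis by (metis pd_def)
  qed
  have "\<exists>B. \<forall>x. \<bar>f x\<bar> \<le> B" if c: "continuous_on UNIV f" and "\<And>x. norm x > real N \<Longrightarrow> f x = 0"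
    for f :: "real^3 \<Rightarrow> real"
  proof -
    have "compact (f ` cball 0 (real N))"
      by (intro compact_continuous_image compact_cball continuous_on_subset[OF c]) simp
    then obtain B where B: "\<And>y. y \<in> f ` cball 0 (real N) \<Longrightarrow> \<bar>y\<bar> \<le> B"
      using compact_imp_bounded bounded_iff by (metis real_norm_def)
    have "\<bar>f x\<bar> \<le> \<bar>B\<bar>" for x
      using B[of "f x"] that(2)[of x] by (cases "norm x > real N") force+
    then show ?thesis by blast
  qed
  from this[OF test_fn_measurable(4)[OF t] z] this[OF test_fn_measurable(5)[OF t] zd]
  obtain B1 B2 where "\<And>x. \<bar>\<phi> x\<bar> \<le> B1" "\<And>x. \<bar>pd k \<phi> x\<bar> \<le> B2" by blast
  then have "\<And>x. \<bar>\<phi> x\<bar> \<le> max \<bar>B1\<bar> \<bar>B2\<bar>" "\<And>x. \<bar>pd k \<phi> x\<bar> \<le> max \<bar>B1\<bar> \<bar>B2\<bar>"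
    by (meson abs_ge_self max.coboundedI1 max.coboundedI2 order_trans)+
  with z zd show thesis by (intro that[of N "max \<bar>B1\<bar> \<bar>B2\<bar>"]) auto
qed

lemma has_derivative_line:
  assumes "\<phi> differentiable (at (x + t *\<^sub>R axis k 1))"
  shows "((\<lambda>t. \<phi> (x + t *\<^sub>R axis k 1)) has_real_derivative pd k \<phi> (x + t *\<^sub>R axis k 1)) (at t)"
proof -
  let ?D = "frechet_derivative \<phi> (at (x + t *\<^sub>R axis k 1))"
  have l: "linear ?D" by (rule linear_frechet_derivative[OF assms])
  have "((\<lambda>t. x + t *\<^sub>R axis k 1) has_derivative (\<lambda>s. s *\<^sub>R axis k 1)) (at t)"
    by (auto intro!: derivative_eq_intros)
  from has_derivative_compose[OF this has_derivative_pd[OF assms]]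
  show ?thesis
    by (simp add: has_field_derivative_def linear_scale[OF l] pd_def mult_commute_abs)
qed

lemma test_fn_lipschitz:
  assumes t: "test_fn \<phi>" and M: "\<And>x. \<bar>pd k \<phi> x\<bar> \<le> M"
  shows "\<bar>\<phi> (x + s *\<^sub>R axis k 1) - \<phi> x\<bar> \<le> M * \<bar>s\<bar>"
proof -
  have "norm (\<phi> (x + s *\<^sub>R axis k 1) - \<phi> (x + 0 *\<^sub>R axis k 1)) \<le> M * norm (s - 0)"
    by (rule field_differentiable_bound[of UNIV "\<lambda>t. \<phi> (x + t *\<^sub>R axis k 1)" "\<lambda>t. pd k \<phi> (x + t *\<^sub>R axis k 1)"])
       (use has_derivative_line[OF test_fn_measurable(3)[OF t]] M in auto)
  then show ?thesis by simp
qed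

lemma norm_fo_le:
  assumes h: "integrable lborel h"
  shows "norm (fo s h x) \<le> (2 * pi) powr (-3/2) * (\<integral>\<xi>. norm (h \<xi>) \<partial>lborel)"
proof -
  have "norm (\<integral>\<xi>. iexp (s * (\<xi> \<bullet> x)) *s h \<xi> \<partial>lborel) \<le>
      (\<integral>\<xi>. norm (iexp (s * (\<xi> \<bullet> x)) *s h \<xi>) \<partial>lborel)"
    by (rule integral_norm_bound)
  also have "\<dots> = (\<integral>\<xi>. norm (h \<xi>) \<partial>lborel)"
    by (simp only: norm_smult_spinor norm_phase mult_1)
  finally show ?thesis
    unfolding fo_def norm_smult_spinor norm_of_real by (simp add: mult_left_mono)
qed

lemma loc_integrable_bounded:
  assumes [measurable]: "u \<in> borel_measurable borel" and b: "\<And>x. norm (u x) \<le> C"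
  shows "loc_integrable (u::wavefn)"
  unfolding loc_integrable_def set_integrable_def
proof (intro conjI allI)
  fix R
  show "integrable lborel (\<lambda>x. indicator (cball 0 R) x *\<^sub>R u x)"
  proof (rule Bochner_Integration.integrable_bound)
    show "integrable lborel (\<lambda>x. indicator (cball (0::real^3) R) x *\<^sub>R C)"
      by (simp add: integrable_indicator_iff emeasure_cball_less_top)
    show "AE x in lborel. norm (indicator (cball 0 R) x *\<^sub>R u x) \<le> norm (indicator (cball (0::real^3) R) x *\<^sub>R C)"
      using order_trans[OF b abs_ge_self] by (simp add: indicator_def)
    show "(\<lambda>x. indicator (cball 0 R) x *\<^sub>R u x) \<in> borel_measurable lborel"
      by (intro borel_measurable_scaleR borel_measurable_indicator) simp_all
  qed
qed simp

lemma fo_translate: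
  assumes h: "integrable lborel h"
  shows "fo 1 h (x + y) = fo 1 (\<lambda>\<xi>. iexp (\<xi> \<bullet> y) *s h \<xi>) x"
  unfolding fo_def
  by (simp add: vector_smult_assoc exp_add[symmetric] inner_add_right distrib_left)

text \<open>Translating the test function instead of the wave function turns the difference
  quotient of \<open>\<phi>\<close> into the one of \<open>fo 1 h\<close>, which acts on \<open>h\<close> as a multiplier.\<close>
theorem weak_deriv_fo:
  assumes h: "integrable lborel h" and h': "integrable lborel (\<lambda>\<xi>. (\<i> * complex_of_real (\<xi> $ k)) *s h \<xi>)"
  shows "weak_deriv (fo 1 h) k (fo 1 (\<lambda>\<xi>. (\<i> * complex_of_real (\<xi> $ k)) *s h \<xi>))"
  unfolding weak_deriv_def
proof (intro conjI allI impI)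
  define h1 where "h1 = (\<lambda>\<xi>. (\<i> * complex_of_real (\<xi> $ k)) *s h \<xi>)"
  have [measurable]: "h \<in> borel_measurable borel" "h1 \<in> borel_measurable borel" using h h' by (auto simp: h1_def)
  have h1: "integrable lborel h1" using h' by (simp add: h1_def)
  let ?c = "(2 * pi) powr (-3/2)"
  show "loc_integrable (fo 1 h)" by (rule loc_integrable_bounded[OF _ norm_fo_le[OF h]]) measurable
  have m1 [measurable]: "fo 1 h1 \<in> borel_measurable borel" by measurable
  show "loc_integrable (fo 1 (\<lambda>\<xi>. (\<i> * complex_of_real (\<xi> $ k)) *s h \<xi>))"
    unfolding h1_def[symmetric] by (rule loc_integrable_bounded[OF _ norm_fo_le[OF h1]]) measurable
  fix \<phi> assume t: "test_fn \<phi>"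
  note [measurable] = test_fn_measurable(1)[OF t] test_fn_measurable(2)[OF t, of k]
  obtain N M where z: "\<And>x. norm x > real N \<Longrightarrow> \<phi> x = 0" and M: "\<And>x. \<bar>\<phi> x\<bar> \<le> M" "\<And>x. \<bar>pd k \<phi> x\<bar> \<le> M" "0 \<le> M"
    using test_fn_bounds[OF t, where k=k] by metis
  define e :: "real^3" where "e = axis k 1"
  define s where "s n = 1 / real (Suc n)" for n
  have s: "s n > 0" "s n \<le> 1" for n by (simp_all add: s_def)
  have s0: "s \<longlonglongrightarrow> 0" unfolding s_def using LIMSEQ_inverse_real_of_nat by (simp add: inverse_eq_divide)
  have s0': "filterlim s (at 0) sequentially"
    using s0 s(1) by (auto simp: filterlim_at intro!: always_eventually) (metis less_irrefl)
  let ?u = "fo 1 h"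
  define B where "B = ?c * (\<integral>\<xi>. norm (h \<xi>) \<partial>lborel)"
  define B1 where "B1 = ?c * (\<integral>\<xi>. norm (h1 \<xi>) \<partial>lborel)"
  have um [measurable]: "?u \<in> borel_measurable borel" by (rule fo_measurable) simp
  have B: "norm (?u x) \<le> B" for x unfolding B_def by (rule norm_fo_le[OF h])
  have B0: "0 \<le> B" using B[of 0] norm_ge_zero order_trans by blast
  have icb: "integrable lborel (\<lambda>x. C * indicator (cb n) x :: real)" for C n
    by (simp add: integrable_indicator_iff emeasure_cball_less_top)
  \<comment> \<open>The multiplier of the difference quotient of \<open>fo 1 h\<close> for a
    backward shift. Its limit therefore carries a minus sign, which becomes the sign in the
    integration by parts formula.\<close>
  define q where "q n \<xi> = (iexp (\<xi> \<bullet> (- s n *\<^sub>R e)) - 1) / complex_of_real (s n)" for n and \<xi> :: "real^3"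
  have qm [measurable]: "q n \<in> borel_measurable borel" for n unfolding q_def by measurable
  have ex: "\<xi> \<bullet> (- s n *\<^sub>R e) = - (s n * \<xi> $ k)" for n \<xi> by (simp add: e_def inner_axis)
  have qb: "cmod (q n \<xi>) \<le> \<bar>\<xi> $ k\<bar>" for n \<xi>
  proof -
    have "cmod (iexp (- (s n * \<xi> $ k)) - 1) \<le> \<bar>- (s n * \<xi> $ k)\<bar>"
      using iexp_approx1[of "- (s n * \<xi> $ k)" 0] by simp
    then show ?thesis using s(1)[of n] unfolding q_def ex
      by (simp add: norm_divide abs_mult field_simps)
  qed
  have ql: "(\<lambda>n. q n \<xi>) \<longlonglongrightarrow> - (\<i> * complex_of_real (\<xi> $ k))" for \<xi>
  proof -
    have b: "cmod (q n \<xi> - - (\<i> * complex_of_real (\<xi> $ k))) \<le> s n * ((\<xi> $ k)\<^sup>2 / 2)" for n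
    proof -
      let ?t = "- (s n * \<xi> $ k)"
      have "q n \<xi> - - (\<i> * complex_of_real (\<xi> $ k)) =
          (iexp ?t - (1 + \<i> * complex_of_real ?t)) / complex_of_real (s n)"
        using s(1)[of n] unfolding q_def ex by (simp add: field_simps)
      moreover have "cmod (iexp ?t - (1 + \<i> * complex_of_real ?t)) \<le> (s n * \<xi> $ k)\<^sup>2 / 2"
        using iexp_approx1[of ?t 1] by (simp add: power2_eq_square)
      ultimately show ?thesis using s(1)[of n]
        by (simp add: norm_divide divide_le_eq power2_eq_square mult_ac)
    qed
    have "(\<lambda>n. s n * ((\<xi> $ k)\<^sup>2 / 2)) \<longlonglongrightarrow> 0" using tendsto_mult_left_zero[OF s0] .
    then have "(\<lambda>n. cmod (q n \<xi> - - (\<i> * complex_of_real (\<xi> $ k)))) \<longlonglongrightarrow> 0"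
      by (rule tendsto_zero_sandwich[OF norm_ge_zero b])
    then show ?thesis by (rule LIM_zero_cancel[OF tendsto_norm_zero_cancel])
  qed
  define hn where "hn n \<xi> = q n \<xi> *s h \<xi>" for n \<xi>
  have hnm [measurable]: "hn n \<in> borel_measurable borel" for n unfolding hn_def by measurable
  have hnb: "norm (hn n \<xi>) \<le> norm (h1 \<xi>)" for n \<xi>
    using mult_right_mono[OF qb[of n \<xi>] norm_ge_zero[of "h \<xi>"]] by (simp add: hn_def h1_def norm_mult)
  have ihn: "integrable lborel (hn n)" for n
    by (rule Bochner_Integration.integrable_bound[OF h1]) (simp_all add: hnb)
  have dq: "(1 / s n) *\<^sub>R (?u (x + (- s n *\<^sub>R e)) - ?u x) = fo 1 (hn n) x" for n x
  proof -
    have ii: "integrable lborel (\<lambda>\<xi>. iexp (\<xi> \<bullet> (- s n *\<^sub>R e)) *s h \<xi>)"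
      by (intro integrable_phase h) measurable
    have "(1 / s n) *\<^sub>R (?u (x + (- s n *\<^sub>R e)) - ?u x) =
      complex_of_real (1 / s n) *s fo 1 (\<lambda>\<xi>. iexp (\<xi> \<bullet> (- s n *\<^sub>R e)) *s h \<xi> - h \<xi>) x"
      unfolding fo_translate[OF h] fo_diff[OF ii h] smult_of_real_spinor ..
    also have "\<dots> = fo 1 (\<lambda>\<xi>. complex_of_real (1 / s n) *s (iexp (\<xi> \<bullet> (- s n *\<^sub>R e)) *s h \<xi> - h \<xi>)) x"
      using ii h by (intro fo_smult[symmetric]) simp
    also have "(\<lambda>\<xi>. complex_of_real (1 / s n) *s (iexp (\<xi> \<bullet> (- s n *\<^sub>R e)) *s h \<xi> - h \<xi>)) = hn n"
      unfolding hn_def q_def using s(1)[of n] by (intro ext) (simp add: vec_eq_iff field_simps)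
    finally show ?thesis .
  qed
  have fl: "(\<lambda>n. fo 1 (hn n) x) \<longlonglongrightarrow> - fo 1 h1 x" for x
  proof -
    have "(\<lambda>n. \<integral>\<xi>. iexp (1 * (\<xi> \<bullet> x)) *s hn n \<xi> \<partial>lborel) \<longlonglongrightarrow>
       (\<integral>\<xi>. iexp (1 * (\<xi> \<bullet> x)) *s (- h1 \<xi>) \<partial>lborel)"
    proof (rule integral_dominated_convergence[where w="\<lambda>\<xi>. norm (h1 \<xi>)"])
      have "(\<lambda>n. (iexp (1 * (\<xi> \<bullet> x)) * q n \<xi>) *s h \<xi>) \<longlonglongrightarrow>
          (iexp (1 * (\<xi> \<bullet> x)) * - (\<i> * complex_of_real (\<xi> $ k))) *s h \<xi>" for \<xi>
        unfolding vector_scalar_mult_def by (intro tendsto_vec_lambda tendsto_intros ql)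
      then have "(\<lambda>n. iexp (1 * (\<xi> \<bullet> x)) *s hn n \<xi>) \<longlonglongrightarrow>
          iexp (1 * (\<xi> \<bullet> x)) *s (- h1 \<xi>)" for \<xi>
        by (simp add: hn_def h1_def vector_smult_assoc)
      then show "AE \<xi> in lborel. (\<lambda>n. iexp (1 * (\<xi> \<bullet> x)) *s hn n \<xi>) \<longlonglongrightarrow>
          iexp (1 * (\<xi> \<bullet> x)) *s (- h1 \<xi>)" by simp
      show "AE \<xi> in lborel. norm (iexp (1 * (\<xi> \<bullet> x)) *s hn n \<xi>) \<le> norm (h1 \<xi>)" for n
        unfolding norm_smult_spinor norm_phase by (simp add: hnb)
      show "integrable lborel (\<lambda>\<xi>. norm (h1 \<xi>))" using h1 by simp
    qed measurable
    also have "(\<integral>\<xi>. iexp (1 * (\<xi> \<bullet> x)) *s (- h1 \<xi>) \<partial>lborel) =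
      - (\<integral>\<xi>. iexp (1 * (\<xi> \<bullet> x)) *s h1 \<xi> \<partial>lborel)"
      by simp
    finally have "(\<lambda>n. ?c *\<^sub>R (\<integral>\<xi>. iexp (1 * (\<xi> \<bullet> x)) *s hn n \<xi> \<partial>lborel)) \<longlonglongrightarrow>
       ?c *\<^sub>R (- (\<integral>\<xi>. iexp (1 * (\<xi> \<bullet> x)) *s h1 \<xi> \<partial>lborel))"
      by (intro tendsto_intros)
    then show ?thesis unfolding fo_def smult_of_real_spinor by simp
  qed
  have L: "(\<lambda>n. \<integral>x. ((\<phi> (x + s n *\<^sub>R e) - \<phi> x) / s n) *\<^sub>R ?u x \<partial>lborel) \<longlonglongrightarrow> (\<integral>x. pd k \<phi> x *\<^sub>R ?u x \<partial>lborel)"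
  \<comment> \<open>\<open>Suc N\<close> instead of \<open>N\<close>, since shifting the test
    function moves its support by at most 1.\<close>
  proof (rule integral_dominated_convergence[where w="\<lambda>x. M * B * indicator (cb (Suc N)) x"])
    show "integrable lborel (\<lambda>x. M * B * indicator (cb (Suc N)) x :: real)" by (rule icb)
    have "(\<lambda>n. (\<phi> (x + s n *\<^sub>R e) - \<phi> x) / s n) \<longlonglongrightarrow> pd k \<phi> x" for x
    proof -
      have "((\<lambda>t. (\<phi> (x + (0 + t) *\<^sub>R e) - \<phi> (x + 0 *\<^sub>R e)) / t) \<longlongrightarrow> pd k \<phi> (x + 0 *\<^sub>R e)) (at 0)"
        using has_derivative_line[where x=x and t=0 and k=k, OF test_fn_measurable(3)[OF t]] unfolding DERIV_def e_def .
      from filterlim_compose[OF this s0'] show ?thesis by simp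
    qed
    then show "AE x in lborel. (\<lambda>n. ((\<phi> (x + s n *\<^sub>R e) - \<phi> x) / s n) *\<^sub>R ?u x) \<longlonglongrightarrow> pd k \<phi> x *\<^sub>R ?u x"
      by (intro AE_I2 tendsto_intros)
    show "AE x in lborel. norm (((\<phi> (x + s n *\<^sub>R e) - \<phi> x) / s n) *\<^sub>R ?u x) \<le> M * B * indicator (cb (Suc N)) x" for n
    proof (rule AE_I2)
      fix x
      show "norm (((\<phi> (x + s n *\<^sub>R e) - \<phi> x) / s n) *\<^sub>R ?u x) \<le> M * B * indicator (cb (Suc N)) x"
      proof (cases "x \<in> cb (Suc N)")
        case True
        have lb: "\<bar>(\<phi> (x + s n *\<^sub>R e) - \<phi> x) / s n\<bar> \<le> M"
          using test_fn_lipschitz[OF t M(2), of x "s n"] s(1)[of n] by (simp add: e_def field_simps)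
        show ?thesis using True mult_mono[OF lb B[of x] M(3) norm_ge_zero] unfolding norm_scaleR real_norm_def by simp
      next
        case False
        then have x: "norm x > real N + 1" by simp
        have "norm x \<le> norm (x + s n *\<^sub>R e) + norm (s n *\<^sub>R e)"
          using norm_triangle_ineq4[of "x + s n *\<^sub>R e" "s n *\<^sub>R e"] by simp
        also have "norm (s n *\<^sub>R e) \<le> 1" using s[of n] by (simp add: e_def)
        finally have "norm (x + s n *\<^sub>R e) > real N" using x by linarith
        then show ?thesis using z x False by simp
      qed
    qed
  qed measurable
  have i1: "integrable lborel (\<lambda>x. \<phi> x *\<^sub>R ?u (x + y))" for y
  proof (rule Bochner_Integration.integrable_bound[OF icb[of "M * B" N]])
    show "(\<lambda>x. \<phi> x *\<^sub>R ?u (x + y)) \<in> borel_measurable lborel" by measurable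
    have "norm (\<phi> x *\<^sub>R ?u (x + y)) \<le> norm (M * B * indicator (cb N) x :: real)" for x
    proof (cases "norm x \<le> real N")
      case True
      then show ?thesis
        using mult_mono[OF M(1)[of x] B[of "x + y"] M(3) norm_ge_zero] M(3) B0 by simp
    next
      case False
      then show ?thesis using z[of x] by simp
    qed
    then show "AE x in lborel. norm (\<phi> x *\<^sub>R ?u (x + y)) \<le> norm (M * B * indicator (cb N) x :: real)" by simp
  qed
  have tr: "(\<integral>x. ((\<phi> (x + s n *\<^sub>R e) - \<phi> x) / s n) *\<^sub>R ?u x \<partial>lborel) = (\<integral>x. \<phi> x *\<^sub>R fo 1 (hn n) x \<partial>lborel)" for n
  proof -
    let ?y = "- s n *\<^sub>R e"
    have i2: "integrable lborel (\<lambda>x. \<phi> (x + s n *\<^sub>R e) *\<^sub>R ?u x)"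
      using lborel_integrable_translate[OF i1[of ?y], of "s n *\<^sub>R e"] by simp
    have "(\<integral>x. ((\<phi> (x + s n *\<^sub>R e) - \<phi> x) / s n) *\<^sub>R ?u x \<partial>lborel) =
       (\<integral>x. (1 / s n) *\<^sub>R (\<phi> (x + s n *\<^sub>R e) *\<^sub>R ?u x - \<phi> x *\<^sub>R ?u x) \<partial>lborel)"
      by (intro Bochner_Integration.integral_cong) (simp_all add: scaleR_diff_left[symmetric])
    also have "\<dots> = (1 / s n) *\<^sub>R ((\<integral>x. \<phi> (x + s n *\<^sub>R e) *\<^sub>R ?u x \<partial>lborel) - (\<integral>x. \<phi> x *\<^sub>R ?u x \<partial>lborel))"
      using i2 i1[of 0] by simp
    also have "(\<integral>x. \<phi> (x + s n *\<^sub>R e) *\<^sub>R ?u x \<partial>lborel) = (\<integral>x. \<phi> x *\<^sub>R ?u (x + ?y) \<partial>lborel)"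
      using lborel_integral_translate[of "\<lambda>x. \<phi> x *\<^sub>R ?u (x + ?y)" "s n *\<^sub>R e"] by simp
    also have "(1 / s n) *\<^sub>R ((\<integral>x. \<phi> x *\<^sub>R ?u (x + ?y) \<partial>lborel) - (\<integral>x. \<phi> x *\<^sub>R ?u x \<partial>lborel)) =
       (\<integral>x. (1 / s n) *\<^sub>R (\<phi> x *\<^sub>R ?u (x + ?y) - \<phi> x *\<^sub>R ?u x) \<partial>lborel)"
      using i1[of ?y] i1[of 0] by simp
    also have "\<dots> = (\<integral>x. \<phi> x *\<^sub>R fo 1 (hn n) x \<partial>lborel)"
      unfolding dq[symmetric] by (intro Bochner_Integration.integral_cong) (simp_all add: algebra_simps)
    finally show ?thesis .
  qed
  have R: "(\<lambda>n. \<integral>x. \<phi> x *\<^sub>R fo 1 (hn n) x \<partial>lborel) \<longlonglongrightarrow> (\<integral>x. \<phi> x *\<^sub>R (- fo 1 h1 x) \<partial>lborel)"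
  proof (rule integral_dominated_convergence[where w="\<lambda>x. M * B1 * indicator (cb N) x"])
    show "integrable lborel (\<lambda>x. M * B1 * indicator (cb N) x :: real)" by (rule icb)
    show "AE x in lborel. (\<lambda>n. \<phi> x *\<^sub>R fo 1 (hn n) x) \<longlonglongrightarrow> \<phi> x *\<^sub>R (- fo 1 h1 x)"
      by (intro AE_I2 tendsto_scaleR tendsto_const fl)
    have bb: "norm (fo 1 (hn n) x) \<le> B1" for n x
    proof -
      have "norm (fo 1 (hn n) x) \<le> ?c * (\<integral>\<xi>. norm (hn n \<xi>) \<partial>lborel)" by (rule norm_fo_le[OF ihn])
      also have "\<dots> \<le> B1" unfolding B1_def using ihn[of n] h1 hnb by (intro mult_left_mono integral_mono) auto
      finally show ?thesis .
    qed
    show "AE x in lborel. norm (\<phi> x *\<^sub>R fo 1 (hn n) x) \<le> M * B1 * indicator (cb N) x" for n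
      using z mult_mono[OF M(1) bb M(3)] by (intro AE_I2) (auto simp: indicator_def not_le[symmetric])
  qed measurable
  have "(\<integral>x. pd k \<phi> x *\<^sub>R ?u x \<partial>lborel) = (\<integral>x. \<phi> x *\<^sub>R (- fo 1 h1 x) \<partial>lborel)"
    by (rule LIMSEQ_unique[OF L]) (simp only: tr R)
  then show "(\<integral>x. pd k \<phi> x *\<^sub>R ?u x \<partial>lborel) =
      - (\<integral>x. \<phi> x *\<^sub>R fo 1 (\<lambda>\<xi>. (\<i> * complex_of_real (\<xi> $ k)) *s h \<xi>) x \<partial>lborel)"
    by (simp add: h1_def)
qed

section \<open>Frequency splitting\<close>

text \<open>The maximum is dropped, which leaves a power with an integrable singularity at 0 because
  \<open>a < 1\<close>; the two halves of the interval contribute equally.\<close>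

lemma nn_integral_max_powr_le:
  fixes a N :: real
  assumes a: "0 < a" "a < 1" and N: "0 < N"
  shows "(\<integral>\<^sup>+t. ennreal (indicator {-N..N} t * max 1 \<bar>t\<bar> powr (-a)) \<partial>lborel) \<le> ennreal (2 * (N powr (1 - a) / (1 - a)))"
proof -
  let ?J = "N powr (1 - a) / (1 - a)"
  let ?g = "\<lambda>t. ennreal (indicator {0..N} t * t powr (-a))"
  have "((\<lambda>t. t powr (-a)) has_integral N powr (- a + 1) / (- a + 1)) {0..N}"
    using a N by (intro has_integral_powr_from_0) auto
  then have "((\<lambda>t. t powr (-a)) has_integral ?J) {0..N}" by (simp add: add.commute)
  then have J: "(\<integral>\<^sup>+t. ?g t \<partial>lborel) = ennreal ?J"
    by (intro nn_integral_has_integral_lebesgue) auto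
  have J': "(\<integral>\<^sup>+t. ?g (- t) \<partial>lborel) = ennreal ?J"
    using nn_integral_real_affine[of ?g "-1" 0] J by simp
  have "(\<integral>\<^sup>+t. ennreal (indicator {-N..N} t * max 1 \<bar>t\<bar> powr (-a)) \<partial>lborel) \<le> (\<integral>\<^sup>+t. ?g t + ?g (- t) \<partial>lborel)"
  proof (rule nn_integral_mono_AE)
    have "AE t in lborel. t \<noteq> (0::real)" by (rule AE_lborel_singleton)
    then show "AE t in lborel. ennreal (indicator {-N..N} t * max 1 \<bar>t\<bar> powr (-a)) \<le> ?g t + ?g (- t)"
    proof eventually_elim
      case (elim t)
      have m: "max 1 \<bar>t\<bar> powr (-a) \<le> \<bar>t\<bar> powr (-a)"
        using elim a by (intro powr_mono2') auto
      show ?case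
      proof (cases "t \<ge> 0")
        case True
        then have "ennreal (indicator {-N..N} t * max 1 \<bar>t\<bar> powr (-a)) \<le> ?g t"
          using m by (intro ennreal_leI) (auto simp: indicator_def)
        then show ?thesis by (simp add: add_increasing2)
      next
        case False
        then have "ennreal (indicator {-N..N} t * max 1 \<bar>t\<bar> powr (-a)) \<le> ?g (- t)"
          using m by (intro ennreal_leI) (auto simp: indicator_def)
        then show ?thesis by (simp add: add_increasing)
      qed
    qed
  qed
  also have "\<dots> = (\<integral>\<^sup>+t. ?g t \<partial>lborel) + (\<integral>\<^sup>+t. ?g (- t) \<partial>lborel)"
    by (rule nn_integral_add) measurable
  also have "\<dots> = ennreal (2 * ?J)"
    unfolding J J' using a by (simp add: ennreal_plus[symmetric] del: ennreal_plus)
  finally show ?thesis .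
qed

section \<open>Frequency weights and energies\<close>

lemmas cball_borel [measurable] = borel_closed[OF closed_cball]

text \<open>The Bessel weight of order \<open>\<theta>\<close>. At order 1 it is the modulus of the
  symbol of the free Dirac operator, and at order 2 the weight of the H1 norm.\<close>

definition wt :: "real \<Rightarrow> real^3 \<Rightarrow> real" where
  "wt \<theta> \<xi> = (1 + (norm \<xi>)\<^sup>2) powr (\<theta> / 2)"

lemma wt_measurable [measurable]: "wt \<theta> \<in> borel_measurable borel"
  unfolding wt_def by measurable

lemma wt_pos [simp]: "0 < wt \<theta> \<xi>"
proof -
  have "0 < 1 + (norm \<xi>)\<^sup>2" by (simp add: add_pos_nonneg)
  then show ?thesis by (simp add: wt_def)
qed

lemma wt_nonneg [simp]: "0 \<le> wt \<theta> \<xi>"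
  using wt_pos[of \<theta> \<xi>] by linarith

lemma wt_add: "wt \<theta> \<xi> * wt \<theta>' \<xi> = wt (\<theta> + \<theta>') \<xi>"
  by (simp add: wt_def powr_add[symmetric] add_divide_distrib)

lemma wt_0 [simp]: "wt 0 \<xi> = 1"
  using add_pos_nonneg[of 1 "(norm \<xi>)\<^sup>2"] by (simp add: wt_def)

text \<open>The weight is shared equally among the three coordinates, and each share is bounded by a
  function of one coordinate. The integral over a ball thus reduces to one-dimensional integrals
  with exponent \<open>\<theta> / 3\<close>, which are finite for
  \<open>\<theta> < 3\<close>.\<close>

lemma wt_minus_le_prod:
  assumes "0 < \<theta>"
  shows "wt (-\<theta>) \<xi> \<le> (\<Prod>b\<in>Basis. max 1 \<bar>\<xi> \<bullet> b\<bar> powr (- (\<theta> / 3)))"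
proof -
  define X where "X = 1 + (norm \<xi>)\<^sup>2"
  have X: "1 \<le> X" by (simp add: X_def)
  have "wt (-\<theta>) \<xi> = (\<Prod>b\<in>(Basis::(real^3) set). X powr (- (\<theta> / 6)))"
    using X by (simp add: wt_def X_def[symmetric] powr_power)
  also have "\<dots> \<le> (\<Prod>b\<in>Basis. max 1 \<bar>\<xi> \<bullet> b\<bar> powr (- (\<theta> / 3)))"
  proof (rule prod_mono, intro conjI)
    fix b :: "real^3" assume b: "b \<in> Basis"
    have "(max 1 \<bar>\<xi> \<bullet> b\<bar>)\<^sup>2 \<le> X"
      using power_mono[OF Basis_le_norm[OF b, of \<xi>] abs_ge_zero, of 2] X
      by (simp add: max_def X_def)
    then have m: "max 1 \<bar>\<xi> \<bullet> b\<bar> \<le> X powr (1/2)"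
      using real_le_rsqrt[of "max 1 \<bar>\<xi> \<bullet> b\<bar>" X] X by (simp add: powr_half_sqrt)
    have "X powr (- (\<theta> / 6)) = (X powr (1/2)) powr (- (\<theta> / 3))"
      by (simp add: powr_powr)
    also have "\<dots> \<le> max 1 \<bar>\<xi> \<bullet> b\<bar> powr (- (\<theta> / 3))"
      using m assms by (intro powr_mono2') auto
    finally show "X powr (- (\<theta> / 6)) \<le> max 1 \<bar>\<xi> \<bullet> b\<bar> powr (- (\<theta> / 3))" .
  qed simp
  finally show ?thesis .
qed

text \<open>The cube of the one-dimensional constant of \<open>nn_integral_max_powr_le\<close> at
  exponent \<open>\<theta> / 3\<close>.\<close>

definition cth :: "real \<Rightarrow> real" where "cth \<theta> = (2 / (1 - \<theta> / 3)) ^ 3"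

lemma nn_integral_wt_ball:
  assumes t: "0 < \<theta>" "\<theta> < 3" and N: "0 < N"
  shows "(\<integral>\<^sup>+\<xi>. ennreal (indicator (cball 0 N) \<xi> * wt (-\<theta>) \<xi>) \<partial>lborel) \<le> ennreal (cth \<theta> * N powr (3 - \<theta>))"
proof -
  let ?g = "\<lambda>t. ennreal (indicator {-N..N} t * max 1 \<bar>t\<bar> powr (- (\<theta> / 3)))"
  have "(\<integral>\<^sup>+\<xi>. ennreal (indicator (cball 0 N) \<xi> * wt (-\<theta>) \<xi>) \<partial>lborel) \<le>
      (\<integral>\<^sup>+\<xi>. (\<Prod>b\<in>(Basis::(real^3) set). ?g (\<xi> \<bullet> b)) \<partial>lborel)"
  proof (rule nn_integral_mono)
    fix \<xi> :: "real^3"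
    have "indicator (cball 0 N) \<xi> * wt (-\<theta>) \<xi> \<le> (\<Prod>b\<in>Basis. indicator {-N..N} (\<xi> \<bullet> b) * max 1 \<bar>\<xi> \<bullet> b\<bar> powr (- (\<theta> / 3)))"
    proof (cases "norm \<xi> \<le> N")
      case True
      have "indicator {-N..N} (\<xi> \<bullet> b) = (1::real)" if "b \<in> Basis" for b
        using Basis_le_norm[OF that, of \<xi>] True by (auto simp: indicator_def abs_le_iff)
      then show ?thesis using True wt_minus_le_prod[OF t(1), of \<xi>] by simp
    next
      case False
      then show ?thesis by (simp add: prod_nonneg)
    qed
    then show "ennreal (indicator (cball 0 N) \<xi> * wt (-\<theta>) \<xi>) \<le> (\<Prod>b\<in>Basis. ?g (\<xi> \<bullet> b))"
      by (subst prod_ennreal) (auto intro: ennreal_leI)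
  qed
  also have "\<dots> = (\<Prod>b\<in>(Basis::(real^3) set). \<integral>\<^sup>+t. ?g t \<partial>lborel)"
    by (rule nn_integral_lborel_prod) auto
  also have "\<dots> \<le> (\<Prod>b\<in>(Basis::(real^3) set). ennreal (2 * (N powr (1 - \<theta>/3) / (1 - \<theta>/3))))"
    using t N by (intro prod_mono_ennreal nn_integral_max_powr_le) auto
  also have "\<dots> = ennreal ((2 * (N powr (1 - \<theta>/3) / (1 - \<theta>/3))) ^ 3)"
    using t by (simp add: ennreal_power)
  also have "(2 * (N powr (1 - \<theta>/3) / (1 - \<theta>/3))) ^ 3 = cth \<theta> * (N powr (1 - \<theta>/3)) ^ 3"
    by (simp add: cth_def power_divide power_mult_distrib)
  also have "(N powr (1 - \<theta>/3)) ^ 3 = N powr (3 - \<theta>)"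
    using N by (simp add: powr_power algebra_simps)
  finally show ?thesis .
qed

definition En :: "real \<Rightarrow> wavefn \<Rightarrow> real" where
  "En \<theta> uh = (\<integral>\<xi>. wt \<theta> \<xi> * (norm (uh \<xi>))\<^sup>2 \<partial>lborel)"

text \<open>Stated apart from \<open>En\<close>, because the integral of a function that is not
  integrable is 0 by default and a bound on \<open>En\<close> alone would say nothing.\<close>

definition finE :: "real \<Rightarrow> wavefn \<Rightarrow> bool" where
  "finE \<theta> uh \<longleftrightarrow> uh \<in> borel_measurable borel \<and> integrable lborel (\<lambda>\<xi>. wt \<theta> \<xi> * (norm (uh \<xi>))\<^sup>2)"

lemma En_nonneg: "0 \<le> En \<theta> uh"
  unfolding En_def by (rule integral_nonneg_AE) simp

lemma wt_mono: "\<theta> \<le> \<theta>' \<Longrightarrow> wt \<theta> \<xi> \<le> wt \<theta>' \<xi>"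
  unfolding wt_def by (intro powr_mono) auto

lemma finE_mono: "finE \<theta>' uh \<Longrightarrow> \<theta> \<le> \<theta>' \<Longrightarrow> finE \<theta> uh"
  unfolding finE_def
  by (auto intro!: Bochner_Integration.integrable_bound[of _ "\<lambda>\<xi>. wt \<theta>' \<xi> * (norm (uh \<xi>))\<^sup>2"] AE_I2 mult_right_mono wt_mono)

lemma finE_L2: "finE \<theta> uh \<Longrightarrow> 0 \<le> \<theta> \<Longrightarrow> L2 uh"
  using finE_mono[of \<theta> uh 0] by (simp add: finE_def L2_def)

text \<open>Cauchy-Schwarz after splitting 1 into weights of orders -\<theta>/2 and \<theta>/2; the
  first factor is the weight integral over the ball, the second the energy.\<close>

lemma low_pass_integral:
  assumes f: "finE \<theta> uh" and t: "0 < \<theta>" "\<theta> < 3" and N: "0 < N"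
  shows "(\<integral>\<xi>. norm (restr (cball 0 N) uh \<xi>) \<partial>lborel)\<^sup>2 \<le> cth \<theta> * N powr (3 - \<theta>) * En \<theta> uh"
proof -
  have [measurable]: "uh \<in> borel_measurable borel" using f by (simp add: finE_def)
  have L: "L2 uh" using finE_L2[OF f] t by simp
  have i: "integrable lborel (restr (cball 0 N) uh)"
    by (intro integrable_restr L) (simp_all add: emeasure_cball_less_top)
  let ?I = "\<integral>\<xi>. norm (restr (cball 0 N) uh \<xi>) \<partial>lborel"
  have eq: "ennreal (norm (restr (cball 0 N) uh \<xi>)) =
      ennreal (indicator (cball 0 N) \<xi> * wt (-(\<theta>/2)) \<xi>) * ennreal (wt (\<theta>/2) \<xi> * norm (uh \<xi>))" for \<xi>
  proof -
    have "wt (-(\<theta>/2)) \<xi> * (wt (\<theta>/2) \<xi> * norm (uh \<xi>)) = norm (uh \<xi>)"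
      by (simp add: mult.assoc[symmetric] wt_add)
    then show ?thesis by (simp add: ennreal_mult[symmetric] restr_def indicator_def)
  qed
  have "ennreal (?I\<^sup>2) = (\<integral>\<^sup>+\<xi>. ennreal (norm (restr (cball 0 N) uh \<xi>)) \<partial>lborel)\<^sup>2"
    using i by (simp add: nn_integral_eq_integral ennreal_power)
  also have "\<dots> \<le> (\<integral>\<^sup>+\<xi>. (ennreal (indicator (cball 0 N) \<xi> * wt (-(\<theta>/2)) \<xi>))\<^sup>2 \<partial>lborel) *
      (\<integral>\<^sup>+\<xi>. (ennreal (wt (\<theta>/2) \<xi> * norm (uh \<xi>)))\<^sup>2 \<partial>lborel)"
    unfolding eq by (rule Cauchy_Schwarz_nn_integral) measurable
  also have "(\<integral>\<^sup>+\<xi>. (ennreal (indicator (cball 0 N) \<xi> * wt (-(\<theta>/2)) \<xi>))\<^sup>2 \<partial>lborel) =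
      (\<integral>\<^sup>+\<xi>. ennreal (indicator (cball 0 N) \<xi> * wt (-\<theta>) \<xi>) \<partial>lborel)"
  proof (rule nn_integral_cong)
    show "(ennreal (indicator (cball 0 N) \<xi> * wt (-(\<theta>/2)) \<xi>))\<^sup>2 = ennreal (indicator (cball 0 N) \<xi> * wt (-\<theta>) \<xi>)" for \<xi>
      using wt_add[of "-(\<theta>/2)" \<xi> "-(\<theta>/2)"] by (simp add: ennreal_power power2_eq_square indicator_def flip: ennreal_mult)
  qed
  also have "(\<integral>\<^sup>+\<xi>. (ennreal (wt (\<theta>/2) \<xi> * norm (uh \<xi>)))\<^sup>2 \<partial>lborel) = (\<integral>\<^sup>+\<xi>. ennreal (wt \<theta> \<xi> * (norm (uh \<xi>))\<^sup>2) \<partial>lborel)"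
  proof (rule nn_integral_cong)
    show "(ennreal (wt (\<theta>/2) \<xi> * norm (uh \<xi>)))\<^sup>2 = ennreal (wt \<theta> \<xi> * (norm (uh \<xi>))\<^sup>2)" for \<xi>
      using wt_add[of "\<theta>/2" \<xi> "\<theta>/2"] by (simp add: ennreal_power power_mult_distrib flip: power2_eq_square)
  qed
  also have "\<dots> = ennreal (En \<theta> uh)"
    using f unfolding En_def finE_def by (intro nn_integral_eq_integral) auto
  also have "(\<integral>\<^sup>+\<xi>. ennreal (indicator (cball 0 N) \<xi> * wt (-\<theta>) \<xi>) \<partial>lborel) * ennreal (En \<theta> uh) \<le>
      ennreal (cth \<theta> * N powr (3 - \<theta>)) * ennreal (En \<theta> uh)"
    by (intro mult_right_mono nn_integral_wt_ball t N) simp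
  also have "\<dots> = ennreal (cth \<theta> * N powr (3 - \<theta>) * En \<theta> uh)"
    using t En_nonneg[of \<theta> uh] by (simp add: ennreal_mult cth_def)
  finally show ?thesis
    using t En_nonneg[of \<theta> uh] by (subst (asm) ennreal_le_iff) (auto simp: cth_def)
qed

text \<open>Outside the ball the weight is at least \<open>N powr \<theta>\<close>.\<close>

lemma high_pass_norm:
  assumes f: "finE \<theta> uh" and t: "0 < \<theta>" and N: "0 < N"
  shows "(L2norm (\<lambda>\<xi>. uh \<xi> - restr (cball 0 N) uh \<xi>))\<^sup>2 \<le> N powr (-\<theta>) * En \<theta> uh"
proof -
  have [measurable]: "uh \<in> borel_measurable borel" using f by (simp add: finE_def)
  have L: "L2 uh" using finE_L2[OF f] t by simp
  have "(L2norm (\<lambda>\<xi>. uh \<xi> - restr (cball 0 N) uh \<xi>))\<^sup>2 = (\<integral>\<xi>. (norm (uh \<xi> - restr (cball 0 N) uh \<xi>))\<^sup>2 \<partial>lborel)"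
    by (rule L2norm_power2)
  also have "\<dots> \<le> (\<integral>\<xi>. N powr (-\<theta>) * (wt \<theta> \<xi> * (norm (uh \<xi>))\<^sup>2) \<partial>lborel)"
  proof (rule integral_mono)
    show "integrable lborel (\<lambda>\<xi>. (norm (uh \<xi> - restr (cball 0 N) uh \<xi>))\<^sup>2)"
      by (rule L2_integrable[OF L2_diff[OF L L2_restr[OF L]]]) simp
    show "integrable lborel (\<lambda>\<xi>. N powr (-\<theta>) * (wt \<theta> \<xi> * (norm (uh \<xi>))\<^sup>2))"
      using f by (simp add: finE_def)
    show "(norm (uh \<xi> - restr (cball 0 N) uh \<xi>))\<^sup>2 \<le> N powr (-\<theta>) * (wt \<theta> \<xi> * (norm (uh \<xi>))\<^sup>2)" for \<xi>
    proof (cases "norm \<xi> \<le> N")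
      case True then show ?thesis by (simp add: restr_def)
    next
      case False
      have "N\<^sup>2 \<le> 1 + (norm \<xi>)\<^sup>2" using power_mono[of N "norm \<xi>" 2] False N by linarith
      then have "(N\<^sup>2) powr (\<theta>/2) \<le> wt \<theta> \<xi>" unfolding wt_def using t by (intro powr_mono2) auto
      moreover have "(N\<^sup>2) powr (\<theta>/2) = N powr \<theta>"
        using N by (simp add: powr_powr flip: powr_numeral)
      ultimately have "1 \<le> N powr (-\<theta>) * wt \<theta> \<xi>"
        using N by (simp add: powr_minus field_simps)
      then have "1 * (norm (uh \<xi>))\<^sup>2 \<le> N powr (-\<theta>) * wt \<theta> \<xi> * (norm (uh \<xi>))\<^sup>2" by (rule mult_right_mono) simp
      then show ?thesis using False by (simp add: restr_def mult.assoc)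
    qed
  qed
  also have "\<dots> = N powr (-\<theta>) * En \<theta> uh" by (simp add: En_def)
  finally show ?thesis .
qed

section \<open>Low-pass parts of a field\<close>

definition lowpass :: "real \<Rightarrow> wavefn \<Rightarrow> wavefn" where
  "lowpass N uh = fo 1 (restr (cball 0 N) uh)"

lemma integrable_restr_cball: "L2 u \<Longrightarrow> integrable lborel (restr (cball 0 N) u)"
  by (rule integrable_restr) (simp_all add: emeasure_cball_less_top)

lemma lowpass_L2: "L2 uh \<Longrightarrow> L2 (lowpass N uh)"
  unfolding lowpass_def by (intro L2_fo L2_restr integrable_restr_cball) auto

lemma lowpass_diff:
  assumes u: "L2 u" "FT2 u uh"
  shows "L2norm (\<lambda>x. u x - lowpass N uh x) = L2norm (\<lambda>\<xi>. uh \<xi> - restr (cball 0 N) uh \<xi>)"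
proof -
  note L = FT2_L2[OF u(2)]
  show ?thesis
    by (rule FT2_isometry[OF L2_diff[OF u(1) lowpass_L2[OF L]]])
       (unfold lowpass_def, intro FT2_diff u L2_fo FT2_fo L2_restr integrable_restr_cball L, simp_all)
qed

lemma lowpass_bound:
  assumes f: "finE \<theta> uh" and t: "0 < \<theta>" "\<theta> < 3" and N: "0 < N"
  shows "(norm (lowpass N uh x))\<^sup>2 \<le> cth \<theta> * N powr (3 - \<theta>) * En \<theta> uh"
proof -
  have L: "L2 uh" using finE_L2[OF f] t by simp
  have c: "(2 * pi) powr (-3/2) \<le> 1"
    using powr_mono[of "-3/2" 0 "2*pi"] pi_gt3 by simp
  have "norm (lowpass N uh x) \<le> 1 * (\<integral>\<xi>. norm (restr (cball 0 N) uh \<xi>) \<partial>lborel)"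
    unfolding lowpass_def
    by (rule order_trans[OF norm_fo_le[OF integrable_restr_cball[OF L]]], rule mult_right_mono[OF c]) simp
  then have "(norm (lowpass N uh x))\<^sup>2 \<le> (\<integral>\<xi>. norm (restr (cball 0 N) uh \<xi>) \<partial>lborel)\<^sup>2"
    by (intro power_mono) auto
  also note low_pass_integral[OF f t N]
  finally show ?thesis .
qed

lemma integral_set_split:
  assumes u: "L2 u" "FT2 u uh" and f: "finE \<theta> uh" and t: "0 < \<theta>" "\<theta> < 3" and N: "0 < N"
    and A [measurable]: "A \<in> sets borel"
  shows "(\<integral>\<^sup>+x. ennreal (indicator A x * (norm (u x))\<^sup>2) \<partial>lborel) \<le>
    2 * (\<integral>\<^sup>+x. ennreal (indicator A x * (norm (lowpass N uh x))\<^sup>2) \<partial>lborel) + ennreal (2 * (N powr (-\<theta>) * En \<theta> uh))"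
proof -
  note [measurable] = L2_measurable[OF u(1)] L2_measurable[OF lowpass_L2[OF FT2_L2[OF u(2)], of N]]
  let ?l = "lowpass N uh"
  have L: "L2 (\<lambda>x. u x - ?l x)" by (intro L2_diff u lowpass_L2 FT2_L2[OF u(2)])
  have "(\<integral>\<^sup>+x. ennreal (indicator A x * (norm (u x))\<^sup>2) \<partial>lborel) \<le>
    (\<integral>\<^sup>+x. 2 * ennreal (indicator A x * (norm (?l x))\<^sup>2) + ennreal (2 * (norm (u x - ?l x))\<^sup>2) \<partial>lborel)"
  proof (rule nn_integral_mono)
    fix x
    have "norm (u x) \<le> norm (?l x) + norm (u x - ?l x)" using norm_triangle_ineq[of "?l x" "u x - ?l x"] by simp
    then have "(norm (u x))\<^sup>2 \<le> (norm (?l x) + norm (u x - ?l x))\<^sup>2" by (intro power_mono) auto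
    also have "\<dots> \<le> 2 * (norm (?l x))\<^sup>2 + 2 * (norm (u x - ?l x))\<^sup>2"
      using sum_squares_bound[of "norm (?l x)" "norm (u x - ?l x)"] by (simp add: power2_sum)
    finally have "indicator A x * (norm (u x))\<^sup>2 \<le> 2 * (indicator A x * (norm (?l x))\<^sup>2) + 2 * (norm (u x - ?l x))\<^sup>2"
      by (auto simp: indicator_def)
    then have "ennreal (indicator A x * (norm (u x))\<^sup>2) \<le> ennreal (2 * (indicator A x * (norm (?l x))\<^sup>2) + 2 * (norm (u x - ?l x))\<^sup>2)"
      by (rule ennreal_leI)
    also have "\<dots> = 2 * ennreal (indicator A x * (norm (?l x))\<^sup>2) + ennreal (2 * (norm (u x - ?l x))\<^sup>2)"
      by (simp add: ennreal_plus ennreal_mult)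
    finally show "ennreal (indicator A x * (norm (u x))\<^sup>2) \<le> \<dots>" .
  qed
  also have "\<dots> = 2 * (\<integral>\<^sup>+x. ennreal (indicator A x * (norm (?l x))\<^sup>2) \<partial>lborel) + (\<integral>\<^sup>+x. ennreal (2 * (norm (u x - ?l x))\<^sup>2) \<partial>lborel)"
    by (subst nn_integral_add) (auto simp: nn_integral_cmult)
  also have "(\<integral>\<^sup>+x. ennreal (2 * (norm (u x - ?l x))\<^sup>2) \<partial>lborel) = ennreal (2 * (L2norm (\<lambda>x. u x - ?l x))\<^sup>2)"
    using L2_integrable[OF L] by (subst nn_integral_eq_integral) (auto simp: L2norm_power2)
  also have "2 * (\<integral>\<^sup>+x. ennreal (indicator A x * (norm (?l x))\<^sup>2) \<partial>lborel) + \<dots> \<le>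
     2 * (\<integral>\<^sup>+x. ennreal (indicator A x * (norm (?l x))\<^sup>2) \<partial>lborel) + ennreal (2 * (N powr (-\<theta>) * En \<theta> uh))"
    unfolding lowpass_diff[OF u] using high_pass_norm[OF f t(1) N] by (intro add_left_mono ennreal_leI) simp
  finally show ?thesis .
qed

text \<open>The low frequencies contribute at most a multiple of m N^(3-\<theta>) by their pointwise
  bound, the high ones a multiple of N^(-\<theta>). The choice N = m^(-1/3) makes both equal to
  m^(\<theta>/3). This takes the role of a Sobolev embedding combined with Hoelder's
  inequality.\<close>

lemma integral_small_set:
  assumes u: "L2 u" "FT2 u uh" and f: "finE \<theta> uh" and t: "0 < \<theta>" "\<theta> < 3"
    and A [measurable]: "A \<in> sets borel" and m: "emeasure lborel A \<le> ennreal m" "0 < m"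
  shows "(\<integral>\<^sup>+x. ennreal (indicator A x * (norm (u x))\<^sup>2) \<partial>lborel) \<le>
    ennreal (2 * (cth \<theta> + 1) * m powr (\<theta> / 3) * En \<theta> uh)"
proof -
  define N where "N = m powr (- (1/3))"
  have N: "0 < N" using m by (simp add: N_def)
  have c: "0 \<le> cth \<theta>" using t by (simp add: cth_def)
  let ?B = "cth \<theta> * N powr (3 - \<theta>) * En \<theta> uh"
  have B: "0 \<le> ?B" using c En_nonneg by (intro mult_nonneg_nonneg) auto
  have "(\<integral>\<^sup>+x. ennreal (indicator A x * (norm (lowpass N uh x))\<^sup>2) \<partial>lborel) \<le> (\<integral>\<^sup>+x. ennreal ?B * indicator A x \<partial>lborel)"
    using lowpass_bound[OF f t N] by (intro nn_integral_mono) (auto simp: indicator_def intro!: ennreal_leI)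
  also have "\<dots> = ennreal ?B * emeasure lborel A" by (simp add: nn_integral_cmult)
  also have "\<dots> \<le> ennreal ?B * ennreal m" by (intro mult_left_mono m) simp
  also have "\<dots> = ennreal (?B * m)" using B m by (simp add: ennreal_mult)
  finally have "(\<integral>\<^sup>+x. ennreal (indicator A x * (norm (u x))\<^sup>2) \<partial>lborel) \<le> 2 * ennreal (?B * m) + ennreal (2 * (N powr (-\<theta>) * En \<theta> uh))"
    by (intro order_trans[OF integral_set_split[OF u f t N A]] add_right_mono mult_left_mono) auto
  also have "\<dots> = ennreal (2 * (?B * m) + 2 * (N powr (-\<theta>) * En \<theta> uh))"
    using B m En_nonneg[of \<theta> uh] by (simp add: ennreal_plus ennreal_mult)
  also have "N powr (-\<theta>) = m powr (\<theta> / 3)" by (simp add: N_def powr_powr)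
  also have "2 * (?B * m) = 2 * cth \<theta> * m powr (\<theta> / 3) * En \<theta> uh"
  proof -
    have "N powr (3 - \<theta>) * m = m powr (\<theta>/3 - 1) * m powr 1"
      using m by (simp add: N_def powr_powr diff_divide_distrib)
    also have "\<dots> = m powr (\<theta> / 3)" unfolding powr_add[symmetric] by simp
    finally show ?thesis by (simp add: mult_ac)
  qed
  also have "2 * cth \<theta> * m powr (\<theta> / 3) * En \<theta> uh + 2 * (m powr (\<theta> / 3) * En \<theta> uh) = 2 * (cth \<theta> + 1) * m powr (\<theta> / 3) * En \<theta> uh"
    by (simp add: algebra_simps)
  finally show ?thesis .
qed

section \<open>Potentials with a decaying distribution function\<close>

text \<open>Finite measure of all level sets expresses decay at infinity in the sense of measure,
  while the power bound at high levels limits local singularities. \<open>3 < s\<close> is the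
  subcritical range.\<close>

definition tail_bound :: "(real^3 \<Rightarrow> real) \<Rightarrow> real \<Rightarrow> real \<Rightarrow> bool" where
  "tail_bound V C s \<longleftrightarrow> V \<in> borel_measurable borel \<and> 0 < C \<and> 3 < s \<and>
     (\<forall>t>0. emeasure lborel {x. t < \<bar>V x\<bar>} < \<infinity>) \<and>
     (\<forall>t\<ge>1. emeasure lborel {x. t < \<bar>V x\<bar>} \<le> ennreal (C * t powr (-s)))"

text \<open>Chebyshev's inequality for the p-th power.\<close>

lemma Lp_tail:
  assumes L: "Lp_real p f" and p: "0 < p" and t: "0 < t"
  shows "emeasure lborel {x. t < \<bar>f x\<bar>} \<le> ennreal ((\<integral>x. \<bar>f x\<bar> powr p \<partial>lborel) * t powr (-p))"
proof -
  have [measurable]: "f \<in> borel_measurable borel" and i: "integrable lborel (\<lambda>x. \<bar>f x\<bar> powr p)"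
    using L by (simp_all add: Lp_real_def)
  have "emeasure lborel {x. t < \<bar>f x\<bar>} = (\<integral>\<^sup>+x. indicator {x. t < \<bar>f x\<bar>} x \<partial>lborel)" by simp
  also have "\<dots> \<le> (\<integral>\<^sup>+x. ennreal (t powr (-p) * \<bar>f x\<bar> powr p) \<partial>lborel)"
  proof (rule nn_integral_mono)
    fix x
    show "indicator {x. t < \<bar>f x\<bar>} x \<le> ennreal (t powr (-p) * \<bar>f x\<bar> powr p)"
    proof (cases "t < \<bar>f x\<bar>")
      case True
      have "t powr p \<le> \<bar>f x\<bar> powr p" using True t p by (intro powr_mono2) auto
      then have "1 \<le> t powr (-p) * \<bar>f x\<bar> powr p" using t by (simp add: powr_minus field_simps)
      then show ?thesis using True by simp
    qed simp
  qed
  also have "\<dots> = ennreal ((\<integral>x. \<bar>f x\<bar> powr p \<partial>lborel) * t powr (-p))"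
    using i by (subst nn_integral_eq_integral) (auto simp: mult.commute)
  finally show ?thesis .
qed

lemma powr_minus_half: "0 < t \<Longrightarrow> (t / 2) powr (-a) = 2 powr a * t powr (-a)" for t a :: real
  by (simp add: powr_divide powr_minus_divide)

text \<open>If the sum exceeds \<open>t\<close>, one of the summands exceeds \<open>t / 2\<close>;
  this is the source of the factors \<open>2 powr p\<close> and \<open>2 powr r\<close>.\<close>

lemma Xclass_tail:
  assumes W: "Xclass p r q W" and p: "3 < p" "3 < r"
  obtains C where "0 \<le> C" "\<And>t. 0 < t \<Longrightarrow> emeasure lborel {x. t < \<bar>W x\<bar>} \<le> ennreal (C * (t powr (-p) + t powr (-r)))"
    "W \<in> borel_measurable borel"
proof -
  obtain V1 V2 where V: "Lp_real p V1" "Lp_real r V2" and W': "\<And>x. W x = V1 x + V2 x"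
    using W by (auto simp: Xclass_def)
  have [measurable]: "V1 \<in> borel_measurable borel" "V2 \<in> borel_measurable borel"
    using V by (simp_all add: Lp_real_def)
  define I where "I p f = (\<integral>x. \<bar>f x\<bar> powr p \<partial>lborel)" for p and f :: "real^3 \<Rightarrow> real"
  have I: "0 \<le> I p f" for p f unfolding I_def by (rule integral_nonneg_AE) simp
  define C where "C = max (I p V1 * 2 powr p) (I r V2 * 2 powr r)"
  have C: "I p V1 * 2 powr p \<le> C" "I r V2 * 2 powr r \<le> C" by (simp_all add: C_def)
  have C0: "0 \<le> C" using I[of p V1] by (intro order_trans[OF _ C(1)]) simp
  have "emeasure lborel {x. t < \<bar>W x\<bar>} \<le> ennreal (C * (t powr (-p) + t powr (-r)))" if t: "0 < t" for t
  proof -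
    have "emeasure lborel {x. t < \<bar>W x\<bar>} \<le> emeasure lborel ({x. t/2 < \<bar>V1 x\<bar>} \<union> {x. t/2 < \<bar>V2 x\<bar>})"
      by (intro emeasure_mono) (auto simp: W')
    also have "\<dots> \<le> emeasure lborel {x. t/2 < \<bar>V1 x\<bar>} + emeasure lborel {x. t/2 < \<bar>V2 x\<bar>}"
      by (rule emeasure_subadditive) auto
    also have "\<dots> \<le> ennreal (I p V1 * (t/2) powr (-p)) + ennreal (I r V2 * (t/2) powr (-r))"
      unfolding I_def using V p t by (intro add_mono Lp_tail) auto
    also have "\<dots> = ennreal (I p V1 * 2 powr p * t powr (-p) + I r V2 * 2 powr r * t powr (-r))"
      using I t by (simp add: powr_minus_half ennreal_plus mult.assoc)
    also have "\<dots> \<le> ennreal (C * (t powr (-p) + t powr (-r)))"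
      using C by (intro ennreal_leI) (auto simp: distrib_left intro!: add_mono mult_right_mono)
    finally show ?thesis .
  qed
  moreover have "W \<in> borel_measurable borel" unfolding W'[abs_def] by measurable
  ultimately show thesis using that C0 by blast
qed

lemma emeasure_perturb:
  assumes [measurable]: "V \<in> borel_measurable borel" "W \<in> borel_measurable borel"
    and ae: "AE x in lborel. \<bar>V x - W x\<bar> \<le> e"
  shows "emeasure lborel {x. t + e < \<bar>V x\<bar>} \<le> emeasure lborel {x::real^3. t < \<bar>W x :: real\<bar>}"
  by (rule emeasure_mono_AE) (use ae in \<open>auto elim!: eventually_mono\<close>)

text \<open>The approximation property is used at two scales: with error \<open>t / 2\<close> to see
  that the level set at height \<open>t\<close> has finite measure, and with the fixed error 1/2 to
  obtain one constant for all heights from 1 on, where \<open>t - 1/2\<close> still is at least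
  \<open>t / 2\<close>.\<close>

lemma Xclass_eps_tail_bound:
  assumes V: "Xclass_eps p r q V" and p: "3 < p" "3 < r"
  obtains C where "tail_bound V C (min p r)"
proof -
  obtain W U where WU: "Xclass p r q W" "Linf_real U" "\<And>x. V x = W x + U x"
    using V by (auto simp: Xclass_eps_def)
  obtain C' where "W \<in> borel_measurable borel" using Xclass_tail[OF WU(1) p] by blast
  moreover have "U \<in> borel_measurable borel" using WU by (simp add: Linf_real_def)
  ultimately have [measurable]: "V \<in> borel_measurable borel" unfolding WU(3)[abs_def] by measurable
  have app: "\<exists>W C. W \<in> borel_measurable borel \<and> (AE x in lborel. \<bar>V x - W x\<bar> \<le> e) \<and> 0 \<le> C \<and>
      (\<forall>t>0. emeasure lborel {x. t < \<bar>W x\<bar>} \<le> ennreal (C * (t powr (-p) + t powr (-r))))" if "e > 0" for e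
  proof -
    obtain W where W: "Xclass p r q W" "AE x in lborel. \<bar>V x - W x\<bar> \<le> e"
      using V \<open>e > 0\<close> unfolding Xclass_eps_def by blast
    obtain C where "0 \<le> C" "\<And>t. 0 < t \<Longrightarrow> emeasure lborel {x. t < \<bar>W x\<bar>} \<le> ennreal (C * (t powr (-p) + t powr (-r)))"
      "W \<in> borel_measurable borel" using Xclass_tail[OF W(1) p] by blast
    with W show ?thesis by blast
  qed
  have fin: "emeasure lborel {x. t < \<bar>V x\<bar>} < \<infinity>" if t: "t > 0" for t
  proof -
    obtain W C where W [measurable]: "W \<in> borel_measurable borel" and ae: "AE x in lborel. \<bar>V x - W x\<bar> \<le> t/2"
      and e: "\<And>t. t > 0 \<Longrightarrow> emeasure lborel {x. t < \<bar>W x\<bar>} \<le> ennreal (C * (t powr (-p) + t powr (-r)))"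
      using app[of "t/2"] t by auto
    have "emeasure lborel {x. t < \<bar>V x\<bar>} \<le> emeasure lborel {x. t/2 < \<bar>W x\<bar>}"
      using emeasure_perturb[OF _ W ae, of "t/2"] by simp
    also have "\<dots> < \<infinity>" using e[of "t/2"] t by (simp add: order_le_less_trans[OF _ ennreal_less_top])
    finally show ?thesis .
  qed
  obtain W C where W [measurable]: "W \<in> borel_measurable borel" and ae: "AE x in lborel. \<bar>V x - W x\<bar> \<le> 1/2"
    and C: "0 \<le> C" and e: "\<And>t. t > 0 \<Longrightarrow> emeasure lborel {x. t < \<bar>W x\<bar>} \<le> ennreal (C * (t powr (-p) + t powr (-r)))"
    using app[of "1/2"] by auto
  \<comment> \<open>The summand 1 keeps the constant strictly positive, as \<open>tail_bound\<close>
    demands.\<close>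
  let ?s = "min p r" and ?K = "C * (2 powr p + 2 powr r) + 1"
  have "emeasure lborel {x. t < \<bar>V x\<bar>} \<le> ennreal (?K * t powr (- ?s))" if t: "t \<ge> 1" for t
  proof -
    have "emeasure lborel {x. t < \<bar>V x\<bar>} \<le> emeasure lborel {x. t - 1/2 < \<bar>W x\<bar>}"
      using emeasure_perturb[OF _ W ae, of "t - 1/2"] by simp
    also have "\<dots> \<le> emeasure lborel {x. t/2 < \<bar>W x\<bar>}"
      using t by (intro emeasure_mono) auto
    also have "\<dots> \<le> ennreal (C * ((t/2) powr (-p) + (t/2) powr (-r)))" using e[of "t/2"] t by simp
    also have "\<dots> \<le> ennreal (?K * t powr (- ?s))"
    proof (rule ennreal_leI)
      have "t powr (-p) \<le> t powr (- ?s)" "t powr (-r) \<le> t powr (- ?s)"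
        using t by (auto intro!: powr_mono)
      then have "C * ((t/2) powr (-p) + (t/2) powr (-r)) \<le> C * (2 powr p * t powr (- ?s) + 2 powr r * t powr (- ?s))"
        using t C by (auto simp: powr_minus_half intro!: mult_left_mono add_mono)
      also have "\<dots> \<le> ?K * t powr (- ?s)" by (simp add: algebra_simps)
      finally show "C * ((t/2) powr (-p) + (t/2) powr (-r)) \<le> ?K * t powr (- ?s)" .
    qed
    finally show ?thesis .
  qed
  moreover have "0 < ?K" using C by (intro add_nonneg_pos mult_nonneg_nonneg) auto
  ultimately have "tail_bound V ?K ?s" using fin p by (auto simp: tail_bound_def)
  then show thesis by (rule that)
qed

text \<open>Dyadic decomposition of the range of \<open>V\<close>; the geometric series converges because \<open>s > 3\<close>.\<close>
lemma tail_integral: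
  assumes V: "tail_bound V C s" and t: "0 < \<theta>" "\<theta> < 3"
  shows "\<exists>K \<delta>. 0 \<le> K \<and> 0 < \<delta> \<and> (\<forall>M u uh. M \<ge> 1 \<longrightarrow> L2 u \<longrightarrow> FT2 u uh \<longrightarrow> finE \<theta> uh \<longrightarrow>
      (\<integral>\<^sup>+x. ennreal (indicator {x. M < \<bar>V x\<bar>} x * (\<bar>V x\<bar> powr \<theta> * (norm (u x))\<^sup>2)) \<partial>lborel) \<le> ennreal (K * M powr (-\<delta>) * En \<theta> uh))"
proof -
  have [measurable]: "V \<in> borel_measurable borel" and C: "0 < C" and s: "3 < s"
    and tail: "\<And>t. t \<ge> 1 \<Longrightarrow> emeasure lborel {x. t < \<bar>V x\<bar>} \<le> ennreal (C * t powr (-s))"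
    using V by (auto simp: tail_bound_def)
  \<comment> \<open>Height t contributes t^\<theta> from the potential and t^(-s\<theta>/3) from the
    mass on its level set; the product is t^(-\<delta>).\<close>
  define \<delta> where "\<delta> = \<theta> * (s / 3 - 1)"
  have d: "0 < \<delta>" using t s by (simp add: \<delta>_def)
  define K0 where "K0 = 2 powr \<theta> * (2 * (cth \<theta> + 1) * C powr (\<theta> / 3))"
  have c: "0 \<le> cth \<theta>" using t by (simp add: cth_def)
  have K0: "0 \<le> K0" using c by (simp add: K0_def)
  define \<rho> where "\<rho> = 2 powr (-\<delta>)"
  have rho: "0 \<le> \<rho>" "\<rho> < 1" using d powr_less_mono[of "-\<delta>" 0 2] by (simp_all add: \<rho>_def)
  have main: "(\<integral>\<^sup>+x. ennreal (indicator {x. M < \<bar>V x\<bar>} x * (\<bar>V x\<bar> powr \<theta> * (norm (u x))\<^sup>2)) \<partial>lborel)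
      \<le> ennreal (K0 / (1 - \<rho>) * M powr (-\<delta>) * En \<theta> uh)"
    if M: "M \<ge> 1" and u: "L2 u" "FT2 u uh" and f: "finE \<theta> uh" for M u uh
  proof -
    note [measurable] = L2_measurable[OF u(1)]
    define T where "T j = 2 ^ j * M" for j :: nat
    have T: "1 \<le> T j" for j 
      unfolding T_def using mult_mono[OF one_le_power[of "2::real" j] M] by simp
    define D where "D j = {x. T j < \<bar>V x\<bar>}" for j
    have [measurable]: "D j \<in> sets borel" for j unfolding D_def by measurable
    let ?F = "\<lambda>j x. ennreal ((2 * T j) powr \<theta>) * ennreal (indicator (D j) x * (norm (u x))\<^sup>2)"
    let ?a = "K0 * M powr (-\<delta>) * En \<theta> uh"
    have a: "0 \<le> ?a" using K0 En_nonneg by (intro mult_nonneg_nonneg) auto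
    have pw: "ennreal (indicator {x. M < \<bar>V x\<bar>} x * (\<bar>V x\<bar> powr \<theta> * (norm (u x))\<^sup>2)) \<le> (\<Sum>j. ?F j x)" for x
    proof (cases "M < \<bar>V x\<bar>")
      case True
      have "\<exists>n. \<bar>V x\<bar> \<le> T n"
      proof -
        obtain n where "\<bar>V x\<bar> < 2 ^ n" using real_arch_pow[of 2 "\<bar>V x\<bar>"] by auto
        then have "\<bar>V x\<bar> \<le> 2 ^ n * 1" by simp
        also have "\<dots> \<le> T n" unfolding T_def using M by (intro mult_left_mono) auto
        finally show ?thesis by blast
      qed
      \<comment> \<open>Locates the dyadic shell of the value: with \<open>j\<close> the predecessor
        of the least such index, it lies between \<open>T j\<close> and \<open>2 * T j\<close>. The
        index is not 0 because the value exceeds \<open>M = T 0\<close>.\<close>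
      define n where "n = (LEAST n. \<bar>V x\<bar> \<le> T n)"
      have n: "\<bar>V x\<bar> \<le> T n" unfolding n_def by (rule LeastI_ex) fact
      have "n \<noteq> 0" using n True by (intro notI) (simp add: T_def)
      then obtain j where j: "n = Suc j" by (cases n) auto
      have jn: "T j < \<bar>V x\<bar>" using not_less_Least[of j "\<lambda>n. \<bar>V x\<bar> \<le> T n"] j by (simp add: n_def)
      have "\<bar>V x\<bar> \<le> 2 * T j" using n j by (simp add: T_def)
      then have "\<bar>V x\<bar> powr \<theta> \<le> (2 * T j) powr \<theta>" using t by (intro powr_mono2) auto
      then have "ennreal (indicator {x. M < \<bar>V x\<bar>} x * (\<bar>V x\<bar> powr \<theta> * (norm (u x))\<^sup>2)) \<le> ennreal ((2 * T j) powr \<theta> * (indicator (D j) x * (norm (u x))\<^sup>2))"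
        using True jn by (intro ennreal_leI) (simp add: D_def mult_right_mono)
      also have "\<dots> = ?F j x" by (simp add: ennreal_mult)
      also have "\<dots> \<le> (\<Sum>j. ?F j x)" using sum_le_suminf[of "\<lambda>j. ?F j x" "{j}"] by simp
      finally show ?thesis .
    qed simp
    have each: "(\<integral>\<^sup>+x. ?F j x \<partial>lborel) \<le> ennreal (?a * \<rho> ^ j)" for j
    proof -
      have "(\<integral>\<^sup>+x. ?F j x \<partial>lborel) = ennreal ((2 * T j) powr \<theta>) * (\<integral>\<^sup>+x. ennreal (indicator (D j) x * (norm (u x))\<^sup>2) \<partial>lborel)"
        by (rule nn_integral_cmult) measurable
      also have "\<dots> \<le> ennreal ((2 * T j) powr \<theta>) * ennreal (2 * (cth \<theta> + 1) * (C * T j powr (-s)) powr (\<theta> / 3) * En \<theta> uh)"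
        using tail[OF T[of j]] T[of j] C
        by (intro mult_left_mono integral_small_set[OF u f t]) (auto simp: D_def)
      also have "\<dots> = ennreal ((2 * T j) powr \<theta> * (2 * (cth \<theta> + 1) * (C * T j powr (-s)) powr (\<theta> / 3) * En \<theta> uh))"
        using c En_nonneg by (subst ennreal_mult) auto
      also have "(2 * T j) powr \<theta> * (2 * (cth \<theta> + 1) * (C * T j powr (-s)) powr (\<theta> / 3) * En \<theta> uh) =
          K0 * (T j powr \<theta> * T j powr (- s * (\<theta> / 3))) * En \<theta> uh"
        using C T[of j] by (simp add: K0_def powr_mult powr_powr mult_ac)
      also have "T j powr \<theta> * T j powr (- s * (\<theta> / 3)) = T j powr (-\<delta>)"
        unfolding powr_add[symmetric] \<delta>_def by (simp add: algebra_simps)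
      also have "\<dots> = \<rho> ^ j * M powr (-\<delta>)"
        unfolding T_def \<rho>_def using M by (simp add: powr_mult powr_power powr_realpow[symmetric] powr_powr mult.commute)
      finally show ?thesis by (simp add: mult_ac)
    qed
    have "(\<integral>\<^sup>+x. ennreal (indicator {x. M < \<bar>V x\<bar>} x * (\<bar>V x\<bar> powr \<theta> * (norm (u x))\<^sup>2)) \<partial>lborel) \<le> (\<integral>\<^sup>+x. (\<Sum>j. ?F j x) \<partial>lborel)"
      by (intro nn_integral_mono pw)
    also have "\<dots> = (\<Sum>j. \<integral>\<^sup>+x. ?F j x \<partial>lborel)" by (rule nn_integral_suminf) measurable
    also have "\<dots> \<le> (\<Sum>j. ennreal (?a * \<rho> ^ j))" by (intro suminf_le each) auto
    also have "\<dots> = ennreal (\<Sum>j. ?a * \<rho> ^ j)"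
      using a rho by (intro suminf_ennreal2) (auto intro!: mult_nonneg_nonneg summable_mult summable_geometric)
    also have "(\<Sum>j. ?a * \<rho> ^ j) = ?a * (1 / (1 - \<rho>))"
      using rho by (subst suminf_mult) (auto simp: suminf_geometric intro!: summable_geometric)
    finally show ?thesis by (simp add: mult_ac)
  qed
  show ?thesis
    by (intro exI[of _ "K0 / (1 - \<rho>)"] exI[of _ \<delta>] conjI allI impI main) (use K0 rho d in auto)
qed

text \<open>Order 1 is the form of the absolute potential, order 2 the squared norm of the potential
  times the field.\<close>

definition potE :: "(real^3 \<Rightarrow> real) \<Rightarrow> real \<Rightarrow> wavefn \<Rightarrow> real" where
  "potE V \<theta> u = (\<integral>x. \<bar>V x\<bar> powr \<theta> * (norm (u x))\<^sup>2 \<partial>lborel)"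

definition massOn :: "(real^3) set \<Rightarrow> wavefn \<Rightarrow> real" where
  "massOn A u = (\<integral>x. indicator A x * (norm (u x))\<^sup>2 \<partial>lborel)"

lemma massOn_integrable:
  assumes u: "L2 u" and [measurable]: "A \<in> sets borel"
  shows "integrable lborel (\<lambda>x. indicator A x * (norm (u x))\<^sup>2)" "0 \<le> massOn A u" "massOn A u \<le> (L2norm u)\<^sup>2"
proof -
  note [measurable] = L2_measurable[OF u]
  show i: "integrable lborel (\<lambda>x. indicator A x * (norm (u x))\<^sup>2)"
    by (rule Bochner_Integration.integrable_bound[OF L2_integrable[OF u]]) (auto simp: indicator_def)
  show "0 \<le> massOn A u" unfolding massOn_def by (rule integral_nonneg_AE) simp
  show "massOn A u \<le> (L2norm u)\<^sup>2" unfolding massOn_def L2norm_power2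
    by (rule integral_mono[OF i L2_integrable[OF u]]) (simp add: indicator_def)
qed

text \<open>Small, intermediate and large values of the potential are treated separately; the last
  zone is \<open>tail_integral\<close>. The constants \<open>K\<close> and \<open>\<delta>\<close>
  do not depend on the two thresholds, which can therefore be tuned afterwards.\<close>

lemma potE_bound:
  assumes V: "tail_bound V C s" and t: "0 < \<theta>" "\<theta> < 3"
  shows "\<exists>K \<delta>. 0 \<le> K \<and> 0 < \<delta> \<and>
    (\<forall>u uh. L2 u \<longrightarrow> FT2 u uh \<longrightarrow> finE \<theta> uh \<longrightarrow>
       integrable lborel (\<lambda>x. \<bar>V x\<bar> powr \<theta> * (norm (u x))\<^sup>2)) \<and>
    (\<forall>e M u uh. 0 < e \<longrightarrow> M \<ge> 1 \<longrightarrow> L2 u \<longrightarrow> FT2 u uh \<longrightarrow> finE \<theta> uh \<longrightarrow>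
       potE V \<theta> u \<le> e powr \<theta> * (L2norm u)\<^sup>2 + M powr \<theta> * massOn {x. e < \<bar>V x\<bar>} u + K * M powr (-\<delta>) * En \<theta> uh)"
proof -
  have Vm [measurable]: "V \<in> borel_measurable borel" using V by (auto simp: tail_bound_def)
  obtain K \<delta> where K: "0 \<le> K" "0 < \<delta>" and
    tail0: "\<forall>M u uh. M \<ge> 1 \<longrightarrow> L2 u \<longrightarrow> FT2 u uh \<longrightarrow> finE \<theta> uh \<longrightarrow>
      (\<integral>\<^sup>+x. ennreal (indicator {x. M < \<bar>V x\<bar>} x * (\<bar>V x\<bar> powr \<theta> * (norm (u x))\<^sup>2)) \<partial>lborel) \<le> ennreal (K * M powr (-\<delta>) * En \<theta> uh)"
    using tail_integral[OF V t] by (elim exE conjE) (rule that)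
  note tail = tail0[rule_format]
  have main: "(\<integral>\<^sup>+x. ennreal (\<bar>V x\<bar> powr \<theta> * (norm (u x))\<^sup>2) \<partial>lborel) \<le>
      ennreal (e powr \<theta> * (L2norm u)\<^sup>2 + M powr \<theta> * massOn {x. e < \<bar>V x\<bar>} u + K * M powr (-\<delta>) * En \<theta> uh)"
    if e: "0 < e" and M: "M \<ge> 1" and u: "L2 u" "FT2 u uh" and f: "finE \<theta> uh" for e M u uh
  proof -
    note [measurable] = L2_measurable[OF u(1)]
    let ?A = "{x. e < \<bar>V x\<bar>}"
    have A: "?A \<in> sets borel" by measurable
    note mi = massOn_integrable[OF u(1) A]
    let ?t = "\<lambda>x. indicator {x. M < \<bar>V x\<bar>} x * (\<bar>V x\<bar> powr \<theta> * (norm (u x))\<^sup>2)"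
    let ?l = "\<lambda>x. e powr \<theta> * (norm (u x))\<^sup>2 + M powr \<theta> * (indicator ?A x * (norm (u x))\<^sup>2)"
    have pw: "\<bar>V x\<bar> powr \<theta> * (norm (u x))\<^sup>2 \<le> ?l x + ?t x" for x
    proof -
      consider "M < \<bar>V x\<bar>" | "\<bar>V x\<bar> \<le> e" | "e < \<bar>V x\<bar>" "\<bar>V x\<bar> \<le> M" by linarith
      then show ?thesis
      proof cases
        case 1
        then show ?thesis by simp
      next
        case 2
        then have "\<bar>V x\<bar> powr \<theta> \<le> e powr \<theta>" using t by (intro powr_mono2) auto
        then have "\<bar>V x\<bar> powr \<theta> * (norm (u x))\<^sup>2 \<le> e powr \<theta> * (norm (u x))\<^sup>2" by (rule mult_right_mono) simp
        moreover have "0 \<le> ?t x" by simp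
        moreover have "0 \<le> M powr \<theta> * (indicator ?A x * (norm (u x))\<^sup>2)" by simp
        ultimately show ?thesis by linarith
      next
        case 3
        then have "\<bar>V x\<bar> powr \<theta> \<le> M powr \<theta>" using t by (intro powr_mono2) auto
        then have "\<bar>V x\<bar> powr \<theta> * (norm (u x))\<^sup>2 \<le> M powr \<theta> * (indicator ?A x * (norm (u x))\<^sup>2)"
          using 3 by (simp add: mult_right_mono)
        moreover have "0 \<le> ?t x" by simp
        moreover have "0 \<le> e powr \<theta> * (norm (u x))\<^sup>2" by simp
        ultimately show ?thesis by linarith
      qed
    qed
    have il: "integrable lborel ?l" using mi L2_integrable[OF u(1)] by simp
    have "(\<integral>\<^sup>+x. ennreal (\<bar>V x\<bar> powr \<theta> * (norm (u x))\<^sup>2) \<partial>lborel) \<le> (\<integral>\<^sup>+x. ennreal (?l x) + ennreal (?t x) \<partial>lborel)"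
    proof (rule nn_integral_mono)
      fix x
      have "ennreal (\<bar>V x\<bar> powr \<theta> * (norm (u x))\<^sup>2) \<le> ennreal (?l x + ?t x)" by (rule ennreal_leI[OF pw])
      also have "\<dots> = ennreal (?l x) + ennreal (?t x)" by (rule ennreal_plus) simp_all
      finally show "ennreal (\<bar>V x\<bar> powr \<theta> * (norm (u x))\<^sup>2) \<le> ennreal (?l x) + ennreal (?t x)" .
    qed
    also have "\<dots> = (\<integral>\<^sup>+x. ennreal (?l x) \<partial>lborel) + (\<integral>\<^sup>+x. ennreal (?t x) \<partial>lborel)"
      by (rule nn_integral_add) measurable
    also have "(\<integral>\<^sup>+x. ennreal (?l x) \<partial>lborel) = ennreal (\<integral>x. ?l x \<partial>lborel)"
      by (rule nn_integral_eq_integral[OF il]) simp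
    also have "(\<integral>x. ?l x \<partial>lborel) = e powr \<theta> * (L2norm u)\<^sup>2 + M powr \<theta> * massOn ?A u"
      using mi L2_integrable[OF u(1)] by (simp add: L2norm_power2 massOn_def)
    also have "ennreal (e powr \<theta> * (L2norm u)\<^sup>2 + M powr \<theta> * massOn ?A u) + (\<integral>\<^sup>+x. ennreal (?t x) \<partial>lborel) \<le>
       ennreal (e powr \<theta> * (L2norm u)\<^sup>2 + M powr \<theta> * massOn ?A u) + ennreal (K * M powr (-\<delta>) * En \<theta> uh)"
      by (intro add_left_mono tail M u f)
    also have "\<dots> = ennreal (e powr \<theta> * (L2norm u)\<^sup>2 + M powr \<theta> * massOn ?A u + K * M powr (-\<delta>) * En \<theta> uh)"
      using mi K En_nonneg[of \<theta> uh] by (intro ennreal_plus[symmetric]) auto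
    finally show ?thesis .
  qed
  have int: "integrable lborel (\<lambda>x. \<bar>V x\<bar> powr \<theta> * (norm (u x))\<^sup>2)"
    if "L2 u" "FT2 u uh" "finE \<theta> uh" for u uh
  proof -
    note [measurable] = L2_measurable[OF that(1)]
    \<comment> \<open>For finiteness any thresholds will do; both are set to 1.\<close>
    show ?thesis
      by (intro integrableI_bounded) (use main[of 1 1, OF _ _ that] in \<open>auto intro: le_less_trans[OF _ ennreal_less_top]\<close>)
  qed
  have "potE V \<theta> u \<le> e powr \<theta> * (L2norm u)\<^sup>2 + M powr \<theta> * massOn {x. e < \<bar>V x\<bar>} u + K * M powr (-\<delta>) * En \<theta> uh"
    if a: "0 < e" "M \<ge> 1" "L2 u" "FT2 u uh" "finE \<theta> uh" for e M u uh
  proof -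
    have A: "{x. e < \<bar>V x\<bar>} \<in> sets borel" by measurable
    have nn: "0 \<le> e powr \<theta> * (L2norm u)\<^sup>2 + M powr \<theta> * massOn {x. e < \<bar>V x\<bar>} u + K * M powr (-\<delta>) * En \<theta> uh"
      using massOn_integrable(2)[OF a(3) A] K En_nonneg[of \<theta> uh] by (intro add_nonneg_nonneg mult_nonneg_nonneg) auto
    have "ennreal (potE V \<theta> u) = (\<integral>\<^sup>+x. ennreal (\<bar>V x\<bar> powr \<theta> * (norm (u x))\<^sup>2) \<partial>lborel)"
      unfolding potE_def by (rule nn_integral_eq_integral[OF int[OF a(3-5)], symmetric]) simp
    also note main[OF a]
    finally show ?thesis using nn by (simp add: ennreal_le_iff)
  qed
  with K int show ?thesis by (intro exI[of _ K] exI[of _ \<delta>] conjI allI impI)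
qed

text \<open>Relative compactness of the potential. Large values are made negligible by the energy
  bound, small values by the norm bound, and the set that remains has finite measure, where the mass
  tends to 0 by assumption.\<close>

lemma potE_tendsto:
  assumes V: "tail_bound V C s" and t: "0 < \<theta>" "\<theta> < 3"
    and u: "\<And>n. L2 (u n)" "\<And>n. FT2 (u n) (uh n)" "\<And>n. finE \<theta> (uh n)"
    and n1: "\<And>n. L2norm (u n) \<le> 1" and B: "\<And>n. En \<theta> (uh n) \<le> B"
    and mass: "\<And>A. A \<in> sets borel \<Longrightarrow> emeasure lborel A < \<infinity> \<Longrightarrow> (\<lambda>n. massOn A (u n)) \<longlonglongrightarrow> 0"
  shows "(\<lambda>n. potE V \<theta> (u n)) \<longlonglongrightarrow> 0"
proof (rule tendsto_zero_approx)
  have Vm [measurable]: "V \<in> borel_measurable borel" using V by (auto simp: tail_bound_def)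
  show "0 \<le> potE V \<theta> (u n)" for n unfolding potE_def by (rule integral_nonneg_AE) simp
  obtain K \<delta> where K: "0 \<le> K" "0 < \<delta>" and
    "\<forall>u uh. L2 u \<longrightarrow> FT2 u uh \<longrightarrow> finE \<theta> uh \<longrightarrow>
       integrable lborel (\<lambda>x. \<bar>V x\<bar> powr \<theta> * (norm (u x))\<^sup>2)" and
    bd0: "\<forall>e M u uh. 0 < e \<longrightarrow> M \<ge> 1 \<longrightarrow> L2 u \<longrightarrow> FT2 u uh \<longrightarrow> finE \<theta> uh \<longrightarrow>
       potE V \<theta> u \<le> e powr \<theta> * (L2norm u)\<^sup>2 + M powr \<theta> * massOn {x. e < \<bar>V x\<bar>} u + K * M powr (-\<delta>) * En \<theta> uh"
    using potE_bound[OF V t] by (elim exE conjE) (rule that)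
  note bd = bd0[rule_format]
  have B0: "0 \<le> B" using B[of 0] En_nonneg order_trans by blast
  fix e :: real assume e: "e > 0"
  \<comment> \<open>Chosen so that \<open>d powr \<theta> = e / 2\<close>; the other half of
    \<open>e\<close> is left for the values above \<open>M\<close>.\<close>
  define d where "d = (e / 2) powr (1 / \<theta>)"
  have d: "0 < d" "d powr \<theta> = e / 2" using e t by (simp_all add: d_def powr_powr)
  have "((\<lambda>M. K * M powr (-\<delta>) * B) \<longlongrightarrow> K * 0 * B) at_top"
    using K(2) by (intro tendsto_intros tendsto_neg_powr filterlim_ident) auto
  then have "\<forall>\<^sub>F M in at_top. K * M powr (-\<delta>) * B < e / 2"
    using e by (intro order_tendstoD(2)[where y=0]) auto
  then have "\<forall>\<^sub>F M in at_top. K * M powr (-\<delta>) * B < e / 2 \<and> M \<ge> 1"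
    using eventually_ge_at_top[of "1::real"] by (rule eventually_conj)
  then obtain M where M: "K * M powr (-\<delta>) * B < e / 2" "M \<ge> 1"
    unfolding eventually_at_top_linorder by blast
  let ?A = "{x. d < \<bar>V x\<bar>}"
  have A: "?A \<in> sets borel" by measurable
  have fA: "emeasure lborel ?A < \<infinity>" using V d by (simp add: tail_bound_def)
  have "potE V \<theta> (u n) \<le> e + M powr \<theta> * massOn ?A (u n)" for n
  proof -
    have "(L2norm (u n))\<^sup>2 \<le> 1" using n1[of n] by (simp add: power_le_one)
    then have "d powr \<theta> * (L2norm (u n))\<^sup>2 \<le> d powr \<theta> * 1" by (intro mult_left_mono) auto
    moreover have "K * M powr (-\<delta>) * En \<theta> (uh n) \<le> K * M powr (-\<delta>) * B"
      using B[of n] K by (intro mult_left_mono) auto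
    ultimately show ?thesis using bd[OF d(1) M(2) u(1)[of n] u(2)[of n] u(3)[of n]] M(1) d(2) by linarith
  qed
  moreover have "(\<lambda>n. M powr \<theta> * massOn ?A (u n)) \<longlonglongrightarrow> 0"
    by (intro tendsto_mult_right_zero mass A fA)
  ultimately show "\<exists>b. b \<longlonglongrightarrow> 0 \<and> (\<forall>n. potE V \<theta> (u n) \<le> e + b n)" by blast
qed

text \<open>A local compactness statement of Rellich type: high frequencies are uniformly small in
  the mean by the energy bound, while low-pass parts are uniformly bounded and converge pointwise,
  so dominated convergence applies on a set of finite measure.\<close>

lemma massOn_tendsto_lowpass:
  assumes u: "\<And>n. L2 (u n)" "\<And>n. FT2 (u n) (uh n)" "\<And>n. finE 1 (uh n)"
    and B: "\<And>n. En 1 (uh n) \<le> B"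
    and A [measurable]: "A \<in> sets borel" and fA: "emeasure lborel A < \<infinity>"
    and low: "\<And>N x. 0 < N \<Longrightarrow> (\<lambda>n. lowpass N (uh n) x) \<longlonglongrightarrow> 0"
  shows "(\<lambda>n. massOn A (u n)) \<longlonglongrightarrow> 0"
proof (rule tendsto_zero_approx)
  show "0 \<le> massOn A (u n)" for n by (rule massOn_integrable(2)[OF u(1) A])
  have B0: "0 \<le> B" using B[of 0] En_nonneg order_trans by blast
  fix e :: real assume e: "e > 0"
  \<comment> \<open>The high-frequency part costs at most \<open>2 * B / N\<close>; the summand 1
    keeps \<open>N\<close> positive even if \<open>B = 0\<close>.\<close>
  define N where "N = 2 * (B + 1) / e"
  have N: "0 < N" using e B0 by (simp add: N_def)
  have lL: "L2 (lowpass N (uh n))" for n by (intro lowpass_L2 FT2_L2[OF u(2)])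
  note [measurable] = L2_measurable[OF lL]
  have le: "massOn A (u n) \<le> e + 2 * massOn A (lowpass N (uh n))" for n
  proof -
    let ?m = "massOn A (lowpass N (uh n))"
    have mm: "ennreal (massOn A w) = (\<integral>\<^sup>+x. ennreal (indicator A x * (norm (w x))\<^sup>2) \<partial>lborel)" if "L2 w" for w
      unfolding massOn_def by (rule nn_integral_eq_integral[OF massOn_integrable(1)[OF that A], symmetric]) simp
    have m0: "0 \<le> ?m" by (rule massOn_integrable(2)[OF lL A])
    have "ennreal (massOn A (u n)) \<le> 2 * ennreal ?m + ennreal (2 * (N powr (-1) * En 1 (uh n)))"
      unfolding mm[OF u(1)] mm[OF lL] by (rule integral_set_split[OF u(1,2,3)]) (use N in auto)
    also have "\<dots> = ennreal (2 * ?m + 2 * (N powr (-1) * En 1 (uh n)))"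
      using m0 En_nonneg[of 1 "uh n"] by (simp add: ennreal_plus ennreal_mult)
    finally have "massOn A (u n) \<le> 2 * ?m + 2 * (N powr (-1) * En 1 (uh n))"
      using m0 En_nonneg[of 1 "uh n"] by (subst (asm) ennreal_le_iff) auto
    moreover have "2 * (N powr (-1) * En 1 (uh n)) \<le> e"
    proof -
      have "2 * (N powr (-1) * En 1 (uh n)) = 2 * En 1 (uh n) / N" using N by (simp add: powr_minus divide_inverse)
      also have "\<dots> \<le> 2 * (B + 1) / N" using B[of n] N by (intro divide_right_mono) auto
      also have "\<dots> = e" using e B0 by (simp add: N_def)
      finally show ?thesis .
    qed
    ultimately show ?thesis by linarith
  qed
  have "(\<lambda>n. massOn A (lowpass N (uh n))) \<longlonglongrightarrow> integral\<^sup>L (lborel :: (real^3) measure) (\<lambda>x. 0::real)"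
    unfolding massOn_def
  proof (rule integral_dominated_convergence[where w="\<lambda>x. cth 1 * N powr 2 * B * indicator A x"])
    show "integrable lborel (\<lambda>x. cth 1 * N powr 2 * B * indicator A x)"
      using fA by (simp add: integrable_indicator_iff)
    have "(\<lambda>n. indicator A x * (norm (lowpass N (uh n) x))\<^sup>2) \<longlonglongrightarrow> indicator A x * 0\<^sup>2" for x
      by (intro tendsto_mult tendsto_const tendsto_power tendsto_norm_zero low N)
    then show "AE x in lborel. (\<lambda>n. indicator A x * (norm (lowpass N (uh n) x))\<^sup>2) \<longlonglongrightarrow> 0" by simp
    have "(norm (lowpass N (uh n) x))\<^sup>2 \<le> cth 1 * N powr 2 * B" for n x
    proof -
      have "(norm (lowpass N (uh n) x))\<^sup>2 \<le> cth 1 * N powr (3 - 1) * En 1 (uh n)"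
        by (rule lowpass_bound[OF u(3)]) (use N in auto)
      also have "\<dots> \<le> cth 1 * N powr (3 - 1) * B" by (intro mult_left_mono B) (simp add: cth_def)
      finally show ?thesis by simp
    qed
    then show "AE x in lborel. norm (indicator A x * (norm (lowpass N (uh n) x))\<^sup>2) \<le> cth 1 * N powr 2 * B * indicator A x" for n
      by (intro AE_I2) (simp add: indicator_def)
  qed measurable
  then have "(\<lambda>n. 2 * massOn A (lowpass N (uh n))) \<longlonglongrightarrow> 0" by (intro tendsto_mult_right_zero) simp
  with le show "\<exists>b. b \<longlonglongrightarrow> 0 \<and> (\<forall>n. massOn A (u n) \<le> e + b n)" by blast
qed

section \<open>The Dirac operator and its essential spectrum\<close>

text \<open>Arithmetic in the index type is modulo 4. The identity matches the enumeration 1, 2, 3,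
  4 with the indices 0 to 3 by which the spinor blocks are defined.\<close>

lemma four_eq_0: "(4::4) = 0"
proof -
  have "(0::4) \<in> {1,2,3,4}" unfolding UNIV_4[symmetric] by simp
  then show ?thesis by simp
qed

lemma sum_UNIV_4: "sum f (UNIV::4 set) = f 0 + f 1 + f 2 + f 3"
  using sum_4[of f] by (simp add: four_eq_0 add_ac)

lemma all_4: "(\<forall>i::4. P i) \<longleftrightarrow> P 0 \<and> P 1 \<and> P 2 \<and> P 3"
  using forall_4[of P] by (auto simp: four_eq_0)

lemma D0symb_nth:
  "(D0symb \<xi> *v v) $ 0 = v $ 0 + of_real (\<xi> $ 3) * v $ 2 + (of_real (\<xi> $ 1) - \<i> * of_real (\<xi> $ 2)) * v $ 3"
  "(D0symb \<xi> *v v) $ 1 = v $ 1 + (of_real (\<xi> $ 1) + \<i> * of_real (\<xi> $ 2)) * v $ 2 - of_real (\<xi> $ 3) * v $ 3"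
  "(D0symb \<xi> *v v) $ 2 = - v $ 2 + of_real (\<xi> $ 3) * v $ 0 + (of_real (\<xi> $ 1) - \<i> * of_real (\<xi> $ 2)) * v $ 1"
  "(D0symb \<xi> *v v) $ 3 = - v $ 3 + (of_real (\<xi> $ 1) + \<i> * of_real (\<xi> $ 2)) * v $ 0 - of_real (\<xi> $ 3) * v $ 1"
  by (simp_all add: matrix_vector_mult_def D0symb_def alpha_def beta_def blk_def sub_def pauli_def
      sum_UNIV_4 sum_3 algebra_simps)

lemma D0symb_hermitian: "cinner (D0symb \<xi> *v v) w = cinner v (D0symb \<xi> *v w)"
  by (simp add: cinner_def sum_UNIV_4 D0symb_nth algebra_simps)

lemma D0symb_inner: "(D0symb \<xi> *v v) \<bullet> w = v \<bullet> (D0symb \<xi> *v w)"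
  unfolding Re_cinner[symmetric] D0symb_hermitian ..

lemma bounded_linear_matrix_spinor: "bounded_linear (\<lambda>v::spinor. A *v v)"
  unfolding linear_conv_bounded_linear[symmetric]
proof (rule linearI)
  show "A *v (r *\<^sub>R v) = r *\<^sub>R (A *v v)" for r and v :: spinor
    by (simp add: matrix_vector_mult_def vec_eq_iff scaleR_sum_right)
qed (rule matrix_vector_right_distrib)

lemma matrix_smult_spinor: "A *v (c *s v) = c *s (A *v (v::spinor))"
  by (simp add: matrix_vector_mult_def vec_eq_iff sum_distrib_left mult_ac)

lemma measurable_matrix_spinor [measurable (raw)]:
  assumes "u \<in> borel_measurable M"
  shows "(\<lambda>x. A *v (u x :: spinor)) \<in> borel_measurable M"
  by (rule borel_measurable_continuous_on[OF _ assms])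
     (rule linear_continuous_on[OF bounded_linear_matrix_spinor])

lemma L2_matrix:
  assumes u: "L2 (u::wavefn)" shows "L2 (\<lambda>x. A *v u x)"
proof -
  obtain K where K: "\<And>v::spinor. norm (A *v v) \<le> norm v * K" "0 \<le> K"
    using bounded_linear.nonneg_bounded[OF bounded_linear_matrix_spinor[of A]] by blast
  note [measurable] = L2_measurable[OF u]
  show ?thesis
    by (rule L2_dominated(1)[OF u, of _ K]) (use K in \<open>auto simp: mult.commute\<close>)
qed

lemma FT2_matrix:
  assumes u: "L2 u" "FT2 u uh"
  shows "FT2 (\<lambda>x. A *v u x) (\<lambda>\<xi>. A *v uh \<xi>)"
  unfolding FT2_iff
proof
  note L = FT2_L2[OF u(2)]
  note [measurable] = L2_measurable[OF u(1)] L2_measurable[OF L]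
  show "L2 (\<lambda>\<xi>. A *v uh \<xi>)" by (rule L2_matrix[OF L])
  obtain K where K: "\<And>v::spinor. norm (A *v v) \<le> norm v * K" "0 \<le> K"
    using bounded_linear.nonneg_bounded[OF bounded_linear_matrix_spinor[of A]] by blast
  let ?d = "\<lambda>n \<xi>. fo (-1) (restr (cb n) u) \<xi> - uh \<xi>"
  have d: "L2 (?d n)" for n by (intro L2_diff FT2_L2_restr u L)
  have fA: "fo (-1) (restr (cb n) (\<lambda>x. A *v u x)) \<xi> = A *v fo (-1) (restr (cb n) u) \<xi>" for n \<xi>
  proof -
    have "restr (cb n) (\<lambda>x. A *v u x) = (\<lambda>x. A *v restr (cb n) u x)"
      by (auto simp: restr_def indicator_def)
    moreover have "(\<integral>x. iexp ((-1) * (x \<bullet> \<xi>)) *s (A *v restr (cb n) u x) \<partial>lborel) =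
      A *v (\<integral>x. iexp ((-1) * (x \<bullet> \<xi>)) *s restr (cb n) u x \<partial>lborel)"
      unfolding matrix_smult_spinor[symmetric]
      by (rule integral_bounded_linear[OF bounded_linear_matrix_spinor]) (intro integrable_phase integrable_restr_cb u, measurable)
    ultimately show ?thesis by (simp add: fo_def matrix_smult_spinor)
  qed
  have le: "L2norm (\<lambda>\<xi>. fo (-1) (restr (cb n) (\<lambda>x. A *v u x)) \<xi> - A *v uh \<xi>) \<le> K * L2norm (?d n)" for n
  proof -
    note [measurable] = L2_measurable[OF d[of n]]
    have "L2norm (\<lambda>\<xi>. A *v ?d n \<xi>) \<le> K * L2norm (?d n)"
      by (rule L2_dominated(2)[OF d]) (use K in \<open>auto simp: mult.commute\<close>)
    then show ?thesis by (simp add: fA matrix_vector_mult_diff_distrib)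
  qed
  have "(\<lambda>n. K * L2norm (?d n)) \<longlonglongrightarrow> 0"
    using u(2) unfolding FT2_iff by (intro tendsto_mult_right_zero) simp
  then show "(\<lambda>n. L2norm (\<lambda>\<xi>. fo (-1) (restr (cb n) (\<lambda>x. A *v u x)) \<xi> - A *v uh \<xi>)) \<longlonglongrightarrow> 0"
    by (rule tendsto_zero_sandwich[OF L2norm_nonneg le])
qed

lemma FT2_sum:
  assumes "\<And>k. k \<in> I \<Longrightarrow> L2 (u k)" "\<And>k. k \<in> I \<Longrightarrow> FT2 (u k) (uh k)"
  shows "FT2 (\<lambda>x. \<Sum>k\<in>I. u k x) (\<lambda>\<xi>. \<Sum>k\<in>I. uh k \<xi>)"
  using assms
proof (induction I rule: infinite_finite_induct)
  case (insert k I)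
  then show ?case using FT2_add[of "u k" "uh k" "\<lambda>x. \<Sum>k\<in>I. u k x" "\<lambda>\<xi>. \<Sum>k\<in>I. uh k \<xi>"]
    by (simp add: L2_sum)
qed (simp_all add: FT2_iff restr_def fo_def)

section \<open>The Dirac operator as a Fourier multiplier on H1\<close>

lemma H1_L2: "H1 u \<Longrightarrow> L2 u" by (simp add: H1_def)

lemma H1_wd:
  assumes "H1 u" shows "L2 (wd u k)" "weak_deriv u k (wd u k)"
proof -
  have "\<exists>g. L2 g \<and> weak_deriv u k g" using assms by (simp add: H1_def)
  then have "L2 (wd u k) \<and> weak_deriv u k (wd u k)" unfolding wd_def by (rule someI_ex)
  then show "L2 (wd u k)" "weak_deriv u k (wd u k)" by auto
qed

definition D0op :: "wavefn \<Rightarrow> wavefn" where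
  "D0op u x = (\<Sum>k\<in>UNIV. (- \<i>) *s (alpha k *v wd u k x)) + beta *v u x"

lemma Dop_eq: "Dop V u x = D0op u x + complex_of_real (V x) *s u x"
  by (simp add: Dop_def D0op_def)

text \<open>The choice made by \<open>wd\<close> is harmless, since \<open>FT2_weak_deriv\<close>
  gives every square-integrable weak derivative the same transform; the factors -i and i then cancel
  and leave the symbol.\<close>

lemma FT2_D0op:
  assumes u: "H1 u" "FT2 u uh"
  shows "L2 (D0op u)" "FT2 (D0op u) (\<lambda>\<xi>. D0symb \<xi> *v uh \<xi>)"
proof -
  note L = H1_L2[OF u(1)] and W = H1_wd[OF u(1)]
  show "L2 (D0op u)" unfolding D0op_def by (intro L2_add L2_sum L2_smult L2_matrix L W)
  have g: "FT2 (wd u k) (\<lambda>\<xi>. (\<i> * complex_of_real (\<xi> $ k)) *s uh \<xi>)" for k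
    by (rule FT2_weak_deriv[OF L u(2) W])
  have "FT2 (D0op u) (\<lambda>\<xi>. (\<Sum>k\<in>UNIV. (- \<i>) *s (alpha k *v ((\<i> * complex_of_real (\<xi> $ k)) *s uh \<xi>))) + beta *v uh \<xi>)"
    unfolding D0op_def
    by (intro FT2_add FT2_sum FT2_smult FT2_matrix L2_add L2_sum L2_smult L2_matrix L W u(2) g)
  moreover have "(\<Sum>k\<in>UNIV. (- \<i>) *s (alpha k *v ((\<i> * complex_of_real (\<xi> $ k)) *s uh \<xi>))) + beta *v uh \<xi> = D0symb \<xi> *v uh \<xi>" for \<xi>
    by (simp add: vec_eq_iff matrix_vector_mult_def D0symb_def sum_UNIV_4 sum_3 algebra_simps)
  ultimately show "FT2 (D0op u) (\<lambda>\<xi>. D0symb \<xi> *v uh \<xi>)" by simp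
qed

lemma wt_2: "wt 2 \<xi> = 1 + (norm \<xi>)\<^sup>2"
  using add_pos_nonneg[of 1 "(norm \<xi>)\<^sup>2"] by (simp add: wt_def)

lemma H1_finE:
  assumes u: "H1 u" "FT2 u uh" shows "finE 2 uh"
proof -
  note L = FT2_L2[OF u(2)]
  note [measurable] = L2_measurable[OF L]
  have "L2 (\<lambda>\<xi>. (\<i> * complex_of_real (\<xi> $ k)) *s uh \<xi>)" for k
    by (rule FT2_L2[OF FT2_weak_deriv[OF H1_L2[OF u(1)] u(2) H1_wd[OF u(1)]]])
  from L2_integrable[OF this] have i: "integrable lborel (\<lambda>\<xi>. (\<xi> $ k)\<^sup>2 * (norm (uh \<xi>))\<^sup>2)" for k
    by (simp add: norm_mult power_mult_distrib)
  have "integrable lborel (\<lambda>\<xi>. (norm (uh \<xi>))\<^sup>2 + (\<Sum>k\<in>UNIV. (\<xi> $ k)\<^sup>2 * (norm (uh \<xi>))\<^sup>2))"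
    by (intro Bochner_Integration.integrable_add Bochner_Integration.integrable_sum L2_integrable L i)
  moreover have "wt 2 \<xi> * (norm (uh \<xi>))\<^sup>2 = (norm (uh \<xi>))\<^sup>2 + (\<Sum>k\<in>UNIV. (\<xi> $ k)\<^sup>2 * (norm (uh \<xi>))\<^sup>2)" for \<xi>
    by (simp add: wt_2 power2_norm_eq_inner inner_vec_def power2_eq_square[symmetric] sum_distrib_right distrib_right)
  ultimately show ?thesis by (simp add: finE_def)
qed

text \<open>The order 2 is below the limit 3 of \<open>potE_bound\<close>, so the potential maps H1
  into L2.\<close>

lemma mult_V_L2:
  assumes V: "tail_bound V C s" and u: "L2 u" "FT2 u uh" "finE 2 uh"
  shows "L2 (\<lambda>x. complex_of_real (V x) *s u x)"
    and "(L2norm (\<lambda>x. complex_of_real (V x) *s u x))\<^sup>2 = potE V 2 u"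
proof -
  have [measurable]: "V \<in> borel_measurable borel" using V by (simp add: tail_bound_def)
  note [measurable] = L2_measurable[OF u(1)]
  obtain K \<delta> where "0 \<le> (K::real)" "0 < (\<delta>::real)" and
    int: "\<forall>u uh. L2 u \<longrightarrow> FT2 u uh \<longrightarrow> finE 2 uh \<longrightarrow> integrable lborel (\<lambda>x. \<bar>V x\<bar> powr 2 * (norm (u x))\<^sup>2)"
    using potE_bound[OF V, of 2] by auto
  have eq: "(norm (complex_of_real (V x) *s u x))\<^sup>2 = \<bar>V x\<bar> powr 2 * (norm (u x))\<^sup>2" for x
    by (simp add: power_mult_distrib)
  show "L2 (\<lambda>x. complex_of_real (V x) *s u x)"
    unfolding L2_def eq using int u by simp
  show "(L2norm (\<lambda>x. complex_of_real (V x) *s u x))\<^sup>2 = potE V 2 u"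
    unfolding L2norm_power2 eq potE_def ..
qed

lemma Dop_L2:
  assumes V: "tail_bound V C s" and u: "H1 u" "FT2 u uh"
  shows "L2 (Dop V u)"
  unfolding Dop_eq[abs_def]
  by (rule L2_add[OF FT2_D0op(1)[OF u] mult_V_L2(1)[OF V H1_L2[OF u(1)] u(2) H1_finE[OF u]]])

lemma H1_fo:
  assumes h: "L2 h" "integrable lborel h"
    and h': "\<And>k. L2 (\<lambda>\<xi>. (\<i> * complex_of_real (\<xi> $ k)) *s h \<xi>)" "\<And>k. integrable lborel (\<lambda>\<xi>. (\<i> * complex_of_real (\<xi> $ k)) *s h \<xi>)"
  shows "H1 (fo 1 h)"
  unfolding H1_def using L2_fo(2)[OF h] L2_fo(2)[OF h'] weak_deriv_fo[OF h(2) h'(2)] by blast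

lemma D0symb_diff_bound:
  "\<exists>K. 0 \<le> K \<and> (\<forall>\<xi> \<eta> v. norm (D0symb \<xi> *v v - D0symb \<eta> *v v) \<le> K * norm (\<xi> - \<eta>) * norm v)"
proof -
  have "\<exists>K\<ge>0. \<forall>v::spinor. norm (alpha k *v v) \<le> norm v * K" for k
    using bounded_linear.nonneg_bounded[OF bounded_linear_matrix_spinor[of "alpha k"]] by blast
  then obtain K where K: "\<And>k. 0 \<le> K k" "\<And>k (v::spinor). norm (alpha k *v v) \<le> norm v * K k" by metis
  have "norm (D0symb \<xi> *v v - D0symb \<eta> *v v) \<le> (\<Sum>k\<in>UNIV. K k) * norm (\<xi> - \<eta>) * norm v" for \<xi> \<eta> v
  proof -
    have "D0symb \<xi> *v v - D0symb \<eta> *v v = (\<Sum>k\<in>UNIV. complex_of_real ((\<xi> - \<eta>) $ k) *s (alpha k *v v))"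
      by (simp add: vec_eq_iff matrix_vector_mult_def D0symb_def sum_UNIV_4 sum_3 algebra_simps)
    also have "norm \<dots> \<le> (\<Sum>k\<in>UNIV. norm (\<xi> - \<eta>) * (norm v * K k))"
    proof (rule sum_norm_le)
      fix k
      show "norm (complex_of_real ((\<xi> - \<eta>) $ k) *s (alpha k *v v)) \<le> norm (\<xi> - \<eta>) * (norm v * K k)"
        unfolding norm_smult_spinor norm_of_real
        by (intro mult_mono K component_le_norm_cart) auto
    qed
    also have "\<dots> = (\<Sum>k\<in>UNIV. K k) * norm (\<xi> - \<eta>) * norm v"
      by (simp add: sum_distrib_left sum_distrib_right mult_ac)
    finally show ?thesis .
  qed
  then show ?thesis by (intro exI[of _ "\<Sum>k\<in>UNIV. K k"] conjI allI) (simp_all add: K sum_nonneg)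
qed

text \<open>Along the third axis the symbol decouples, and components 0 and 2 form the symmetric
  block with rows (1, \<kappa>) and (\<kappa>, -1), whose eigenvalues are the two roots of 1 +
  \<kappa>^2. Hence every real number of modulus at least 1 occurs.\<close>

lemma D0symb_eigenvector:
  assumes "\<bar>lam\<bar> \<ge> 1"
  obtains k :: "real^3" and w :: spinor where "norm w = 1" "D0symb k *v w = complex_of_real lam *s w"
proof -
  define \<kappa> where "\<kappa> = sqrt (lam\<^sup>2 - 1)"
  have "1 \<le> lam\<^sup>2" using assms power_mono[of 1 "\<bar>lam\<bar>" 2] by simp
  then have \<kappa>: "\<kappa> * \<kappa> = lam * lam - 1" by (simp add: \<kappa>_def power2_eq_square)
  define k :: "real^3" where "k = \<kappa> *\<^sub>R axis 3 1"
  have k: "k $ 1 = 0" "k $ 2 = 0" "k $ 3 = \<kappa>" by (simp_all add: k_def axis_def)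
  \<comment> \<open>Both (lam + 1, \<kappa>) and (\<kappa>, lam - 1) solve the eigenvalue equation;
    the case distinction picks the one that cannot vanish.\<close>
  define a where "a = (if lam \<ge> 1 then lam + 1 else \<kappa>)"
  define b where "b = (if lam \<ge> 1 then \<kappa> else lam - 1)"
  have ab: "a + \<kappa> * b = lam * a" "- b + \<kappa> * a = lam * b"
    using \<kappa> by (auto simp: a_def b_def algebra_simps)
  have nz: "a \<noteq> 0 \<or> b \<noteq> 0" using assms by (auto simp: a_def b_def)
  define w :: spinor where "w = (\<chi> i. if i = 0 then of_real a else if i = 2 then of_real b else 0)"
  have w: "w $ 0 = of_real a" "w $ 1 = 0" "w $ 2 = of_real b" "w $ 3 = 0" by (simp_all add: w_def)
  have ev: "D0symb k *v w = complex_of_real lam *s w"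
    unfolding vec_eq_iff all_4 vector_smult_component D0symb_nth k w
    using ab by (simp flip: of_real_mult of_real_add of_real_minus of_real_diff)
  have "w \<noteq> 0" using nz w by (metis of_real_eq_0_iff zero_index)
  then have "norm ((1 / norm w) *\<^sub>R w) = 1" by simp
  moreover have "D0symb k *v ((1 / norm w) *\<^sub>R w) = complex_of_real lam *s ((1 / norm w) *\<^sub>R w)"
    unfolding smult_of_real_spinor[symmetric] matrix_smult_spinor ev by (simp add: vector_smult_assoc mult.commute)
  ultimately show thesis by (rule that)
qed

text \<open>Weyl sequence: wave packets whose Fourier transforms are normalised indicator functions of
  shrinking balls spread out in space, so that the potential does not see them.\<close>
theorem resolvent_abs_less_1:
  assumes V: "tail_bound V C s" and res: "in_resolvent V lam"
  shows "\<bar>lam\<bar> < 1"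
proof (rule ccontr)
  assume "\<not> \<bar>lam\<bar> < 1"
  then have "1 \<le> \<bar>lam\<bar>" by simp
  then obtain k w where w: "norm w = 1" and ev: "D0symb k *v w = complex_of_real lam *s w"
    using D0symb_eigenvector by blast
  obtain K where K0: "0 \<le> K" and K1: "\<forall>\<xi> \<eta> v. norm (D0symb \<xi> *v v - D0symb \<eta> *v v) \<le> K * norm (\<xi> - \<eta>) * norm v"
    using D0symb_diff_bound by (elim exE conjE) (rule that)
  note K = K0 K1[rule_format]
  define r where "r n = 1 / real (Suc n)" for n
  have r: "0 < r n" "r n \<le> 1" for n by (simp_all add: r_def)
  have r0: "r \<longlonglongrightarrow> 0" unfolding r_def using LIMSEQ_inverse_real_of_nat by (simp add: inverse_eq_divide)
  define b where "b n = cball k (r n)" for n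
  have bm [measurable]: "b n \<in> sets borel" for n by (simp add: b_def)
  define m where "m n = measure lborel (b n)" for n
  have m_eq: "m n = unit_ball_vol 3 * r n ^ 3" for n
    unfolding m_def b_def using r(1)[of n] by (simp add: content_cball)
  have m: "0 < m n" for n unfolding m_eq using r(1)[of n] by (simp add: unit_ball_vol_pos)
  have m0: "m \<longlonglongrightarrow> 0"
    using tendsto_mult[OF tendsto_const tendsto_power[OF r0, of 3], of "unit_ball_vol 3"] by (simp add: m_eq[abs_def])
  define c where "c n = 1 / sqrt (m n)" for n
  have c: "0 < c n" "(c n)\<^sup>2 * m n = 1" "c n * m n = sqrt (m n)" for n
    using m[of n] by (simp_all add: c_def power_divide real_div_sqrt)
  define h where "h n = (\<lambda>\<xi>. (c n * indicator (b n) \<xi>) *\<^sub>R w)" for n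
  have fin: "emeasure lborel (b n) < \<infinity>" for n unfolding b_def by (rule emeasure_lborel_cball_finite)
  have ib: "integrable lborel (\<lambda>\<xi>. C * indicator (b n) \<xi> :: real)" for C n
    using fin[of n] by (simp add: integrable_indicator_iff)
  have hm [measurable]: "h n \<in> borel_measurable borel" for n unfolding h_def by measurable
  have nh: "norm (h n \<xi>) = c n * indicator (b n) \<xi>" for n \<xi>
    using c(1)[of n] by (simp add: h_def w)
  have hi: "integrable lborel (h n)" for n
    by (rule Bochner_Integration.integrable_bound[OF ib[of "c n" n]]) (auto simp: nh)
  have hL: "L2 (h n)" for n
    by (rule L2_bounded_integrable[OF hi, of _ "c n"]) (use c(1)[of n] in \<open>simp add: nh indicator_def\<close>)
  have hn: "L2norm (h n) = 1" for n
  proof -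
    have "(L2norm (h n))\<^sup>2 = (\<integral>\<xi>. (c n)\<^sup>2 * indicator (b n) \<xi> \<partial>lborel)"
      unfolding L2norm_power2 nh by (intro Bochner_Integration.integral_cong) (auto simp: indicator_def)
    also have "\<dots> = 1" using c(2)[of n] by (simp add: m_def)
    finally show ?thesis by (simp add: power2_eq_1_iff) (metis L2norm_nonneg neg_0_le_iff_le not_one_le_zero)
  qed
  have bnorm: "norm \<xi> \<le> norm k + 1" if "\<xi> \<in> b n" for \<xi> n
    using that r(2)[of n] norm_triangle_ineq2[of \<xi> k] by (simp add: b_def dist_norm norm_minus_commute)
  have hk: "L2 (\<lambda>\<xi>. (\<i> * complex_of_real (\<xi> $ j)) *s h n \<xi>)" "integrable lborel (\<lambda>\<xi>. (\<i> * complex_of_real (\<xi> $ j)) *s h n \<xi>)" for j n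
  proof -
    have le: "norm ((\<i> * complex_of_real (\<xi> $ j)) *s h n \<xi>) \<le> (norm k + 1) * norm (h n \<xi>)" for \<xi>
    proof (cases "\<xi> \<in> b n")
      case True
      have "\<bar>\<xi> $ j\<bar> \<le> norm k + 1" using component_le_norm_cart[of \<xi> j] bnorm[OF True] by linarith
      then show ?thesis by (simp add: norm_mult mult_right_mono)
    qed (simp add: h_def)
    show "L2 (\<lambda>\<xi>. (\<i> * complex_of_real (\<xi> $ j)) *s h n \<xi>)"
      by (rule L2_dominated(1)[OF hL[of n], where C="norm k + 1"]) (use le in auto)
    show "integrable lborel (\<lambda>\<xi>. (\<i> * complex_of_real (\<xi> $ j)) *s h n \<xi>)"
      by (rule Bochner_Integration.integrable_bound[of _ "\<lambda>\<xi>. (norm k + 1) * norm (h n \<xi>)"]) (use le hi in auto)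
  qed
  define u where "u n = fo 1 (h n)" for n
  have uH: "H1 (u n)" for n unfolding u_def by (intro H1_fo hL hi hk)
  have uF: "FT2 (u n) (h n)" for n unfolding u_def by (intro FT2_fo hL hi)
  note uL = H1_L2[OF uH] and uE = H1_finE[OF uH uF]
  have un: "L2norm (u n) = 1" for n using FT2_isometry[OF uL uF] hn by simp
  have En: "En 2 (h n) \<le> 1 + (norm k + 1)\<^sup>2" for n
  proof -
    have "En 2 (h n) \<le> (\<integral>\<xi>. (1 + (norm k + 1)\<^sup>2) * (norm (h n \<xi>))\<^sup>2 \<partial>lborel)"
      unfolding En_def
    proof (rule integral_mono)
      show "integrable lborel (\<lambda>\<xi>. wt 2 \<xi> * (norm (h n \<xi>))\<^sup>2)" using uE[of n] by (simp add: finE_def)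
      show "integrable lborel (\<lambda>\<xi>. (1 + (norm k + 1)\<^sup>2) * (norm (h n \<xi>))\<^sup>2)" using L2_integrable[OF hL] by simp
      show "wt 2 \<xi> * (norm (h n \<xi>))\<^sup>2 \<le> (1 + (norm k + 1)\<^sup>2) * (norm (h n \<xi>))\<^sup>2" for \<xi>
      proof (cases "\<xi> \<in> b n")
        case True
        then have "wt 2 \<xi> \<le> 1 + (norm k + 1)\<^sup>2" unfolding wt_2 using bnorm[OF True] by (simp add: power_mono)
        then show ?thesis by (rule mult_right_mono) simp
      qed (simp add: h_def)
    qed
    also have "\<dots> = (1 + (norm k + 1)\<^sup>2) * (L2norm (h n))\<^sup>2" by (simp add: L2norm_power2)
    finally show ?thesis by (simp add: hn)
  qed
  \<comment> \<open>The amplitude is bounded by the L1 norm of the transform, which tends to 0 at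
    fixed L2 norm: this is the spreading of the packets.\<close>
  have ub: "norm (u n x) \<le> sqrt (m n)" for n x
  proof -
    have "(2 * pi) powr (-3/2) \<le> 1" using powr_mono[of "-3/2" 0 "2*pi"] pi_gt3 by simp
    moreover have "(\<integral>\<xi>. norm (h n \<xi>) \<partial>lborel) = sqrt (m n)" unfolding nh using c(3)[of n] by (simp add: m_def)
    ultimately have "(2 * pi) powr (-3/2) * (\<integral>\<xi>. norm (h n \<xi>) \<partial>lborel) \<le> 1 * sqrt (m n)"
      using m[of n] by (intro mult_mono) auto
    then show ?thesis unfolding u_def using norm_fo_le[OF hi[of n], of 1 x] by linarith
  qed
  have mass: "(\<lambda>n. massOn A (u n)) \<longlonglongrightarrow> 0" if A [measurable]: "A \<in> sets borel" and fA: "emeasure lborel A < \<infinity>" for A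
  proof (rule tendsto_zero_sandwich)
    show "0 \<le> massOn A (u n)" for n by (rule massOn_integrable(2)[OF uL A])
    show "massOn A (u n) \<le> m n * measure lborel A" for n
    proof -
      have "massOn A (u n) \<le> (\<integral>x. m n * indicator A x \<partial>lborel)"
        unfolding massOn_def
      proof (rule integral_mono[OF massOn_integrable(1)[OF uL A]])
        show "integrable lborel (\<lambda>x. m n * indicator A x)" using fA by (simp add: integrable_indicator_iff)
        show "indicator A x * (norm (u n x))\<^sup>2 \<le> m n * indicator A x" for x
          using power_mono[OF ub[of n x] norm_ge_zero, of 2] m[of n] by (simp add: indicator_def)
      qed
      then show ?thesis by simp
    qed
    show "(\<lambda>n. m n * measure lborel A) \<longlonglongrightarrow> 0" using tendsto_mult_left_zero[OF m0] .
  qed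
  have pot: "(\<lambda>n. potE V 2 (u n)) \<longlonglongrightarrow> 0"
    by (rule potE_tendsto[OF V _ _ uL uF uE _ En mass]) (simp_all add: un)
  let ?V = "\<lambda>n x. complex_of_real (V x) *s u n x"
  have VL: "L2 (?V n)" "L2norm (?V n) = sqrt (potE V 2 (u n))" for n
    using mult_V_L2[OF V uL uF uE, of n] L2norm_nonneg[of "?V n"] by (auto intro: real_sqrt_unique[symmetric])
  let ?D = "\<lambda>n x. D0op (u n) x - complex_of_real lam *s u n x"
  have DL: "L2 (?D n)" for n by (intro L2_diff L2_smult FT2_D0op(1)[OF uH uF] uL)
  have DF: "FT2 (?D n) (\<lambda>\<xi>. D0symb \<xi> *v h n \<xi> - complex_of_real lam *s h n \<xi>)" for n
    by (intro FT2_diff FT2_smult L2_smult FT2_D0op[OF uH uF] uL uF)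
  \<comment> \<open>At the centre \<open>k\<close> the vector \<open>w\<close> is an exact
    eigenvector of the symbol; the Lipschitz bound controls the deviation on the ball of radius
    \<open>r n\<close>.\<close>
  have Dn: "L2norm (?D n) \<le> K * r n" for n
  proof -
    have "norm (D0symb \<xi> *v h n \<xi> - complex_of_real lam *s h n \<xi>) \<le> K * r n * norm (h n \<xi>)" for \<xi>
    proof (cases "\<xi> \<in> b n")
      case True
      have "complex_of_real lam *s h n \<xi> = D0symb k *v h n \<xi>"
        unfolding h_def smult_of_real_spinor[symmetric] matrix_smult_spinor ev by (simp add: vector_smult_assoc mult.commute)
      then have "norm (D0symb \<xi> *v h n \<xi> - complex_of_real lam *s h n \<xi>) \<le> K * norm (\<xi> - k) * norm (h n \<xi>)"
        using K(2)[of \<xi> "h n \<xi>" k] by simp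
      also have "\<dots> \<le> K * r n * norm (h n \<xi>)"
        using True K(1) by (intro mult_right_mono mult_left_mono) (auto simp: b_def dist_norm norm_minus_commute)
      finally show ?thesis .
    qed (simp add: h_def)
    then have "L2norm (\<lambda>\<xi>. D0symb \<xi> *v h n \<xi> - complex_of_real lam *s h n \<xi>) \<le> K * r n * L2norm (h n)"
      using K(1) r(1)[of n] L2_measurable[OF FT2_L2[OF DF]] by (intro L2_dominated(2)[OF hL]) auto
    then show ?thesis using FT2_isometry[OF DL DF] hn by simp
  qed
  obtain Cr where Cr: "\<And>f. L2 f \<Longrightarrow> (\<forall>u. H1 u \<and> (AE x in lborel. Dop V u x - complex_of_real lam *s u x = f x) \<longrightarrow> L2norm u \<le> Cr * L2norm f)"
    using res unfolding in_resolvent_def by blast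
  let ?f = "\<lambda>n x. ?D n x + ?V n x"
  have f: "Dop V (u n) x - complex_of_real lam *s u n x = ?f n x" for n x by (simp add: Dop_eq)
  have fL: "L2 (?f n)" for n by (intro L2_add DL VL)
  have fle: "L2norm (?f n) \<le> K * r n + sqrt (potE V 2 (u n))" for n
    using L2norm_triangle[OF DL VL(1), of n n] Dn[of n] VL(2)[of n] by linarith
  have "(\<lambda>n. K * r n + sqrt (potE V 2 (u n))) \<longlonglongrightarrow> K * 0 + sqrt 0"
    by (intro tendsto_add tendsto_mult tendsto_const r0 tendsto_real_sqrt pot)
  then have "(\<lambda>n. L2norm (?f n)) \<longlonglongrightarrow> 0"
    by (intro tendsto_zero_sandwich[OF L2norm_nonneg fle]) simp
  then have "(\<lambda>n. Cr * L2norm (?f n)) \<longlonglongrightarrow> 0" by (rule tendsto_mult_right_zero)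
  moreover have "1 \<le> Cr * L2norm (?f n)" for n
    using Cr[OF fL[of n]] uH[of n] f[of n] un[of n] by auto
  ultimately have "1 \<le> (0::real)" by (intro LIMSEQ_le_const) auto
  then show False by simp
qed

section \<open>Galerkin vectors\<close>

lemma weak_deriv_integrable:
  assumes u: "L2 u" and t: "test_fn \<phi>"
  shows "integrable lborel (\<lambda>x. \<phi> x *\<^sub>R u x)" "integrable lborel (\<lambda>x. pd k \<phi> x *\<^sub>R u x)"
proof -
  obtain N :: nat and M where z: "\<And>x. norm x > real N \<Longrightarrow> \<phi> x = 0" "\<And>x. norm x > real N \<Longrightarrow> pd k \<phi> x = 0"
    and M: "\<And>x. \<bar>\<phi> x\<bar> \<le> M" "\<And>x. \<bar>pd k \<phi> x\<bar> \<le> M"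
    using test_fn_bounds[OF t, where k=k] by metis
  show "integrable lborel (\<lambda>x. \<phi> x *\<^sub>R u x)"
    by (rule integrable_mult_compact[OF u test_fn_measurable(1)[OF t] M(1) z(1)])
  show "integrable lborel (\<lambda>x. pd k \<phi> x *\<^sub>R u x)"
    by (rule integrable_mult_compact[OF u test_fn_measurable(2)[OF t] M(2) z(2)])
qed

lemma weak_deriv_add:
  assumes u: "L2 u" "L2 g" "weak_deriv u k g" and w: "L2 w" "L2 g'" "weak_deriv w k g'"
  shows "weak_deriv (\<lambda>x. u x + w x) k (\<lambda>x. g x + g' x)"
proof -
  have loc: "loc_integrable (\<lambda>x. a x + b x)" if "loc_integrable a" "loc_integrable b" for a b :: wavefn
    using that unfolding loc_integrable_def by (auto intro: set_integral_add)
  show ?thesis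
    unfolding weak_deriv_def
  proof (intro conjI allI impI)
    show "loc_integrable (\<lambda>x. u x + w x)" "loc_integrable (\<lambda>x. g x + g' x)"
      using u w by (auto intro!: loc simp: weak_deriv_def)
    fix \<phi> assume t: "test_fn \<phi>"
    show "(\<integral>x. pd k \<phi> x *\<^sub>R (u x + w x) \<partial>lborel) = - (\<integral>x. \<phi> x *\<^sub>R (g x + g' x) \<partial>lborel)"
      using u(3) w(3) t unfolding weak_deriv_def
      by (simp add: scaleR_add_right weak_deriv_integrable[OF u(1) t] weak_deriv_integrable[OF w(1) t]
          weak_deriv_integrable[OF u(2) t] weak_deriv_integrable[OF w(2) t])
  qed
qed

lemma H1_add: "H1 u \<Longrightarrow> H1 w \<Longrightarrow> H1 (\<lambda>x. u x + w x)"
proof -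
  assume u: "H1 u" and w: "H1 w"
  have "L2 (\<lambda>x. wd u k x + wd w k x) \<and> weak_deriv (\<lambda>x. u x + w x) k (\<lambda>x. wd u k x + wd w k x)" for k
    using L2_add[OF H1_wd(1)[OF u] H1_wd(1)[OF w]]
      weak_deriv_add[OF H1_L2[OF u] H1_wd[OF u] H1_L2[OF w] H1_wd[OF w]] by simp
  then show "H1 (\<lambda>x. u x + w x)"
    unfolding H1_def using L2_add[OF H1_L2[OF u] H1_L2[OF w]] by blast
qed

lemma Re_L2inner:
  assumes u: "L2 u" and w: "L2 w"
  shows "Re (L2inner u w) = ip u w"
proof -
  note [measurable] = L2_measurable[OF u] L2_measurable[OF w]
  have "integrable lborel (\<lambda>x. cinner (u x) (w x))"
  proof (rule Bochner_Integration.integrable_bound)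
    show "integrable lborel (\<lambda>x. 4 * ((norm (u x))\<^sup>2 + (norm (w x))\<^sup>2))"
      using L2_integrable[OF u] L2_integrable[OF w] by simp
    have "cmod (cinner (u x) (w x)) \<le> 4 * ((norm (u x))\<^sup>2 + (norm (w x))\<^sup>2)" for x
    proof -
      have "norm (u x) * norm (w x) \<le> (norm (u x))\<^sup>2 + (norm (w x))\<^sup>2"
        using sum_squares_bound[of "norm (u x)" "norm (w x)"] mult_nonneg_nonneg[OF norm_ge_zero norm_ge_zero, of "u x" "w x"]
        by linarith
      then show ?thesis by (intro order_trans[OF norm_cinner_le]) simp
    qed
    then show "AE x in lborel. norm (cinner (u x) (w x)) \<le> norm (4 * ((norm (u x))\<^sup>2 + (norm (w x))\<^sup>2))" by simp
    show "(\<lambda>x. cinner (u x) (w x)) \<in> borel_measurable lborel" by measurable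
  qed
  then show ?thesis unfolding L2inner_def ip_def Re_cinner[symmetric] by (rule integral_Re[symmetric])
qed

text \<open>Lets each component of a Galerkin vector be used alone as a test vector, with 0 as its
  partner in the direct sum.\<close>

lemma fin_subspace_zero: "fin_subspace W \<Longrightarrow> (\<lambda>x. 0) \<in> W"
  unfolding fin_subspace_def cspan_def by (auto intro!: exI[of _ "\<lambda>_. 0"])

section \<open>Spectral parts of the free operator\<close>

lemma wt_1: "wt 1 \<xi> = sqrt (1 + (norm \<xi>)\<^sup>2)"
  by (simp add: wt_def powr_half_sqrt)

lemma wt_1_ge: "1 \<le> wt 1 \<xi>"
  by (simp add: wt_1)

lemma Lam_plus_mult: "Lam_plus \<xi> *v v = (1/2) *s (v + complex_of_real (1 / wt 1 \<xi>) *s (D0symb \<xi> *v v))"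
  by (simp add: vec_eq_iff all_4 matrix_vector_mult_def Lam_plus_def sum_UNIV_4 wt_1 add_divide_distrib algebra_simps)

lemma D0symb_mult: "D0symb \<xi> *v w = (\<Sum>k\<in>UNIV. complex_of_real (\<xi> $ k) *s (alpha k *v w)) + beta *v w"
  by (simp add: vec_eq_iff matrix_vector_mult_def D0symb_def sum_UNIV_4 sum_3 algebra_simps)

lemma measurable_D0symb [measurable (raw)]:
  assumes [measurable]: "u \<in> borel_measurable borel"
  shows "(\<lambda>\<xi>. D0symb \<xi> *v u \<xi>) \<in> borel_measurable borel"
  unfolding D0symb_mult by measurable

text \<open>For \<open>\<sigma> = 1\<close> and \<open>\<sigma> = -1\<close>: elements of the range of the positive resp. negative spectral
  projector, with their Fourier transforms.\<close>
definition specpart :: "real \<Rightarrow> wavefn \<Rightarrow> wavefn \<Rightarrow> bool" where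
  "specpart \<sigma> a ah \<longleftrightarrow> L2 a \<and> FT2 a ah \<and> finE 2 ah \<and>
     (AE \<xi> in lborel. D0symb \<xi> *v ah \<xi> = (\<sigma> * wt 1 \<xi>) *\<^sub>R ah \<xi>)"

lemma smult_eq_iff_scaleR: "r \<noteq> 0 \<Longrightarrow> complex_of_real (1 / r) *s v = w \<longleftrightarrow> v = r *\<^sub>R (w::spinor)"
  unfolding smult_of_real_spinor by auto

lemma half_smult_eqD: "(1/2) *s (v + y) = z \<Longrightarrow> y = z + z - (v::spinor)"
  by (auto simp: vec_eq_iff field_simps)

lemma Pplus_specpart:
  assumes "u \<in> Pplus_space" "H1 u" obtains uh where "specpart 1 u uh"
proof -
  obtain uh where u: "L2 u" "FT2 u uh" and ae: "AE \<xi> in lborel. Lam_plus \<xi> *v uh \<xi> = uh \<xi>"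
    using assms by (auto simp: Pplus_space_def)
  have "AE \<xi> in lborel. D0symb \<xi> *v uh \<xi> = (1 * wt 1 \<xi>) *\<^sub>R uh \<xi>"
    using ae
  proof eventually_elim
    case (elim \<xi>)
    let ?y = "complex_of_real (1 / wt 1 \<xi>) *s (D0symb \<xi> *v uh \<xi>)"
    have "?y = uh \<xi>" using half_smult_eqD[OF elim[unfolded Lam_plus_mult]] by simp
    then show ?case using smult_eq_iff_scaleR[of "wt 1 \<xi>"] wt_pos[of 1 \<xi>] by simp
  qed
  then show thesis using that u H1_finE[OF assms(2) u(2)] by (auto simp: specpart_def)
qed

lemma Pminus_specpart:
  assumes "u \<in> Pminus_space" "H1 u" obtains uh where "specpart (-1) u uh"
proof -
  obtain uh where u: "L2 u" "FT2 u uh" and ae: "AE \<xi> in lborel. Lam_plus \<xi> *v uh \<xi> = 0"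
    using assms by (auto simp: Pminus_space_def)
  have "AE \<xi> in lborel. D0symb \<xi> *v uh \<xi> = (- 1 * wt 1 \<xi>) *\<^sub>R uh \<xi>"
    using ae
  proof eventually_elim
    case (elim \<xi>)
    let ?y = "complex_of_real (1 / wt 1 \<xi>) *s (D0symb \<xi> *v uh \<xi>)"
    have "?y = - uh \<xi>" using half_smult_eqD[OF elim[unfolded Lam_plus_mult]] by simp
    then show ?case using smult_eq_iff_scaleR[of "wt 1 \<xi>"] wt_pos[of 1 \<xi>] by simp
  qed
  then show thesis using that u H1_finE[OF assms(2) u(2)] by (auto simp: specpart_def)
qed

text \<open>Eigenvectors of a Hermitian matrix for opposite nonzero eigenvalues, frequency by
  frequency. The complex form is recorded so that it survives multiplication by a complex
  \<open>\<mu>\<close>.\<close>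

lemma specpart_orthogonal:
  assumes "\<sigma> \<noteq> 0" "specpart \<sigma> a ah" "specpart (-\<sigma>) b bh"
  shows "AE \<xi> in lborel. cinner (ah \<xi>) (bh \<xi>) = 0"
proof -
  have "AE \<xi> in lborel. D0symb \<xi> *v ah \<xi> = (\<sigma> * wt 1 \<xi>) *\<^sub>R ah \<xi>" "AE \<xi> in lborel. D0symb \<xi> *v bh \<xi> = (-\<sigma> * wt 1 \<xi>) *\<^sub>R bh \<xi>"
    using assms by (auto simp: specpart_def)
  then show ?thesis
  proof eventually_elim
    case (elim \<xi>)
    have "cinner (D0symb \<xi> *v ah \<xi>) (bh \<xi>) = cinner (ah \<xi>) (D0symb \<xi> *v bh \<xi>)" by (rule D0symb_hermitian)
    then have "of_real (\<sigma> * wt 1 \<xi>) * cinner (ah \<xi>) (bh \<xi>) = of_real (- \<sigma> * wt 1 \<xi>) * cinner (ah \<xi>) (bh \<xi>)"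
      unfolding elim smult_of_real_spinor[symmetric] cinner_smult_left cinner_smult_right complex_cnj_complex_of_real .
    then have "of_real (2 * (\<sigma> * wt 1 \<xi>)) * cinner (ah \<xi>) (bh \<xi>) = 0" by simp
    then show ?case using wt_pos[of 1 \<xi>] assms(1) by simp
  qed
qed

lemma D0op_inner:
  assumes w: "H1 w" "FT2 w wh" and v: "H1 v" "FT2 v vh"
  shows "ip w (D0op v) = ip (D0op w) v"
proof -
  have "ip w (D0op v) = ip wh (\<lambda>\<xi>. D0symb \<xi> *v vh \<xi>)"
    by (rule parseval[OF H1_L2[OF w(1)] w(2) FT2_D0op[OF v]])
  also have "\<dots> = ip (\<lambda>\<xi>. D0symb \<xi> *v wh \<xi>) vh"
    by (simp add: ip_def D0symb_inner)
  also have "\<dots> = ip (D0op w) v"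
    by (rule parseval[OF FT2_D0op[OF w] H1_L2[OF v(1)] v(2), symmetric])
  finally show ?thesis .
qed

lemma ip_mult_V_swap: "ip u (\<lambda>x. complex_of_real (V x) *s w x) = ip (\<lambda>x. complex_of_real (V x) *s u x) w"
  unfolding ip_def smult_of_real_spinor by simp

lemma ip_mult_V_le:
  assumes V: "tail_bound V C s" and a: "specpart \<sigma> a ah"
  shows "\<bar>ip a (\<lambda>x. complex_of_real (V x) *s a x)\<bar> \<le> potE V 1 a"
proof -
  have "\<bar>ip a (\<lambda>x. complex_of_real (V x) *s a x)\<bar> \<le> (\<integral>x. \<bar>a x \<bullet> (complex_of_real (V x) *s a x)\<bar> \<partial>lborel)"
    unfolding ip_def by (rule integral_abs_bound)
  also have "\<dots> = potE V 1 a"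
    unfolding potE_def smult_of_real_spinor
    by (intro Bochner_Integration.integral_cong) (simp_all add: abs_mult power2_norm_eq_inner)
  finally show ?thesis .
qed

text \<open>On the Fourier side the opposite part drops out of both pairings by pointwise
  orthogonality, and the symbol acts on the remaining part as \<open>\<sigma> * wt 1\<close>. The
  pairing being real, only the real part of \<open>\<mu>\<close> is seen.\<close>

lemma specpart_decomposition:
  assumes sg: "\<sigma> \<noteq> 0" and a: "specpart \<sigma> a ah" "H1 a" and b: "specpart (-\<sigma>) b bh" "H1 b"
  shows "ip a (D0op (\<lambda>x. a x + b x)) = \<sigma> * En 1 ah"
    and "ip a (\<lambda>x. \<mu> *s (a x + b x)) = Re \<mu> * (L2norm a)\<^sup>2"
proof -
  let ?v = "\<lambda>x. a x + b x" and ?vh = "\<lambda>\<xi>. ah \<xi> + bh \<xi>"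
  have L: "L2 a" "FT2 a ah" "L2 b" "FT2 b bh" using a b by (auto simp: specpart_def)
  note [measurable] = L2_measurable[OF FT2_L2[OF L(2)]] L2_measurable[OF FT2_L2[OF L(4)]]
  have vF: "FT2 ?v ?vh" by (rule FT2_add[OF L])
  note orth = specpart_orthogonal[OF sg a(1) b(1)]
  have "AE \<xi> in lborel. D0symb \<xi> *v ah \<xi> = (\<sigma> * wt 1 \<xi>) *\<^sub>R ah \<xi>" using a by (simp add: specpart_def)
  then have 1: "AE \<xi> in lborel. ah \<xi> \<bullet> (D0symb \<xi> *v ?vh \<xi>) = \<sigma> * (wt 1 \<xi> * (norm (ah \<xi>))\<^sup>2)"
    using orth
  proof eventually_elim
    case (elim \<xi>)
    then have "ah \<xi> \<bullet> bh \<xi> = 0" using Re_cinner[of "ah \<xi>" "bh \<xi>"] by simp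
    then show ?case unfolding D0symb_inner[symmetric] elim(1)
      by (simp add: inner_add_right power2_norm_eq_inner)
  qed
  have 2: "AE \<xi> in lborel. ah \<xi> \<bullet> (\<mu> *s ?vh \<xi>) = Re \<mu> * (norm (ah \<xi>))\<^sup>2"
    using orth
  proof eventually_elim
    case (elim \<xi>)
    have "cinner (ah \<xi>) (ah \<xi>) = complex_of_real ((norm (ah \<xi>))\<^sup>2)"
      by (simp add: complex_eq_iff Re_cinner power2_norm_eq_inner) (simp add: cinner_def sum_UNIV_4)
    then show ?case
      using elim unfolding Re_cinner[symmetric] vector_add_ldistrib
      by (simp add: cinner_def distrib_left sum.distrib vector_smult_component sum_distrib_left[symmetric] mult.left_commute[of _ \<mu>])
  qed
  have "ip a (D0op ?v) = ip ah (\<lambda>\<xi>. D0symb \<xi> *v ?vh \<xi>)"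
    by (rule parseval[OF L(1,2) FT2_D0op[OF H1_add[OF a(2) b(2)] vF]])
  also have "\<dots> = (\<integral>\<xi>. \<sigma> * (wt 1 \<xi> * (norm (ah \<xi>))\<^sup>2) \<partial>lborel)"
    unfolding ip_def by (rule integral_cong_AE) (use 1 in simp_all)
  finally show "ip a (D0op ?v) = \<sigma> * En 1 ah" by (simp add: En_def)
  have "ip a (\<lambda>x. \<mu> *s ?v x) = ip ah (\<lambda>\<xi>. \<mu> *s ?vh \<xi>)"
    by (intro parseval L L2_smult L2_add FT2_smult vF)
  also have "\<dots> = (\<integral>\<xi>. Re \<mu> * (norm (ah \<xi>))\<^sup>2 \<partial>lborel)"
    unfolding ip_def by (rule integral_cong_AE) (use 2 in simp_all)
  also have "\<dots> = Re \<mu> * (L2norm ah)\<^sup>2" by (simp add: L2norm_power2)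
  finally show "ip a (\<lambda>x. \<mu> *s ?v x) = Re \<mu> * (L2norm a)\<^sup>2" using FT2_isometry[OF L(1,2)] by simp
qed

text \<open>Testing the Galerkin equation with \<open>a - b\<close>: the cross terms in \<open>V\<close> cancel because \<open>V\<close> is real.\<close>
lemma galerkin_energy:
  assumes V: "tail_bound V C s" and a: "specpart 1 a ah" "H1 a" and b: "specpart (-1) b bh" "H1 b"
    and ga: "L2inner a (\<lambda>x. Dop V (\<lambda>x. a x + b x) x - \<mu> *s (a x + b x)) = 0"
    and gb: "L2inner b (\<lambda>x. Dop V (\<lambda>x. a x + b x) x - \<mu> *s (a x + b x)) = 0"
  shows "En 1 ah + En 1 bh \<le> cmod \<mu> * (L2norm (\<lambda>x. a x + b x))\<^sup>2 + potE V 1 a + potE V 1 b"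
    and "(L2norm (\<lambda>x. a x + b x))\<^sup>2 = (L2norm a)\<^sup>2 + (L2norm b)\<^sup>2"
proof -
  let ?v = "\<lambda>x. a x + b x" and ?vh = "\<lambda>\<xi>. ah \<xi> + bh \<xi>"
  have aL: "L2 a" "FT2 a ah" "finE 2 ah" "finE 1 ah" and bL: "L2 b" "FT2 b bh" "finE 2 bh" "finE 1 bh"
    using a b finE_mono[of 2 _ 1] by (auto simp: specpart_def)
  have vH: "H1 ?v" by (rule H1_add[OF a(2) b(2)])
  have vF: "FT2 ?v ?vh" by (intro FT2_add aL bL)
  have vL: "L2 ?v" by (rule H1_L2[OF vH])
  have DvL: "L2 (Dop V ?v)" by (rule Dop_L2[OF V vH vF])
  have Va: "L2 (\<lambda>x. complex_of_real (V x) *s a x)" and Vb: "L2 (\<lambda>x. complex_of_real (V x) *s b x)"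
    by (rule mult_V_L2(1)[OF V aL(1-3)], rule mult_V_L2(1)[OF V bL(1-3)])
  have Vv: "L2 (\<lambda>x. complex_of_real (V x) *s ?v x)"
    using L2_add[OF Va Vb] by (simp add: vector_add_ldistrib)
  \<comment> \<open>For the second application the roles are exchanged: with \<sigma> = -1 the
    partner \<open>a\<close> must carry the sign -\<sigma>.\<close>
  have b': "specpart 1 b' bh' = specpart (- (-1)) b' bh'" for b' bh' by simp
  have eqa: "ip a (D0op ?v) = En 1 ah" and mu_a: "ip a (\<lambda>x. \<mu> *s ?v x) = Re \<mu> * (L2norm a)\<^sup>2" for \<mu>
    using specpart_decomposition[of 1, OF _ a b] by simp_all
  have eqb: "ip b (D0op ?v) = - En 1 bh" and mu_b: "ip b (\<lambda>x. \<mu> *s ?v x) = Re \<mu> * (L2norm b)\<^sup>2" for \<mu>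
    using specpart_decomposition[of "-1", OF _ b a(1)[unfolded b'] a(2)] by (simp_all add: add.commute)
  have split: "ip w (D0op ?v) + ip w (\<lambda>x. complex_of_real (V x) *s a x) + ip w (\<lambda>x. complex_of_real (V x) *s b x) = ip w (\<lambda>x. \<mu> *s ?v x)"
    if w: "L2 w" and g: "L2inner w (\<lambda>x. Dop V ?v x - \<mu> *s ?v x) = 0" for w
  proof -
    have "ip w (\<lambda>x. Dop V ?v x - \<mu> *s ?v x) = 0"
      using Re_L2inner[OF w L2_diff[OF DvL L2_smult[OF vL, of \<mu>]]] g by simp
    then have "ip w (\<lambda>x. \<mu> *s ?v x) = ip w (Dop V ?v)"
      using ip_diff_right[OF DvL L2_smult[OF vL, of \<mu>] w] by simp
    also have "Dop V ?v = (\<lambda>x. D0op ?v x + (complex_of_real (V x) *s a x + complex_of_real (V x) *s b x))"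
      by (auto simp: Dop_eq vector_add_ldistrib)
    also have "ip w \<dots> = ip w (D0op ?v) + (ip w (\<lambda>x. complex_of_real (V x) *s a x) + ip w (\<lambda>x. complex_of_real (V x) *s b x))"
      by (simp add: ip_add_right FT2_D0op(1)[OF vH vF] L2_add Va Vb w)
    finally show ?thesis by simp
  qed
  have cross: "ip a (\<lambda>x. complex_of_real (V x) *s b x) = ip b (\<lambda>x. complex_of_real (V x) *s a x)"
    unfolding ip_mult_V_swap[of a] by (rule ip_commute)
  have sa: "En 1 ah + ip a (\<lambda>x. complex_of_real (V x) *s a x) + ip a (\<lambda>x. complex_of_real (V x) *s b x) = Re \<mu> * (L2norm a)\<^sup>2"
    using split[OF aL(1) ga] unfolding eqa mu_a .
  have sb: "- En 1 bh + ip b (\<lambda>x. complex_of_real (V x) *s a x) + ip b (\<lambda>x. complex_of_real (V x) *s b x) = Re \<mu> * (L2norm b)\<^sup>2"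
    using split[OF bL(1) gb] unfolding eqb mu_b .
  \<comment> \<open>The decomposition with \<mu> = 1 yields Pythagoras for the two parts.\<close>
  have "(L2norm ?v)\<^sup>2 = ip a (\<lambda>x. 1 *s ?v x) + ip b (\<lambda>x. 1 *s ?v x)"
    unfolding L2norm_power2_ip by (simp add: ip_add_left aL bL vL)
  then show nv: "(L2norm ?v)\<^sup>2 = (L2norm a)\<^sup>2 + (L2norm b)\<^sup>2" unfolding mu_a mu_b by simp
  have "Re \<mu> * (L2norm a)\<^sup>2 \<le> cmod \<mu> * (L2norm a)\<^sup>2" "- Re \<mu> * (L2norm b)\<^sup>2 \<le> cmod \<mu> * (L2norm b)\<^sup>2"
    using mult_right_mono[of "Re \<mu>" "cmod \<mu>" "(L2norm a)\<^sup>2"] mult_right_mono[of "- Re \<mu>" "cmod \<mu>" "(L2norm b)\<^sup>2"]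
      abs_Re_le_cmod[of \<mu>] by auto
  then have "Re \<mu> * (L2norm a)\<^sup>2 - Re \<mu> * (L2norm b)\<^sup>2 \<le> cmod \<mu> * (L2norm ?v)\<^sup>2"
    unfolding nv by (simp add: distrib_left)
  moreover have "En 1 ah + En 1 bh = Re \<mu> * (L2norm a)\<^sup>2 - Re \<mu> * (L2norm b)\<^sup>2
      - ip a (\<lambda>x. complex_of_real (V x) *s a x) + ip b (\<lambda>x. complex_of_real (V x) *s b x)"
    using sa sb cross by linarith
  ultimately show "En 1 ah + En 1 bh \<le> cmod \<mu> * (L2norm ?v)\<^sup>2 + potE V 1 a + potE V 1 b"
    using ip_mult_V_le[OF V a(1)] ip_mult_V_le[OF V b(1)] by linarith
qed

section \<open>Weak convergence and compactness\<close>

lemma L2_restr_matrix_coord: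
  assumes g: "L2 g" and loc: "\<And>\<xi>. norm \<xi> > N \<Longrightarrow> g \<xi> = 0"
  shows "L2 (\<lambda>\<xi>. D0symb \<xi> *v g \<xi>)"
proof -
  note [measurable] = L2_measurable[OF g]
  have "L2 (\<lambda>\<xi>. complex_of_real (\<xi> $ k) *s (alpha k *v g \<xi>))" for k
  proof -
    have Ag: "L2 (\<lambda>\<xi>. alpha k *v g \<xi>)" by (rule L2_matrix[OF g])
    have "norm (complex_of_real (\<xi> $ k) *s (alpha k *v g \<xi>)) \<le> \<bar>N\<bar> * norm (alpha k *v g \<xi>)" for \<xi>
    proof (cases "norm \<xi> > N")
      case True then show ?thesis by (simp add: loc)
    next
      case False
      then have "\<bar>\<xi> $ k\<bar> \<le> \<bar>N\<bar>" using component_le_norm_cart[of \<xi> k] by linarith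
      then show ?thesis by (simp add: mult_right_mono)
    qed
    then show ?thesis by (intro L2_dominated(1)[OF Ag, where C="\<bar>N\<bar>"]) auto
  qed
  then show ?thesis unfolding D0symb_mult by (intro L2_add L2_sum L2_matrix g)
qed

text \<open>The value of a low-pass part at a point is a pairing with a plane wave truncated to a
  ball, hence with a square-integrable field. This is how weak convergence turns into pointwise
  convergence.\<close>

lemma lowpass_inner:
  assumes L: "L2 ah"
  shows "lowpass N ah x \<bullet> e = ip ah (\<lambda>\<xi>. restr (cball 0 N) (\<lambda>\<xi>. complex_of_real ((2 * pi) powr (-3/2)) *s (iexp (- (\<xi> \<bullet> x)) *s e)) \<xi>)"
proof -
  let ?c = "(2 * pi) powr (-3/2)"
  have "lowpass N ah x \<bullet> e = ?c * ((\<integral>\<xi>. iexp (1 * (\<xi> \<bullet> x)) *s restr (cball 0 N) ah \<xi> \<partial>lborel) \<bullet> e)"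
    by (simp add: lowpass_def fo_def smult_of_real_spinor)
  also have "\<dots> = ?c * (\<integral>\<xi>. (iexp (1 * (\<xi> \<bullet> x)) *s restr (cball 0 N) ah \<xi>) \<bullet> e \<partial>lborel)"
    by (subst integral_inner_left[symmetric]) (auto intro!: integrable_phase integrable_restr_cball L)
  also have "\<dots> = (\<integral>\<xi>. ?c * ((iexp (1 * (\<xi> \<bullet> x)) *s restr (cball 0 N) ah \<xi>) \<bullet> e) \<partial>lborel)"
    by simp
  also have "\<dots> = ip ah (\<lambda>\<xi>. restr (cball 0 N) (\<lambda>\<xi>. complex_of_real ?c *s (iexp (- (\<xi> \<bullet> x)) *s e)) \<xi>)"
    unfolding ip_def
  proof (rule Bochner_Integration.integral_cong[OF refl])
    fix \<xi>
    let ?z = "iexp (\<xi> \<bullet> x)"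
    have z: "iexp (- (\<xi> \<bullet> x)) = cnj ?z" by (simp add: exp_cnj)
    have eq: "(?z *s ah \<xi>) \<bullet> e = ah \<xi> \<bullet> (iexp (- (\<xi> \<bullet> x)) *s e)"
      unfolding z using inner_smult_spinor[of ?z "ah \<xi>" 1 e] inner_smult_spinor[of 1 "ah \<xi>" "cnj ?z" e] by simp
    show "?c * ((iexp (1 * (\<xi> \<bullet> x)) *s restr (cball 0 N) ah \<xi>) \<bullet> e) =
        ah \<xi> \<bullet> restr (cball 0 N) (\<lambda>\<xi>. complex_of_real ?c *s (iexp (- (\<xi> \<bullet> x)) *s e)) \<xi>"
    proof (cases "norm \<xi> \<le> N")
      case True
      then show ?thesis unfolding smult_of_real_spinor using eq by (simp add: restr_def)
    qed (simp add: restr_def)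
  qed
  finally show ?thesis .
qed

text \<open>The spectral projector is a bounded Fourier multiplier, so it can be moved to the test vector.\<close>
lemma specpart_pairing:
  assumes sg: "\<sigma> = 1 \<or> \<sigma> = -1" and G: "L2 G" "integrable lborel G" and loc: "\<And>\<xi>. norm \<xi> > N \<Longrightarrow> G \<xi> = 0"
  shows "\<exists>f. L2 f \<and> (\<forall>a ah b bh. specpart \<sigma> a ah \<longrightarrow> specpart (-\<sigma>) b bh \<longrightarrow> ip ah G = ip f (\<lambda>x. a x + b x))"
proof -
  note [measurable] = L2_measurable[OF G(1)]
  \<comment> \<open>The projection of \<open>G\<close> to the spectral part of sign
    \<open>\<sigma>\<close>. It vanishes outside the same ball as \<open>G\<close>, so it is
    integrable and has a Fourier integral.\<close>
  define q where "q = (\<lambda>\<xi>. (1/2) *\<^sub>R (G \<xi> + (\<sigma> / wt 1 \<xi>) *\<^sub>R (D0symb \<xi> *v G \<xi>)))"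
  have D: "L2 (\<lambda>\<xi>. D0symb \<xi> *v G \<xi>)" by (rule L2_restr_matrix_coord[OF G(1) loc])
  have s1: "\<bar>\<sigma> / wt 1 \<xi>\<bar> \<le> 1" for \<xi> using sg wt_1_ge[of \<xi>] by auto
  have "L2 (\<lambda>\<xi>. (\<sigma> / wt 1 \<xi>) *\<^sub>R (D0symb \<xi> *v G \<xi>))"
  proof (rule L2_dominated(1)[OF D, where C=1])
    have "norm ((\<sigma> / wt 1 \<xi>) *\<^sub>R (D0symb \<xi> *v G \<xi>)) \<le> 1 * norm (D0symb \<xi> *v G \<xi>)" for \<xi>
      unfolding norm_scaleR real_norm_def using s1[of \<xi>] by (intro mult_right_mono) auto
    then show "AE \<xi> in lborel. norm ((\<sigma> / wt 1 \<xi>) *\<^sub>R (D0symb \<xi> *v G \<xi>)) \<le> 1 * norm (D0symb \<xi> *v G \<xi>)" by simp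
  qed auto
  then have qL: "L2 q" unfolding q_def by (intro L2_scaleR L2_add G)
  have "restr (cball 0 N) q = q"
  proof
    show "restr (cball 0 N) q \<xi> = q \<xi>" for \<xi>
      using loc[of \<xi>] by (cases "norm \<xi> \<le> N") (simp_all add: restr_def q_def)
  qed
  then have qi: "integrable lborel q" using integrable_restr_cball[OF qL, of N] by simp
  show ?thesis
  proof (intro exI[of _ "fo 1 q"] conjI allI impI)
    show "L2 (fo 1 q)" by (rule L2_fo(2)[OF qL qi])
    fix a ah b bh assume a: "specpart \<sigma> a ah" and b: "specpart (-\<sigma>) b bh"
    have L: "L2 a" "L2 b" "FT2 a ah" "FT2 b bh" using a b by (auto simp: specpart_def)
    note [measurable] = L2_measurable[OF FT2_L2[OF L(3)]] L2_measurable[OF FT2_L2[OF L(4)]] L2_measurable[OF qL]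
    have "ip (fo 1 q) (\<lambda>x. a x + b x) = ip q (\<lambda>\<xi>. ah \<xi> + bh \<xi>)"
      by (rule parseval[OF L2_fo(2)[OF qL qi] FT2_fo[OF qL qi] L2_add[OF L(1,2)] FT2_add[OF L(1,3,2,4)]])
    also have "\<dots> = ip ah G"
      unfolding ip_def
    proof (rule integral_cong_AE)
      have "AE \<xi> in lborel. D0symb \<xi> *v ah \<xi> = (\<sigma> * wt 1 \<xi>) *\<^sub>R ah \<xi>" "AE \<xi> in lborel. D0symb \<xi> *v bh \<xi> = (-\<sigma> * wt 1 \<xi>) *\<^sub>R bh \<xi>"
        using a b by (auto simp: specpart_def)
      then show "AE \<xi> in lborel. q \<xi> \<bullet> (ah \<xi> + bh \<xi>) = ah \<xi> \<bullet> G \<xi>"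
      proof eventually_elim
        case (elim \<xi>)
        have w: "wt 1 \<xi> \<noteq> 0" by (rule less_imp_neq[OF wt_pos, symmetric])
        have ss: "\<sigma> * \<sigma> = 1" using sg by auto
        have "(D0symb \<xi> *v G \<xi>) \<bullet> (ah \<xi> + bh \<xi>) = (\<sigma> * wt 1 \<xi>) * (G \<xi> \<bullet> ah \<xi> - G \<xi> \<bullet> bh \<xi>)"
          unfolding D0symb_inner inner_add_right matrix_vector_right_distrib elim by (simp add: algebra_simps)
        then have "q \<xi> \<bullet> (ah \<xi> + bh \<xi>) = (1/2) * (G \<xi> \<bullet> ah \<xi> + G \<xi> \<bullet> bh \<xi> + (\<sigma> / wt 1 \<xi>) * ((\<sigma> * wt 1 \<xi>) * (G \<xi> \<bullet> ah \<xi> - G \<xi> \<bullet> bh \<xi>)))"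
          unfolding q_def inner_scaleR_left inner_add_left by (simp add: inner_add_right)
        also have "(\<sigma> / wt 1 \<xi>) * ((\<sigma> * wt 1 \<xi>) * (G \<xi> \<bullet> ah \<xi> - G \<xi> \<bullet> bh \<xi>)) = G \<xi> \<bullet> ah \<xi> - G \<xi> \<bullet> bh \<xi>"
          using w ss by (simp add: mult.assoc[symmetric])
        finally show ?case by (simp add: inner_commute)
      qed
    qed measurable
    finally show "ip ah G = ip (fo 1 q) (\<lambda>x. a x + b x)" by simp
  qed
qed

text \<open>Weak convergence is known only for the sum of the two parts.
  \<open>specpart_pairing\<close> rewrites the pairing of one part with the truncated plane wave as
  a pairing of the sum with one field that is the same for all n.\<close>

lemma specpart_lowpass_tendsto:
  assumes sg: "\<sigma> = 1 \<or> \<sigma> = -1"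
    and a: "\<And>n. specpart \<sigma> (a n) (ah n)" and b: "\<And>n. specpart (-\<sigma>) (b n) (bh n)"
    and weak: "\<And>f. L2 f \<Longrightarrow> (\<lambda>n. ip f (\<lambda>x. a n x + b n x)) \<longlonglongrightarrow> 0"
  shows "(\<lambda>n. lowpass N (ah n) x) \<longlonglongrightarrow> 0"
proof (subst tendsto_componentwise_iff, intro ballI)
  fix e :: spinor assume "e \<in> Basis"
  let ?g0 = "\<lambda>\<xi>::real^3. complex_of_real ((2 * pi) powr (-3/2)) *s (iexp (- (\<xi> \<bullet> x)) *s e)"
  define G where "G = restr (cball 0 N) ?g0"
  have Gm [measurable]: "G \<in> borel_measurable borel" unfolding G_def by measurable
  have Gb: "norm (G \<xi>) \<le> norm ((2 * pi) powr (-3/2) * norm e * indicator (cball 0 N) \<xi>)" for \<xi>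
    unfolding G_def restr_def norm_scaleR norm_smult_spinor norm_phase by (simp add: indicator_def)
  have Gi: "integrable lborel G"
    by (rule Bochner_Integration.integrable_bound[of _ "\<lambda>\<xi>. (2 * pi) powr (-3/2) * norm e * indicator (cball 0 N) \<xi>"])
       (use Gb in \<open>auto simp: integrable_indicator_iff emeasure_cball_less_top\<close>)
  have Gb': "norm (G \<xi>) \<le> (2 * pi) powr (-3/2) * norm e" for \<xi>
    using Gb[of \<xi>] by (cases "norm \<xi> \<le> N") (auto simp: abs_mult)
  have GL: "L2 G" by (rule L2_bounded_integrable[OF Gi Gb'])
  have loc: "G \<xi> = 0" if "norm \<xi> > N" for \<xi> using that by (simp add: G_def restr_def)
  obtain f where f: "L2 f" and pair0: "\<forall>a ah b bh. specpart \<sigma> a ah \<longrightarrow> specpart (-\<sigma>) b bh \<longrightarrow> ip ah G = ip f (\<lambda>x. a x + b x)"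
  proof -
    have "\<exists>f. L2 f \<and> (\<forall>a ah b bh. specpart \<sigma> a ah \<longrightarrow> specpart (-\<sigma>) b bh \<longrightarrow> ip ah G = ip f (\<lambda>x. a x + b x))"
      by (rule specpart_pairing[where N=N, OF sg GL Gi]) (rule loc)
    then show thesis by (elim exE conjE) (rule that)
  qed
  note pair = pair0[rule_format]
  have aL: "L2 (ah n)" for n using a[of n] FT2_L2 by (auto simp: specpart_def)
  have "lowpass N (ah n) x \<bullet> e = ip f (\<lambda>x. a n x + b n x)" for n
    unfolding lowpass_inner[OF aL] pair[OF a b, symmetric] G_def by simp
  then show "(\<lambda>n. lowpass N (ah n) x \<bullet> e) \<longlonglongrightarrow> 0 \<bullet> e" using weak[OF f] by simp
qed

section \<open>Scaling, the spectral gap and energy bounds\<close>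

lemma specpart_scaleR:
  assumes a: "specpart \<sigma> a ah"
  shows "specpart \<sigma> (\<lambda>x. r *\<^sub>R a x) (\<lambda>\<xi>. r *\<^sub>R ah \<xi>)"
proof -
  have f: "finE 2 (\<lambda>\<xi>. r *\<^sub>R ah \<xi>)"
    using a by (auto simp: specpart_def finE_def power_mult_distrib mult.left_commute[of _ "r\<^sup>2"])
  have ae: "AE \<xi> in lborel. D0symb \<xi> *v (r *\<^sub>R ah \<xi>) = (\<sigma> * wt 1 \<xi>) *\<^sub>R (r *\<^sub>R ah \<xi>)"
    using a unfolding specpart_def smult_of_real_spinor[symmetric] matrix_smult_spinor
    by (auto elim!: eventually_mono simp: vector_smult_assoc mult_ac)
  show ?thesis
    using a f ae FT2_smult[of a ah "complex_of_real r"] L2_scaleR[of a r]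
    by (simp add: specpart_def smult_of_real_spinor)
qed

lemma En_scaleR: "En \<theta> (\<lambda>\<xi>. r *\<^sub>R ah \<xi>) = r\<^sup>2 * En \<theta> ah"
  by (simp add: En_def power_mult_distrib mult.left_commute[of _ "r\<^sup>2"])

lemma potE_scaleR: "potE V \<theta> (\<lambda>\<xi>. r *\<^sub>R a \<xi>) = r\<^sup>2 * potE V \<theta> a"
  by (simp add: potE_def power_mult_distrib mult.left_commute[of _ "r\<^sup>2"])

text \<open>This is where the gap (-1, 1) in the spectrum of the free operator enters.\<close>

lemma L2norm_le_En:
  assumes a: "specpart \<sigma> a ah" shows "(L2norm a)\<^sup>2 \<le> En 1 ah"
proof -
  have L: "L2 a" "FT2 a ah" "finE 1 ah" using a finE_mono[of 2 ah 1] by (auto simp: specpart_def)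
  have "(L2norm a)\<^sup>2 = (\<integral>\<xi>. (norm (ah \<xi>))\<^sup>2 \<partial>lborel)"
    using FT2_isometry[OF L(1,2)] by (simp add: L2norm_power2)
  also have "\<dots> \<le> En 1 ah"
    unfolding En_def
  proof (rule integral_mono[OF L2_integrable[OF FT2_L2[OF L(2)]]])
    show "integrable lborel (\<lambda>\<xi>. wt 1 \<xi> * (norm (ah \<xi>))\<^sup>2)" using L(3) by (simp add: finE_def)
    show "(norm (ah \<xi>))\<^sup>2 \<le> wt 1 \<xi> * (norm (ah \<xi>))\<^sup>2" for \<xi>
      using mult_right_mono[OF wt_1_ge[of \<xi>], of "(norm (ah \<xi>))\<^sup>2"] by simp
  qed
  finally show ?thesis .
qed

text \<open>A relative form bound with factor 1/2, obtained by taking the upper threshold in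
  \<open>potE_bound\<close> large. The factor 1/2 allows the potential terms to be absorbed into the
  energy.\<close>

lemma energy_bounded:
  assumes V: "tail_bound V C s"
  shows "\<exists>B. \<forall>a ah \<sigma>. specpart \<sigma> a ah \<longrightarrow> L2norm a \<le> 1 \<longrightarrow> potE V 1 a \<le> B + En 1 ah / 2"
proof -
  have [measurable]: "V \<in> borel_measurable borel" using V by (simp add: tail_bound_def)
  obtain K \<delta> where K: "0 \<le> K" "0 < \<delta>" and
    "\<forall>u uh. L2 u \<longrightarrow> FT2 u uh \<longrightarrow> finE 1 uh \<longrightarrow> integrable lborel (\<lambda>x. \<bar>V x\<bar> powr 1 * (norm (u x))\<^sup>2)" and
    bd0: "\<forall>e M u uh. 0 < e \<longrightarrow> M \<ge> 1 \<longrightarrow> L2 u \<longrightarrow> FT2 u uh \<longrightarrow> finE 1 uh \<longrightarrow>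
       potE V 1 u \<le> e powr 1 * (L2norm u)\<^sup>2 + M powr 1 * massOn {x. e < \<bar>V x\<bar>} u + K * M powr (-\<delta>) * En 1 uh"
    using potE_bound[OF V, of 1, simplified] by (elim exE conjE) (rule that; simp)
  note bd = bd0[rule_format]
  have "((\<lambda>M. K * M powr (-\<delta>)) \<longlongrightarrow> K * 0) at_top"
    using K(2) by (intro tendsto_intros tendsto_neg_powr filterlim_ident) auto
  then have "\<forall>\<^sub>F M in at_top. K * M powr (-\<delta>) < 1 / 2"
    by (intro order_tendstoD(2)[where y=0]) auto
  then have "\<forall>\<^sub>F M in at_top. K * M powr (-\<delta>) < 1 / 2 \<and> M \<ge> 1"
    using eventually_ge_at_top[of "1::real"] by (rule eventually_conj)
  then obtain M where M: "K * M powr (-\<delta>) < 1 / 2" "M \<ge> 1"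
    unfolding eventually_at_top_linorder by blast
  show ?thesis
  proof (intro exI[of _ "1 + M"] allI impI)
    fix a ah \<sigma> assume a: "specpart \<sigma> a ah" and n: "L2norm a \<le> 1"
    have L: "L2 a" "FT2 a ah" "finE 1 ah" using a finE_mono[of 2 ah 1] by (auto simp: specpart_def)
    have n2: "(L2norm a)\<^sup>2 \<le> 1" using n by (simp add: power_le_one)
    have A: "{x. 1 < \<bar>V x\<bar>} \<in> sets borel" by measurable
    have "M * massOn {x. 1 < \<bar>V x\<bar>} a \<le> M * 1"
      using massOn_integrable(3)[OF L(1) A] n2 M by (intro mult_left_mono) auto
    moreover have "K * M powr (-\<delta>) * En 1 ah \<le> (1/2) * En 1 ah"
      using M En_nonneg by (intro mult_right_mono) auto
    moreover have "potE V 1 a \<le> (L2norm a)\<^sup>2 + M * massOn {x. 1 < \<bar>V x\<bar>} a + K * M powr (-\<delta>) * En 1 ah"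
      using bd[OF _ M(2) L, of 1] M(2) by simp
    ultimately show "potE V 1 a \<le> 1 + M + En 1 ah / 2" using n2 by linarith
  qed
qed

lemma no_spurious_sequence:
  assumes V: "tail_bound V C s" and lam: "\<bar>lam\<bar> < 1" and mu: "\<mu> \<longlonglongrightarrow> complex_of_real lam"
    and a: "\<And>n. specpart 1 (a n) (ah n)" and b: "\<And>n. specpart (-1) (b n) (bh n)"
    and nrm: "\<And>n. (L2norm (a n))\<^sup>2 + (L2norm (b n))\<^sup>2 = 1"
    and en: "\<And>n. En 1 (ah n) + En 1 (bh n) \<le> cmod (\<mu> n) + potE V 1 (a n) + potE V 1 (b n)"
    and weak: "\<And>f. L2 f \<Longrightarrow> (\<lambda>n. ip f (\<lambda>x. a n x + b n x)) \<longlonglongrightarrow> 0"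
  shows False
proof -
  have La: "L2 (a n)" "FT2 (a n) (ah n)" "finE 1 (ah n)" and Lb: "L2 (b n)" "FT2 (b n) (bh n)" "finE 1 (bh n)" for n
    using a[of n] b[of n] finE_mono[of 2 _ 1] by (auto simp: specpart_def)
  have na: "L2norm (a n) \<le> 1" "L2norm (b n) \<le> 1" for n
  proof -
    have "(L2norm (a n))\<^sup>2 \<le> 1\<^sup>2" "(L2norm (b n))\<^sup>2 \<le> 1\<^sup>2"
      unfolding one_power2
      using nrm[of n] zero_le_power2[of "L2norm (a n)"] zero_le_power2[of "L2norm (b n)"] by linarith+
    then show "L2norm (a n) \<le> 1" "L2norm (b n) \<le> 1"
      using power2_le_imp_le[OF _ zero_le_one] by blast+
  qed
  have mu': "(\<lambda>n. cmod (\<mu> n)) \<longlonglongrightarrow> \<bar>lam\<bar>" using tendsto_norm[OF mu] by simp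
  then have "Bseq (\<lambda>n. cmod (\<mu> n))" by (rule convergent_imp_Bseq[OF convergentI])
  then obtain K where K: "\<And>n. cmod (\<mu> n) \<le> K" unfolding Bseq_def by auto
  obtain B where B: "\<forall>a ah \<sigma>. specpart \<sigma> a ah \<longrightarrow> L2norm a \<le> 1 \<longrightarrow> potE V 1 a \<le> B + En 1 ah / 2"
    using energy_bounded[OF V] by blast
  have bnd: "En 1 (ah n) \<le> 2 * K + 4 * B" "En 1 (bh n) \<le> 2 * K + 4 * B" for n
  proof -
    have "potE V 1 (a n) \<le> B + En 1 (ah n) / 2" "potE V 1 (b n) \<le> B + En 1 (bh n) / 2"
      using B a b na by blast+
    \<comment> \<open>Half of the total energy is absorbed on the left; what remains,
      \<open>K + 2 * B\<close>, is doubled.\<close>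
    then have "En 1 (ah n) + En 1 (bh n) \<le> 2 * K + 4 * B" using en[of n] K[of n] by linarith
    then show "En 1 (ah n) \<le> 2 * K + 4 * B" "En 1 (bh n) \<le> 2 * K + 4 * B"
      using En_nonneg[of 1 "ah n"] En_nonneg[of 1 "bh n"] by linarith+
  qed
  have weak': "(\<lambda>n. ip f (\<lambda>x. b n x + a n x)) \<longlonglongrightarrow> 0" if "L2 f" for f
    using weak[OF that] by (simp add: add.commute)
  have sa': "specpart (- (-1)) (a n) (ah n)" for n using a by simp
  have lowa: "(\<lambda>n. lowpass N (ah n) x) \<longlonglongrightarrow> 0" for N x
    by (rule specpart_lowpass_tendsto[OF _ a b weak]) simp_all
  have lowb: "(\<lambda>n. lowpass N (bh n) x) \<longlonglongrightarrow> 0" for N x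
    by (rule specpart_lowpass_tendsto[OF _ b sa' weak']) simp_all
  have pa: "(\<lambda>n. potE V 1 (a n)) \<longlonglongrightarrow> 0"
    by (rule potE_tendsto[OF V _ _ La na(1) bnd(1) massOn_tendsto_lowpass[OF La bnd(1) _ _ lowa]]) simp_all
  have pb: "(\<lambda>n. potE V 1 (b n)) \<longlonglongrightarrow> 0"
    by (rule potE_tendsto[OF V _ _ Lb na(2) bnd(2) massOn_tendsto_lowpass[OF Lb bnd(2) _ _ lowb]]) simp_all
  have "1 \<le> cmod (\<mu> n) + potE V 1 (a n) + potE V 1 (b n)" for n
    using nrm[of n] en[of n] L2norm_le_En[OF a[of n]] L2norm_le_En[OF b[of n]] by linarith
  moreover have "(\<lambda>n. cmod (\<mu> n) + potE V 1 (a n) + potE V 1 (b n)) \<longlonglongrightarrow> \<bar>lam\<bar> + 0 + 0"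
    by (intro tendsto_add mu' pa pb)
  ultimately have "1 \<le> \<bar>lam\<bar> + 0 + 0" by (intro LIMSEQ_le_const) auto
  then show False using lam by simp
qed

lemma Dop_symmetric:
  assumes V: "tail_bound V C s" and w: "H1 w" "FT2 w wh" and v: "H1 v" "FT2 v vh"
  shows "ip w (Dop V v) = ip (Dop V w) v"
proof -
  note Vw = mult_V_L2(1)[OF V H1_L2[OF w(1)] w(2) H1_finE[OF w]] and Vv = mult_V_L2(1)[OF V H1_L2[OF v(1)] v(2) H1_finE[OF v]]
  show ?thesis
    unfolding Dop_eq[abs_def]
    by (simp add: ip_add_right[OF FT2_D0op(1)[OF v] Vv H1_L2[OF w(1)]] ip_add_left[OF FT2_D0op(1)[OF w] Vw H1_L2[OF v(1)]]
        D0op_inner[OF w v] ip_mult_V_swap)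
qed

text \<open>Surjectivity writes \<open>f\<close> as the shifted operator applied to some
  \<open>u\<close>, and density replaces \<open>u\<close> by a vector \<open>w\<close> of one fixed
  space. For that \<open>w\<close> the Galerkin equation turns the pairing into one with factor
  \<open>\<nu> n - lam\<close>, which tends to 0.\<close>

lemma weak_convergence:
  assumes V: "tail_bound V C s" and res: "in_resolvent V lam" and f: "L2 f"
    and W: "\<And>m w. w \<in> W m \<Longrightarrow> H1 w \<and> (\<exists>wh. FT2 w wh)"
    and dense: "\<And>u \<epsilon>. H1 u \<Longrightarrow> \<epsilon> > 0 \<Longrightarrow> \<exists>n. \<exists>w\<in>W n.
             L2norm (\<lambda>x. u x - w x) + L2norm (\<lambda>x. Dop V u x - Dop V w x) < \<epsilon>"
    and v: "\<And>n. L2 (v n)" "\<And>n. L2norm (v n) \<le> M"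
    and eq: "\<And>m n w. m \<le> n \<Longrightarrow> w \<in> W m \<Longrightarrow> ip (Dop V w) (v n) = ip w (\<lambda>x. \<nu> n *s v n x)"
    and nu: "\<nu> \<longlonglongrightarrow> complex_of_real lam"
  shows "(\<lambda>n. ip f (v n)) \<longlonglongrightarrow> 0"
proof (rule tendsto_rabs_zero_cancel, rule tendsto_zero_approx)
  have Vm [measurable]: "V \<in> borel_measurable borel" using V by (simp add: tail_bound_def)
  have M: "0 \<le> M" using v(2)[of 0] L2norm_nonneg order_trans by blast
  fix e :: real assume e: "e > 0"
  obtain u where u: "H1 u" and ae: "AE x in lborel. Dop V u x - complex_of_real lam *s u x = f x"
    using res f unfolding in_resolvent_def by blast
  note uL = H1_L2[OF u]
  have fu: "L2 (\<lambda>x. f x + complex_of_real lam *s u x)" by (intro L2_add L2_smult f uL)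
  note [measurable] = L2_measurable[OF f] L2_measurable[OF uL] L2_measurable[OF H1_wd(1)[OF u]]
  have Dm [measurable]: "Dop V u \<in> borel_measurable borel"
    unfolding Dop_def[abs_def] by measurable
  \<comment> \<open>No Fourier transform of \<open>u\<close> is at hand, so square integrability of
    its image is read off from the equation that it solves.\<close>
  have DL: "L2 (Dop V u)"
  proof (rule L2_dominated(1)[OF fu Dm, of 1])
    show "AE x in lborel. norm (Dop V u x) \<le> 1 * norm (f x + complex_of_real lam *s u x)"
      using ae by eventually_elim (simp add: diff_eq_eq)
  qed simp
  \<comment> \<open>Replacing \<open>u\<close> by \<open>w\<close> costs
    \<open>(1 + \<bar>lam\<bar>) * d\<close> in norm, paired with a vector of norm at most
    \<open>M\<close>; the summand 1 keeps the denominator positive.\<close>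
  define d where "d = e / ((1 + \<bar>lam\<bar>) * (M + 1))"
  have pos: "0 < (1 + \<bar>lam\<bar>) * (M + 1)" using M by (intro mult_pos_pos) auto
  have d: "d > 0" using e pos by (simp add: d_def)
  obtain m w where w: "w \<in> W m" and wd: "L2norm (\<lambda>x. u x - w x) + L2norm (\<lambda>x. Dop V u x - Dop V w x) < d"
    using dense[OF u d] by blast
  obtain wh where wH: "H1 w" "FT2 w wh" using W[OF w] by blast
  note wL = H1_L2[OF wH(1)] and DwL = Dop_L2[OF V wH]
  let ?g = "\<lambda>x. Dop V w x - complex_of_real lam *s w x"
  have gL: "L2 ?g" by (intro L2_diff L2_smult DwL wL)
  have fg: "L2norm (\<lambda>x. f x - ?g x) \<le> (1 + \<bar>lam\<bar>) * d"
  proof -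
    let ?A = "\<lambda>x. Dop V u x - Dop V w x" and ?B = "\<lambda>x. complex_of_real (- lam) *s (u x - w x)"
    have AL: "L2 ?A" and BL: "L2 ?B" by (intro L2_diff L2_smult DL DwL uL wL)+
    have "L2norm (\<lambda>x. f x - ?g x) = L2norm (\<lambda>x. ?A x + ?B x)"
    proof (rule L2norm_cong_AE)
      show "AE x in lborel. f x - ?g x = ?A x + ?B x"
        using ae by eventually_elim (auto simp: vec_eq_iff algebra_simps)
    qed (use L2_measurable[OF L2_diff[OF f gL]] L2_measurable[OF L2_add[OF AL BL]] in auto)
    also have "\<dots> \<le> L2norm ?A + L2norm ?B" by (rule L2norm_triangle[OF AL BL])
    also have "L2norm ?B = \<bar>lam\<bar> * L2norm (\<lambda>x. u x - w x)" by (simp only: L2norm_smult norm_of_real abs_minus_cancel)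
    also have "L2norm ?A + \<bar>lam\<bar> * L2norm (\<lambda>x. u x - w x) \<le> d + \<bar>lam\<bar> * d"
      using wd L2norm_nonneg[of ?A] L2norm_nonneg[of "\<lambda>x. u x - w x"] by (intro add_mono mult_left_mono) linarith+
    finally show ?thesis by (simp add: algebra_simps)
  qed
  define b where "b n = (if n < m then \<bar>ip f (v n)\<bar> else L2norm w * (cmod (\<nu> n - complex_of_real lam) * M))" for n
  have "(\<lambda>n. cmod (\<nu> n - complex_of_real lam)) \<longlonglongrightarrow> 0" by (rule tendsto_norm_zero[OF LIM_zero[OF nu]])
  then have "(\<lambda>n. L2norm w * (cmod (\<nu> n - complex_of_real lam) * M)) \<longlonglongrightarrow> 0"
    by (intro tendsto_mult_right_zero tendsto_mult_left_zero)
  then have "b \<longlonglongrightarrow> 0"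
    by (rule Lim_transform_eventually) (auto simp: b_def eventually_sequentially intro!: exI[of _ m])
  moreover have "\<bar>ip f (v n)\<bar> \<le> e + b n" for n
  proof (cases "n < m")
    case True
    then show ?thesis using e by (simp add: b_def)
  next
    case False
    have sL: "L2 (\<lambda>x. (\<nu> n - complex_of_real lam) *s v n x)" by (intro L2_smult v)
    have "ip f (v n) = ip (\<lambda>x. f x - ?g x) (v n) + ip ?g (v n)" using ip_diff_left[OF f gL v(1)] by simp
    also have "ip ?g (v n) = ip w (\<lambda>x. (\<nu> n - complex_of_real lam) *s v n x)"
    proof -
      have "ip ?g (v n) = ip w (\<lambda>x. \<nu> n *s v n x) - ip (\<lambda>x. complex_of_real lam *s w x) (v n)"
        using ip_diff_left[OF DwL L2_smult[OF wL] v(1)] eq[OF _ w, of n] False by simp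
      also have "ip (\<lambda>x. complex_of_real lam *s w x) (v n) = ip w (\<lambda>x. complex_of_real lam *s v n x)"
        by (simp add: ip_def smult_of_real_spinor)
      also have "ip w (\<lambda>x. \<nu> n *s v n x) - \<dots> = ip w (\<lambda>x. \<nu> n *s v n x - complex_of_real lam *s v n x)"
        by (rule ip_diff_right[symmetric]) (intro L2_smult v wL)+
      finally show ?thesis by (simp add: vector_sub_rdistrib)
    qed
    finally have "\<bar>ip f (v n)\<bar> \<le> \<bar>ip (\<lambda>x. f x - ?g x) (v n)\<bar> + \<bar>ip w (\<lambda>x. (\<nu> n - complex_of_real lam) *s v n x)\<bar>"
      by linarith
    also have "\<bar>ip (\<lambda>x. f x - ?g x) (v n)\<bar> \<le> ((1 + \<bar>lam\<bar>) * d) * (M + 1)"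
      using fg v(2)[of n] d M
      by (intro order_trans[OF ip_Cauchy_Schwarz[OF L2_diff[OF f gL] v(1)]] mult_mono) auto
    also have "\<dots> = ((1 + \<bar>lam\<bar>) * (M + 1)) * d" by (simp only: mult_ac)
    also have "\<dots> = e"
      unfolding d_def times_divide_eq_right by (rule nonzero_mult_div_cancel_left[OF less_imp_neq[OF pos, symmetric]])
    also have "\<bar>ip w (\<lambda>x. (\<nu> n - complex_of_real lam) *s v n x)\<bar> \<le> L2norm w * (cmod (\<nu> n - complex_of_real lam) * M)"
    proof (rule order_trans[OF ip_Cauchy_Schwarz[OF wL sL]], rule mult_left_mono)
      show "L2norm (\<lambda>x. (\<nu> n - complex_of_real lam) *s v n x) \<le> cmod (\<nu> n - complex_of_real lam) * M"
        unfolding L2norm_smult by (rule mult_left_mono[OF v(2)]) simp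
    qed simp
    finally show ?thesis using False by (simp add: b_def)
  qed
  ultimately show "\<exists>b. b \<longlonglongrightarrow> 0 \<and> (\<forall>n. \<bar>ip f (v n)\<bar> \<le> e + b n)" by blast
qed simp

theorem mainTheorem10:
  fixes V :: "real ^ 3 \<Rightarrow> real" and p r q :: real
  assumes "6 < p" and "3 < r" and "r \<le> 6" and "2 < q"
    and "Xclass_eps p r q V"
  shows "Spu V = {}"
proof (rule equals0I)
  fix lam assume "lam \<in> Spu V"
  then obtain Vp Vm :: "nat \<Rightarrow> wavefn set" and \<mu> where nspec: "lam \<notin> spec V"
    and Vp': "\<forall>n. fin_subspace (Vp n) \<and> Vp n \<subseteq> Pplus_space \<inter> Collect H1"
    and Vm': "\<forall>n. fin_subspace (Vm n) \<and> Vm n \<subseteq> Pminus_space \<inter> Collect H1"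
    and mono': "\<forall>n. Vp n \<subseteq> Vp (Suc n) \<and> Vm n \<subseteq> Vm (Suc n)"
    and dense': "\<forall>u. H1 u \<longrightarrow> (\<forall>\<epsilon>>0. \<exists>n. \<exists>w\<in>dsum (Vp n) (Vm n).
             L2norm (\<lambda>x. u x - w x) + L2norm (\<lambda>x. Dop V u x - Dop V w x) < \<epsilon>)"
    and ev: "\<forall>\<^sub>F n in sequentially. \<mu> n \<in> compr_spec V (dsum (Vp n) (Vm n))"
    and mu: "\<mu> \<longlonglongrightarrow> complex_of_real lam"
    unfolding Spu_def mem_Collect_eq by (elim conjE exE) (rule that)
  have Vp: "fin_subspace (Vp n)" "Vp n \<subseteq> Pplus_space \<inter> Collect H1"
    and Vm: "fin_subspace (Vm n)" "Vm n \<subseteq> Pminus_space \<inter> Collect H1"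
    and mono: "Vp n \<subseteq> Vp (Suc n)" "Vm n \<subseteq> Vm (Suc n)" for n
    using Vp' Vm' mono' by auto
  note dense = dense'[rule_format]
  obtain C where T: "tail_bound V C (min p r)"
    using Xclass_eps_tail_bound[OF assms(5)] assms(1,2) by auto
  have res: "in_resolvent V lam" using nspec by (simp add: spec_def)
  have lam: "\<bar>lam\<bar> < 1" by (rule resolvent_abs_less_1[OF T res])
  obtain N0 where N0: "\<And>n. n \<ge> N0 \<Longrightarrow> \<mu> n \<in> compr_spec V (dsum (Vp n) (Vm n))"
    using ev unfolding eventually_sequentially by blast
  \<comment> \<open>Compressed eigenvalues are given only eventually; after the shift an eigenvector
    exists for every index.\<close>
  define \<nu> where "\<nu> n = \<mu> (n + N0)" for n
  have nu: "\<nu> \<longlonglongrightarrow> complex_of_real lam" unfolding \<nu>_def by (rule LIMSEQ_ignore_initial_segment[OF mu])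
  \<comment> \<open>Collects all that the limit needs from one normalised eigenvector. Its Galerkin
    equation is kept against the spaces of index at most n, so any fixed test vector is eventually
    covered, and the operator stands on the test vector, so that only pairings with the eigenvector
    remain.\<close>
  define R where "R n a b ah bh \<longleftrightarrow> specpart 1 a ah \<and> specpart (-1) b bh \<and> (L2norm a)\<^sup>2 + (L2norm b)\<^sup>2 = 1 \<and>
      En 1 ah + En 1 bh \<le> cmod (\<nu> n) + potE V 1 a + potE V 1 b \<and>
      (\<forall>m\<le>n. \<forall>w\<in>dsum (Vp m) (Vm m). ip (Dop V w) (\<lambda>x. a x + b x) = ip w (\<lambda>x. \<nu> n *s (a x + b x)))" for n a b ah bh
  have ds: "H1 w \<and> (\<exists>wh. FT2 w wh)" if wd: "w \<in> dsum (Vp m) (Vm m)" for m w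
  proof -
    obtain a b where w: "w = (\<lambda>x. a x + b x)" and a: "a \<in> Vp m" and b: "b \<in> Vm m"
      using wd by (auto simp: dsum_def)
    obtain ah where ah: "FT2 a ah" "L2 a" "H1 a"
      using a Vp(2)[of m] by (auto simp: Pplus_space_def)
    obtain bh where bh: "FT2 b bh" "L2 b" "H1 b"
      using b Vm(2)[of m] by (auto simp: Pminus_space_def)
    show ?thesis unfolding w using H1_add[OF ah(3) bh(3)] FT2_add[OF ah(2,1) bh(2,1)] by blast
  qed
  have ex: "\<exists>a b ah bh. R n a b ah bh" for n
  proof -
    define k where "k = n + N0"
    have "\<nu> n \<in> compr_spec V (dsum (Vp k) (Vm k))" using N0[of k] by (simp add: \<nu>_def k_def)
    then obtain v where v: "v \<in> dsum (Vp k) (Vm k)" and nz: "L2norm v \<noteq> 0"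
      and g: "\<And>w. w \<in> dsum (Vp k) (Vm k) \<Longrightarrow> L2inner w (\<lambda>x. Dop V v x - \<nu> n *s v x) = 0"
      unfolding compr_spec_def by blast
    obtain a b where v_eq: "v = (\<lambda>x. a x + b x)" and a: "a \<in> Vp k" and b: "b \<in> Vm k"
      using v by (auto simp: dsum_def)
    have aP: "a \<in> Pplus_space" "H1 a" and bP: "b \<in> Pminus_space" "H1 b"
      using a b Vp(2)[of k] Vm(2)[of k] by auto
    obtain ah where ah: "specpart 1 a ah" using Pplus_specpart[OF aP] by blast
    obtain bh where bh: "specpart (-1) b bh" using Pminus_specpart[OF bP] by blast
    have aL: "L2 a" "FT2 a ah" and bL: "L2 b" "FT2 b bh" using ah bh by (auto simp: specpart_def)
    have "(\<lambda>x. a x + 0) \<in> dsum (Vp k) (Vm k)"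
      unfolding dsum_def using a fin_subspace_zero[OF Vm(1), of k] by fast
    then have ga: "L2inner a (\<lambda>x. Dop V (\<lambda>x. a x + b x) x - \<nu> n *s (a x + b x)) = 0"
      using g[of a] by (simp add: v_eq)
    have "(\<lambda>x. 0 + b x) \<in> dsum (Vp k) (Vm k)"
      unfolding dsum_def using b fin_subspace_zero[OF Vp(1), of k] by fast
    then have gb: "L2inner b (\<lambda>x. Dop V (\<lambda>x. a x + b x) x - \<nu> n *s (a x + b x)) = 0"
      using g[of b] by (simp add: v_eq)
    note en = galerkin_energy[OF T ah aP(2) bh bP(2) ga gb]
    have vH: "H1 v" unfolding v_eq by (rule H1_add[OF aP(2) bP(2)])
    have vF: "FT2 v (\<lambda>\<xi>. ah \<xi> + bh \<xi>)" unfolding v_eq by (rule FT2_add[OF aL bL])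
    \<comment> \<open>Energies and potential terms are quadratic, so normalisation multiplies the
      whole estimate by \<open>r\<^sup>2\<close> and turns the norm factor of the eigenvalue term
      into 1.\<close>
    define r where "r = 1 / L2norm v"
    have r: "r\<^sup>2 * (L2norm v)\<^sup>2 = 1" using nz by (simp add: r_def power_divide)
    have pair: "ip (Dop V w) v = ip w (\<lambda>x. \<nu> n *s v x)" if m: "m \<le> n" and w: "w \<in> dsum (Vp m) (Vm m)" for m w
    proof -
      have "m \<le> k" using m by (simp add: k_def)
      then have "Vp m \<subseteq> Vp k" "Vm m \<subseteq> Vm k"
        using lift_Suc_mono_le[of Vp m k] lift_Suc_mono_le[of Vm m k] mono by blast+
      then have wk: "w \<in> dsum (Vp k) (Vm k)" using w unfolding dsum_def by blast
      obtain wh where wH: "H1 w" "FT2 w wh" using ds[OF w] by blast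
      note DL = Dop_L2[OF T vH vF] and sL = L2_smult[OF H1_L2[OF vH], of "\<nu> n"]
      have "ip w (\<lambda>x. Dop V v x - \<nu> n *s v x) = 0"
        using Re_L2inner[OF H1_L2[OF wH(1)] L2_diff[OF DL sL]] g[OF wk] by simp
      then show ?thesis
        using ip_diff_right[OF DL sL H1_L2[OF wH(1)]] Dop_symmetric[OF T wH vH vF] by simp
    qed
    have "R n (\<lambda>x. r *\<^sub>R a x) (\<lambda>x. r *\<^sub>R b x) (\<lambda>\<xi>. r *\<^sub>R ah \<xi>) (\<lambda>\<xi>. r *\<^sub>R bh \<xi>)"
      unfolding R_def
    proof (intro conjI allI impI ballI specpart_scaleR ah bh)
      have "(L2norm (\<lambda>x. r *\<^sub>R a x))\<^sup>2 + (L2norm (\<lambda>x. r *\<^sub>R b x))\<^sup>2 = r\<^sup>2 * ((L2norm a)\<^sup>2 + (L2norm b)\<^sup>2)"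
        by (simp add: L2norm_scaleR power_mult_distrib distrib_left)
      also have "\<dots> = 1" using en(2) r by (simp add: v_eq)
      finally show "(L2norm (\<lambda>x. r *\<^sub>R a x))\<^sup>2 + (L2norm (\<lambda>x. r *\<^sub>R b x))\<^sup>2 = 1" .
      have "r\<^sup>2 * (En 1 ah + En 1 bh) \<le> r\<^sup>2 * (cmod (\<nu> n) * (L2norm v)\<^sup>2 + potE V 1 a + potE V 1 b)"
        using en(1) by (intro mult_left_mono) (simp_all add: v_eq)
      also have "\<dots> = cmod (\<nu> n) * (r\<^sup>2 * (L2norm v)\<^sup>2) + r\<^sup>2 * potE V 1 a + r\<^sup>2 * potE V 1 b"
        by (simp add: algebra_simps)
      finally show "En 1 (\<lambda>\<xi>. r *\<^sub>R ah \<xi>) + En 1 (\<lambda>\<xi>. r *\<^sub>R bh \<xi>) \<le>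
          cmod (\<nu> n) + potE V 1 (\<lambda>x. r *\<^sub>R a x) + potE V 1 (\<lambda>x. r *\<^sub>R b x)"
        unfolding r En_scaleR potE_scaleR by (simp add: distrib_left)
    next
      fix m w assume "m \<le> n" "w \<in> dsum (Vp m) (Vm m)"
      note pr = pair[OF this]
      have sc: "\<nu> n *s (r *\<^sub>R z) = r *\<^sub>R (\<nu> n *s z)" for z :: spinor
        unfolding smult_of_real_spinor[symmetric] by (simp add: vector_smult_assoc mult.commute)
      show "ip (Dop V w) (\<lambda>x. r *\<^sub>R a x + r *\<^sub>R b x) = ip w (\<lambda>x. \<nu> n *s (r *\<^sub>R a x + r *\<^sub>R b x))"
        using pr unfolding scaleR_add_right[symmetric] sc ip_scaleR_right v_eq by simp
    qed
    then show ?thesis by blast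
  qed
  then obtain a b ah bh where R: "\<And>n. R n (a n) (b n) (ah n) (bh n)" by metis
  have sa: "specpart 1 (a n) (ah n)" and sb: "specpart (-1) (b n) (bh n)"
    and nrm: "(L2norm (a n))\<^sup>2 + (L2norm (b n))\<^sup>2 = 1"
    and en: "En 1 (ah n) + En 1 (bh n) \<le> cmod (\<nu> n) + potE V 1 (a n) + potE V 1 (b n)" for n
    using R[of n] by (simp_all add: R_def)
  have pair: "ip (Dop V w) (\<lambda>x. a n x + b n x) = ip w (\<lambda>x. \<nu> n *s (a n x + b n x))"
    if "m \<le> n" "w \<in> dsum (Vp m) (Vm m)" for m n w
    using R[of n] that unfolding R_def by blast
  let ?v = "\<lambda>n x. a n x + b n x"
  have aL: "L2 (a n)" and bL: "L2 (b n)" for n using sa[of n] sb[of n] by (auto simp: specpart_def)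
  have vL: "L2 (?v n)" for n by (rule L2_add[OF aL bL])
  have vn: "L2norm (?v n) \<le> 2" for n
  proof -
    have "(L2norm (a n))\<^sup>2 \<le> 1" "(L2norm (b n))\<^sup>2 \<le> 1"
      using nrm[of n] zero_le_power2[of "L2norm (a n)"] zero_le_power2[of "L2norm (b n)"] by linarith+
    then have "L2norm (a n) \<le> 1" "L2norm (b n) \<le> 1"
      using power2_le_imp_le[OF _ zero_le_one] unfolding one_power2 by blast+
    then show ?thesis using L2norm_triangle[OF aL bL, of n n] by linarith
  qed
  have weak: "(\<lambda>n. ip f (?v n)) \<longlonglongrightarrow> 0" if f: "L2 f" for f
    by (rule weak_convergence[where W="\<lambda>m. dsum (Vp m) (Vm m)", OF T res f ds dense vL vn pair nu])
  show False by (rule no_spurious_sequence[OF T lam nu sa sb nrm en weak])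
qed

end
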